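(* Let $P=UU^T\in\mathrm{Gr}(n,p)$ and $F=YY^T\in\mathrm{Cut}_P$ with $U,Y\in\mathrm{St}(n,p)$, and let $r$ denote the number of principal angles between $P$ and $F$ equal to $\frac{\pi}{2}$. Then $\Delta\in\mathrm{TCL}_P\subset T_P\mathrm{Gr}(n,p)$ is a minimizing solution of $$\mathrm{Exp}^{\mathrm{Gr}}_P(\Delta)=F \qquad (\ast)$$ if and only if its horizontal lift $\Delta^{\mathsf{hor}}_U$ is an output of the Extended Grassmann Logarithm procedure applied to $(U,Y)$. Moreover, for such a $\Delta$ consider a compact SVD $\Delta^{\mathsf{hor}}_U=\hat Q\Sigma R^T$ with singular values in descending order. Then the horizontal lifts of all other minimizing solutions of $(\ast)$ are given by $$(\Delta_W)^{\mathsf{hor}}_U:=\hat Q\,\Sigma\,\mathrm{diag}(W,I_{p-r})\,R^T,\qquad W\in\mathrm{O}(r),$$ where $\mathrm{diag}(W,I_{p-r})$ is the block diagonal matrix. The shortest geodesics between $P$ and $F$ are given by $$\gamma_W(t):=\mathrm{Exp}^{\mathrm{Gr}}_P(t\Delta_W)=\big[UR\,\mathrm{diag}(W^T,I_{p-r})\cos(t\Sigma)+\hat Q\sin(t\Sigma)\big].$$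
   Context: Let $1\le p\le n$ be integers. $\mathrm{St}(n,p)=\{U\in\mathbb{R}^{n\times p}: U^TU=I_p\}$. $\mathrm{Gr}(n,p)=\{P\in\mathbb{R}^{n\times n}: P^T=P,\ P^2=P,\ \mathrm{rank}\,P=p\}$, an embedded submanifold of the symmetric $n\times n$ matrices, with tangent space $T_P\mathrm{Gr}(n,p)=\{\Delta=\Delta^T: \Delta P+P\Delta=\Delta\}$ and Riemannian metric $g_P(\Delta_1,\Delta_2)=\frac12\mathrm{tr}(\Delta_1\Delta_2)$, with induced norm $\|\cdot\|$ and Riemannian distance $\mathrm{dist}$. For $X\in\mathrm{St}(n,p)$, $[X]$ denotes the class $\{XM: M\in\mathrm{O}(p)\}$, identified with the point $XX^T\in\mathrm{Gr}(n,p)$. For $P=UU^T$ with $U\in\mathrm{St}(n,p)$, the horizontal lift of $\Delta\in T_P\mathrm{Gr}(n,p)$ to $U$ is $\Delta^{\mathsf{hor}}_U:=\Delta U\in\mathrm{Hor}_U\mathrm{St}(n,p):=\{D\in\mathbb{R}^{n\times p}: U^TD=0\}$; this is a linear bijection $T_P\mathrm{Gr}(n,p)\to\mathrm{Hor}_U\mathrm{St}(n,p)$. $\mathrm{Exp}^{\mathrm{Gr}}_P$ is the Riemannian exponential map; explicitly $\mathrm{Exp}^{\mathrm{Gr}}_P(\Delta)=\exp_m([\Delta,P])\,P\,\exp_m(-[\Delta,P])$, with $\exp_m$ the matrix exponential and $[A,B]=AB-BA$ for square matrices. A compact SVD of $X\in\mathbb{R}^{n\times p}$ is $X=Q\Sigma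 V^T$ with $Q\in\mathrm{St}(n,p)$, $\Sigma\in\mathbb{R}^{p\times p}$ diagonal with nonnegative entries, $V\in\mathrm{O}(p)$. Functions $\sin,\cos,\arcsin$ of diagonal matrices act entrywise on the diagonal. The principal angles between $P=UU^T$ and $F=YY^T$ are $\theta_k=\arccos(s_k)\in[0,\frac\pi2]$, where $s_1\ge\dots\ge s_p$ are the singular values of $U^TY$. For nonzero $\Delta\in T_P\mathrm{Gr}(n,p)$ the cut time is $t_{\mathrm{cut}}(P,\Delta)=\sup\{b>0: t\mapsto\mathrm{Exp}^{\mathrm{Gr}}_P(t\Delta)\text{ restricted to }[0,b]\text{ is length-minimizing}\}$; the cut locus $\mathrm{Cut}_P$ is the set of all points $\mathrm{Exp}^{\mathrm{Gr}}_P(t_{\mathrm{cut}}(P,\Delta)\Delta)$. It is known that $\mathrm{Cut}_P=\{YY^T\in\mathrm{Gr}(n,p): Y\in\mathrm{St}(n,p),\ \mathrm{rank}(U^TY)<p\}$. The tangent cut locus is $\mathrm{TCL}_P=\{\Delta\in T_P\mathrm{Gr}(n,p): \|\Delta\|=t_{\mathrm{cut}}(P,\Delta/\|\Delta\|)\}$. A minimizing solution of $(\ast)$ is a $\Delta\in T_P\mathrm{Gr}(n,p)$ satisfying $(\ast)$ such that the geodesic $[0,1]\ni t\mapsto\mathrm{Exp}^{\mathrm{Gr}}_P(t\Delta)$ is a shortest curve from $P$ to $F$, i.e. $\|\Delta\|=\mathrm{dist}(P,F)$. The Extended Grassmann Logarithm procedure, with input $U,Y\in\mathrm{St}(n,p)$: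 1. choose an SVD $Y^TU=\widetilde Q\widetilde S\widetilde R^T$ (with $\widetilde Q,\widetilde R\in\mathrm{O}(p)$); 2. set $Y_*:=Y\widetilde Q\widetilde R^T$; 3. choose a compact SVD $(I_n-UU^T)Y_*=\hat Q\hat S R^T$; 4. set $\Sigma:=\arcsin(\hat S)$; 5. output $\hat Q\Sigma R^T$. A matrix is called an output of the procedure if it arises for some choice of the SVDs in steps 1 and 3. *)

theory Defs
  imports "HOL-Analysis.Analysis"
begin

text \<open>
  Real \<open>n \<times> p\<close> matrices have type \<^typ>\<open>real^'p^'n\<close>, so \<open>n = CARD('n)\<close> and \<open>p = CARD('p)\<close>. The
  column index type is linearly ordered wherever the order of singular values matters.
\<close>

section \<open>Matrix exponential and singular value decompositions\<close>

text \<open>The type class product and power on \<^typ>\<open>real^'n^'n\<close> are componentwise, hence the explicit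
  iteration of the matrix product.\<close>

definition matrix_exp :: "real^'n^'n \<Rightarrow> real^'n^'n" where
  "matrix_exp A = (\<Sum>k. (1 / fact k) *\<^sub>R (((**) A ^^ k) (mat 1)))"

definition commutator :: "real^'n^'n \<Rightarrow> real^'n^'n \<Rightarrow> real^'n^'n" where
  "commutator A B = A ** B - B ** A"

definition stiefel :: "(real^'p^'n) set" where
  "stiefel = {U. transpose U ** U = mat 1}"

definition diag :: "('p \<Rightarrow> real) \<Rightarrow> real^'p^'p" where
  "diag d = (\<chi> i j. if i = j then d i else 0)"

definition nonneg_diagonal :: "real^'p^'p \<Rightarrow> bool" where
  "nonneg_diagonal S \<longleftrightarrow> (\<forall>i j. i \<noteq> j \<longrightarrow> S $ i $ j = 0) \<and> (\<forall>i. 0 \<le> S $ i $ i)"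

definition descending_diagonal :: "real^('p::{finite,linorder})^('p::{finite,linorder}) \<Rightarrow> bool" where
  "descending_diagonal S \<longleftrightarrow> (\<forall>i j. i \<le> j \<longrightarrow> S $ j $ j \<le> S $ i $ i)"

definition diag_apply :: "(real \<Rightarrow> real) \<Rightarrow> real^'p^'p \<Rightarrow> real^'p^'p" where
  "diag_apply f S = diag (\<lambda>i. f (S $ i $ i))"

text \<open>The diagonal entries are not assumed to be sorted in either kind of decomposition.\<close>

definition square_svd :: "real^'p^'p \<Rightarrow> real^'p^'p \<Rightarrow> real^'p^'p \<Rightarrow> real^'p^'p \<Rightarrow> bool" where
  "square_svd A Q S R \<longleftrightarrow>
     orthogonal_matrix Q \<and> nonneg_diagonal S \<and> orthogonal_matrix R \<and> A = Q ** S ** transpose R"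

definition compact_svd :: "real^'p^'n \<Rightarrow> real^'p^'n \<Rightarrow> real^'p^'p \<Rightarrow> real^'p^'p \<Rightarrow> bool" where
  "compact_svd X Q S V \<longleftrightarrow>
     Q \<in> stiefel \<and> nonneg_diagonal S \<and> orthogonal_matrix V \<and> X = Q ** S ** transpose V"

definition singular_values :: "real^('p::{finite,linorder})^('p::{finite,linorder}) \<Rightarrow> (('p::{finite,linorder}) \<Rightarrow> real) \<Rightarrow> bool" where
  "singular_values A s \<longleftrightarrow> antimono s \<and> (\<exists>Q R. square_svd A Q (diag s) R)"

text \<open>\<open>\<theta>\<close> lists, in ascending order and with multiplicity, the principal angles between
  \<open>UU\<^sup>T\<close> and \<open>YY\<^sup>T\<close>.\<close>

definition principal_angles ::
    "real^('p::{finite,linorder})^'n \<Rightarrow> real^('p::{finite,linorder})^'n \<Rightarrow> (('p::{finite,linorder}) \<Rightarrow> real) \<Rightarrow> bool" where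
  "principal_angles U Y \<theta> \<longleftrightarrow>
     (\<exists>s. singular_values (transpose U ** Y) s \<and> (\<forall>k. \<theta> k = arccos (s k)))"

section \<open>The Grassmannian as a Riemannian manifold\<close>

definition grassmann :: "nat \<Rightarrow> (real^'n^'n) set" where
  "grassmann p = {P. transpose P = P \<and> P ** P = P \<and> rank P = p}"

text \<open>The equivalence class \<open>[X]\<close> of \<open>X \<in> St(n,p)\<close>, identified with \<open>XX\<^sup>T\<close>.\<close>

definition proj :: "real^'p^'n \<Rightarrow> real^'n^'n" where
  "proj X = X ** transpose X"

definition tangent :: "real^'n^'n \<Rightarrow> (real^'n^'n) set" where
  "tangent P = {D. transpose D = D \<and> D ** P + P ** D = D}"

definition hor_lift :: "real^'p^'n \<Rightarrow> real^'n^'n \<Rightarrow> real^'p^'n" where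
  "hor_lift U D = D ** U"

definition gr_metric :: "real^'n^'n \<Rightarrow> real^'n^'n \<Rightarrow> real" where
  "gr_metric D E = 1 / 2 * trace (D ** E)"

definition gr_norm :: "real^'n^'n \<Rightarrow> real" where
  "gr_norm D = sqrt (gr_metric D D)"

definition gr_speed :: "real \<Rightarrow> real \<Rightarrow> (real \<Rightarrow> real^'n^'n) \<Rightarrow> real \<Rightarrow> real" where
  "gr_speed a b \<gamma> t = gr_norm (vector_derivative \<gamma> (at t within {a..b}))"

definition curve_length :: "real \<Rightarrow> real \<Rightarrow> (real \<Rightarrow> real^'n^'n) \<Rightarrow> real" where
  "curve_length a b \<gamma> = integral {a..b} (gr_speed a b \<gamma>)"

text \<open>The library's piecewise \<open>C\<^sup>1\<close> curves may have unbounded speed near a break point and hence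
  infinite length, in which case \<^const>\<open>integral\<close> would return \<open>0\<close>. Such curves do not
  contribute to the infimum defining the distance and are excluded by the integrability condition.\<close>

definition gr_curve :: "nat \<Rightarrow> real^'n^'n \<Rightarrow> real^'n^'n \<Rightarrow> (real \<Rightarrow> real^'n^'n) \<Rightarrow> bool" where
  "gr_curve p P F \<gamma> \<longleftrightarrow>
     \<gamma> piecewise_C1_differentiable_on {0..1} \<and> gr_speed 0 1 \<gamma> integrable_on {0..1} \<and>
     \<gamma> ` {0..1} \<subseteq> grassmann p \<and> \<gamma> 0 = P \<and> \<gamma> 1 = F"

definition gr_dist :: "nat \<Rightarrow> real^'n^'n \<Rightarrow> real^'n^'n \<Rightarrow> real" where
  "gr_dist p P F = Inf {curve_length 0 1 \<gamma> | \<gamma>. gr_curve p P F \<gamma>}"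

definition length_minimizing :: "nat \<Rightarrow> real \<Rightarrow> real \<Rightarrow> (real \<Rightarrow> real^'n^'n) \<Rightarrow> bool" where
  "length_minimizing p a b \<gamma> \<longleftrightarrow> curve_length a b \<gamma> = gr_dist p (\<gamma> a) (\<gamma> b)"

definition gr_exp :: "real^'n^'n \<Rightarrow> real^'n^'n \<Rightarrow> real^'n^'n" where
  "gr_exp P D = matrix_exp (commutator D P) ** P ** matrix_exp (- commutator D P)"

text \<open>Only used for nonzero tangent vectors \<open>D\<close>; the set is then nonempty and bounded above, because
  the Grassmannian is compact.\<close>

definition cut_time :: "nat \<Rightarrow> real^'n^'n \<Rightarrow> real^'n^'n \<Rightarrow> real" where
  "cut_time p P D = Sup {b. 0 < b \<and> length_minimizing p 0 b (\<lambda>t. gr_exp P (t *\<^sub>R D))}"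

definition cut_locus :: "nat \<Rightarrow> real^'n^'n \<Rightarrow> (real^'n^'n) set" where
  "cut_locus p P = {gr_exp P (cut_time p P D *\<^sub>R D) | D. D \<in> tangent P \<and> D \<noteq> 0}"

definition tangent_cut_locus :: "nat \<Rightarrow> real^'n^'n \<Rightarrow> (real^'n^'n) set" where
  "tangent_cut_locus p P =
     {D \<in> tangent P. D \<noteq> 0 \<and> gr_norm D = cut_time p P ((1 / gr_norm D) *\<^sub>R D)}"

definition minimizing_solution ::
    "nat \<Rightarrow> real^'n^'n \<Rightarrow> real^'n^'n \<Rightarrow> real^'n^'n \<Rightarrow> bool" where
  "minimizing_solution p P F D \<longleftrightarrow>
     D \<in> tangent P \<and> gr_exp P D = F \<and> gr_norm D = gr_dist p P F"

text \<open>A curve is only considered on \<open>[0,1]\<close>; its values outside are irrelevant.\<close>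

definition shortest_geodesic ::
    "nat \<Rightarrow> real^'n^'n \<Rightarrow> real^'n^'n \<Rightarrow> (real \<Rightarrow> real^'n^'n) \<Rightarrow> bool" where
  "shortest_geodesic p P F \<gamma> \<longleftrightarrow>
     (\<exists>D \<in> tangent P. \<forall>t\<in>{0..1}. \<gamma> t = gr_exp P (t *\<^sub>R D)) \<and>
     \<gamma> 0 = P \<and> \<gamma> 1 = F \<and> length_minimizing p 0 1 \<gamma>"

section \<open>The Extended Grassmann Logarithm\<close>

definition ext_log_output :: "real^'p^'n \<Rightarrow> real^'p^'n \<Rightarrow> real^'p^'n \<Rightarrow> bool" where
  "ext_log_output U Y X \<longleftrightarrow>
     (\<exists>Q1 S1 R1 Y' Q2 S2 R2.
        square_svd (transpose Y ** U) Q1 S1 R1 \<and>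
        Y' = Y ** Q1 ** transpose R1 \<and>
        compact_svd ((mat 1 - U ** transpose U) ** Y') Q2 S2 R2 \<and>
        X = Q2 ** diag_apply arcsin S2 ** transpose R2)"

section \<open>The matrices \<open>diag(W, I)\<close>\<close>

text \<open>Elements of \<open>O(r)\<close>, where \<open>r\<close> depends on the data, are functions on pairs of naturals of which
  only the values at indices below \<open>r\<close> matter.\<close>

definition orthogonal_upto :: "nat \<Rightarrow> (nat \<Rightarrow> nat \<Rightarrow> real) \<Rightarrow> bool" where
  "orthogonal_upto r W \<longleftrightarrow>
     (\<forall>i<r. \<forall>j<r. (\<Sum>k<r. W k i * W k j) = (if i = j then 1 else 0))"

text \<open>\<open>index_pos\<close> is the order isomorphism from \<^typ>\<open>'p\<close> onto \<open>{0..<p}\<close>.\<close>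

definition index_pos :: "'p::{finite,linorder} \<Rightarrow> nat" where
  "index_pos i = card {k. k < i}"

definition block_diag :: "nat \<Rightarrow> (nat \<Rightarrow> nat \<Rightarrow> real) \<Rightarrow> real^('p::{finite,linorder})^('p::{finite,linorder})" where
  "block_diag r W =
     (\<chi> i j. if index_pos i < r \<and> index_pos j < r then W (index_pos i) (index_pos j)
             else if i = j then 1 else 0)"

text \<open>The representative \<open>U R diag(W\<^sup>T, I) cos(t\<Sigma>) + Q sin(t\<Sigma>)\<close> of \<open>\<gamma>\<^sub>W(t)\<close>;
  \<open>\<lambda>i j. W j i\<close> is the transpose of \<open>W\<close>.\<close>

definition geodesic_rep ::
    "real^('p::{finite,linorder})^'n \<Rightarrow> real^('p::{finite,linorder})^'n \<Rightarrow> real^('p::{finite,linorder})^('p::{finite,linorder}) \<Rightarrow> real^('p::{finite,linorder})^('p::{finite,linorder}) \<Rightarrow> nat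
      \<Rightarrow> (nat \<Rightarrow> nat \<Rightarrow> real) \<Rightarrow> real \<Rightarrow> real^('p::{finite,linorder})^'n" where
  "geodesic_rep U Q S R r W t =
     U ** R ** block_diag r (\<lambda>i j. W j i) ** diag_apply cos (t *\<^sub>R S) + Q ** diag_apply sin (t *\<^sub>R S)"

end

theory Submission
  imports Defs
begin

text \<open>
  The distance between \<open>UU\<^sup>T\<close> and \<open>YY\<^sup>T\<close> is the Euclidean norm of the vector of principal angles.
  The upper bound comes from an explicit geodesic. For the lower bound, follow the matrix
  \<open>Z = U\<^sup>T(I - \<gamma>(t))U\<close>, whose eigenvalues are the squared sines of the principal angles, along a
  curve \<open>\<gamma>\<close>. With \<open>f(z) = (arcsin \<surd>z)\<^sup>2\<close> the function \<open>\<surd>(tr f(Z))\<close> is 1-Lipschitz with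
  respect to arc length, because \<open>f'\<^sup>2 z (1 - z) = f\<close>. As \<open>f\<close> is not smooth at \<open>z = 1\<close>, which
  is exactly the cut locus, \<open>f\<close> is replaced by the partial sums of its power series, which are
  polynomials satisfying \<open>f'\<^sup>2 z (1 - z) \<le> f\<close>.

  A geodesic with initial singular values \<open>s\<close> has principal angles \<open>arccos \<bar>cos (t s)\<bar>\<close> at time
  \<open>t\<close>, so it is minimizing exactly as long as all \<open>t s\<close> are at most \<open>\<pi>/2\<close>. Two minimizing
  geodesics with the same endpoint have the same cosine and sine parts up to an orthogonal factor,
  which is the identity where the cosine does not vanish; this leaves the freedom of \<open>O(r)\<close>.
\<close>

section \<open>Matrix algebra\<close>

text \<open>The eigenvalues of \<open>Z\<close> need not be differentiable where they cross, whereas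
  traces of powers of \<open>Z\<close> are polynomial in the entries. This is why the lower bound
  runs through the trace of a polynomial in \<open>Z\<close> and not through the angles themselves.
  Since \<open>cut_locus\<close> and \<open>tangent_cut_locus\<close> are defined by length
  minimization, the distance formula has to precede every statement about them: it turns both into
  conditions on singular values. The other obstacle is non-uniqueness. A point has many frames, a
  matrix has many SVDs, and repeated singular values leave whole rotation groups undetermined. Two
  such choices are compared through a matrix \<open>M\<close> with
  \<open>diag a ** M = M ** diag b\<close>. It also intertwines h(a) and h(b) for every function h,
  so one can pass between s, cos s, sin s and s / sin s without sorting anything or splitting into
  eigenspaces.\<close>

lemma bounded_bilinear_matrix_mult:
  "bounded_bilinear ((**) :: real^'m^'n \<Rightarrow> real^'p^'m \<Rightarrow> real^'p^'n)"
  unfolding bilinear_conv_bounded_bilinear[symmetric] bilinear_def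
  by (auto intro!: linearI simp: vec_eq_iff matrix_matrix_mult_def sum.distrib algebra_simps sum_distrib_left)

interpretation matrix_mult: bounded_bilinear "(**) :: real^'m^'n \<Rightarrow> real^'p^'m \<Rightarrow> real^'p^'n"
  by (rule bounded_bilinear_matrix_mult)

lemma bounded_linear_transpose: "bounded_linear (transpose :: real^'m^'n \<Rightarrow> real^'n^'m)"
  unfolding linear_conv_bounded_linear[symmetric]
  by (auto intro!: linearI simp: vec_eq_iff transpose_def)

lemmas linear_transpose = bounded_linear.linear[OF bounded_linear_transpose]
lemmas transpose_add = linear_add[OF linear_transpose]
  and transpose_diff = linear_diff[OF linear_transpose]
  and transpose_zero = linear_0[OF linear_transpose]
  and transpose_scaleR = linear_scale[OF linear_transpose]

lemma bounded_linear_trace: "bounded_linear (trace :: real^'n^'n \<Rightarrow> real)"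
  unfolding linear_conv_bounded_linear[symmetric]
  by (auto intro!: linearI simp: trace_def sum.distrib sum_distrib_left)

lemmas linear_trace = bounded_linear.linear[OF bounded_linear_trace]
lemmas trace_add = linear_add[OF linear_trace]
  and trace_minus = linear_neg[OF linear_trace]
  and trace_zero = linear_0[OF linear_trace]
  and trace_scaleR = linear_scale[OF linear_trace]
  and trace_sum = linear_sum[OF linear_trace]

lemma matrix_mult_nth: "(A ** B) $ i $ j = (\<Sum>k\<in>UNIV. A $ i $ k * B $ k $ j)"
  by (simp add: matrix_matrix_mult_def)

lemma transpose_mult [simp]: "transpose (A ** B) = transpose B ** transpose (A :: real^'m^'n)"
  by (rule matrix_transpose_mul)

lemma trace_transpose_mult_inner: "trace (transpose A ** B) = A \<bullet> (B :: real^'m^'n)"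
  unfolding trace_def matrix_mult_nth transpose_def inner_vec_def by (simp, rule sum.swap)

lemma diag_nth [simp]: "diag d $ i $ j = (if i = j then d i else 0)"
  by (simp add: diag_def)

lemma mult_diag_nth [simp]: "(A ** diag d) $ i $ j = A $ i $ j * d j"
  by (simp add: matrix_mult_nth if_distrib[of "(*) _"] sum.delta' cong: if_cong)

lemma diag_mult_nth [simp]: "(diag d ** A) $ i $ j = d i * A $ i $ j"
  by (simp add: matrix_mult_nth if_distrib[of "\<lambda>x. x * _"] sum.delta cong: if_cong)

lemma diag_mult_diag: "diag a ** diag b = diag (\<lambda>i. a i * b i)"
  by (simp add: vec_eq_iff)

lemma transpose_diag [simp]: "transpose (diag d) = diag d"
  by (simp add: vec_eq_iff transpose_def)

lemma diag_one: "diag (\<lambda>i. 1) = mat 1"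
  by (simp add: vec_eq_iff mat_def)

lemma trace_diag: "trace (diag d) = (\<Sum>i\<in>UNIV. d i)"
  by (simp add: trace_def)

lemma diag_eq_iff: "diag a = diag b \<longleftrightarrow> a = b"
  by (auto simp: vec_eq_iff fun_eq_iff)

lemma diag_apply_diag [simp]: "diag_apply f (diag d) = diag (\<lambda>i. f (d i))"
  by (simp add: diag_apply_def)

lemma scaleR_diag [simp]: "t *\<^sub>R diag d = diag (\<lambda>i. t * d i)"
  by (simp add: vec_eq_iff)

lemma nonneg_diagonal_iff: "nonneg_diagonal S \<longleftrightarrow> (\<exists>d. S = diag d \<and> (\<forall>i. 0 \<le> d i))"
proof
  assume "nonneg_diagonal S"
  then show "\<exists>d. S = diag d \<and> (\<forall>i. 0 \<le> d i)"
    by (intro exI[of _ "\<lambda>i. S $ i $ i"]) (auto simp: nonneg_diagonal_def vec_eq_iff)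
qed (auto simp: nonneg_diagonal_def)

lemma orthogonal_matrixD:
  assumes "orthogonal_matrix (Q :: real^'n^'n)"
  shows "transpose Q ** Q = mat 1" "Q ** transpose Q = mat 1"
  using assms by (auto simp: orthogonal_matrix_def)

lemma orthogonal_matrix_cancel:
  assumes "orthogonal_matrix (Q :: real^'n^'n)"
  shows "transpose Q ** (Q ** A) = A" "Q ** (transpose Q ** A) = A"
    "B ** transpose Q ** Q = B" "B ** Q ** transpose Q = B"
  using orthogonal_matrixD[OF assms] by (simp_all add: matrix_mul_assoc) (simp_all flip: matrix_mul_assoc)

lemma stiefelD: "U \<in> stiefel \<Longrightarrow> transpose U ** U = mat 1"
  by (simp add: stiefel_def)

lemma stiefel_cancel:
  assumes "U \<in> stiefel"
  shows "transpose U ** (U ** A) = A" "B ** transpose U ** U = B"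
  using stiefelD[OF assms] by (simp_all add: matrix_mul_assoc) (simp_all flip: matrix_mul_assoc)

lemma stiefel_mult_orthogonal:
  assumes "U \<in> stiefel" "orthogonal_matrix M"
  shows "U ** M \<in> stiefel"
  using assms by (simp add: stiefel_def flip: matrix_mul_assoc)
    (simp add: stiefel_cancel[OF assms(1)] orthogonal_matrixD)

lemma stiefel_square: "orthogonal_matrix (Q :: real^'p^'p) \<longleftrightarrow> Q \<in> stiefel"
  by (simp add: stiefel_def orthogonal_matrix)

lemma stiefel_columns: "U \<in> stiefel \<longleftrightarrow> (\<forall>i j. column i U \<bullet> column j U = (if i = j then 1 else 0))"
  by (auto simp: stiefel_def vec_eq_iff mat_def matrix_mult_transpose_dot_column)

lemma inner_mult_stiefel:
  assumes "U \<in> stiefel"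
  shows "(U ** A) \<bullet> (U ** B) = A \<bullet> (B :: real^'q^'p)"
  by (simp add: stiefel_cancel[OF assms] flip: trace_transpose_mult_inner matrix_mul_assoc)

lemma inner_mult_orthogonal:
  assumes "orthogonal_matrix R"
  shows "(A ** R) \<bullet> (B ** R) = A \<bullet> (B :: real^'q^'p)"
proof -
  have "trace (transpose R ** transpose A ** (B ** R)) = trace (transpose A ** B ** R ** transpose R)"
    by (metis matrix_mul_assoc trace_mul_sym)
  then show ?thesis
    by (simp add: orthogonal_matrix_cancel[OF assms] flip: trace_transpose_mult_inner)
qed

lemma inner_diag: "diag a \<bullet> diag b = (\<Sum>i\<in>UNIV. a i * b i)"
  by (simp add: trace_diag diag_mult_diag flip: trace_transpose_mult_inner)

text \<open>A nonzero entry of an intertwiner forces the corresponding eigenvalues to agree, so that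
  intertwiners are compatible with functional calculus.\<close>

lemma intertwine_iff: "diag a ** M = M ** diag b \<longleftrightarrow> (\<forall>i j. M $ i $ j = 0 \<or> a i = b j)"
proof -
  have "a i * M $ i $ j = M $ i $ j * b j \<longleftrightarrow> M $ i $ j = 0 \<or> a i = b j" for i j
    by (auto simp: mult.commute[of "a i"])
  then show ?thesis by (simp add: vec_eq_iff)
qed

lemma orthogonal_matrix_sum_rows:
  assumes "orthogonal_matrix (M :: real^'p^'p)"
  shows "(\<Sum>j\<in>UNIV. (M $ i $ j)\<^sup>2) = 1"
  using arg_cong[OF orthogonal_matrixD(2)[OF assms], of "\<lambda>A. A $ i $ i"]
  by (simp add: matrix_mult_nth transpose_def mat_def power2_eq_square)

lemma orthogonal_matrix_sum_columns:
  assumes "orthogonal_matrix (M :: real^'p^'p)"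
  shows "(\<Sum>i\<in>UNIV. (M $ i $ j)\<^sup>2) = 1"
  using orthogonal_matrix_sum_rows[of "transpose M" j] assms
  by (simp only: orthogonal_matrix_transpose) (simp add: transpose_def)

text \<open>The intertwining relation survives applying \<open>h\<close> entrywise, and the trace
  does not see the conjugation by \<open>M\<close>.\<close>

lemma sum_intertwine:
  assumes M: "orthogonal_matrix (M :: real^'p^'p)"
    and "diag a ** M = M ** diag b"
  shows "(\<Sum>i\<in>UNIV. h (a i)) = (\<Sum>j\<in>UNIV. (h (b j) :: real))"
proof -
  have h: "diag (\<lambda>i. h (a i)) ** M = M ** diag (\<lambda>j. h (b j))"
    using assms(2) unfolding intertwine_iff by metis
  have "trace (diag (\<lambda>i. h (a i)) ** M ** transpose M) = trace (diag (\<lambda>j. h (b j)))"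
    unfolding h by (metis M matrix_mul_assoc orthogonal_matrix_cancel(1) trace_mul_sym)
  then show ?thesis
    by (simp add: orthogonal_matrix_cancel[OF M] trace_diag)
qed

text \<open>Taking an indicator function for \<open>h\<close> shows that multiplicities do not
  depend on the diagonalization. This allows the number \<open>r\<close> of right angles to be read
  off from any decomposition.\<close>

lemma card_intertwine:
  assumes M: "orthogonal_matrix (M :: real^'p^'p)"
    and "diag a ** M = M ** diag b"
  shows "card {i. a i = c} = card {j. b j = c}"
proof -
  have *: "(\<Sum>i\<in>UNIV. if d i = c then 1 else 0) = real (card {i. d i = c})" for d :: "'p \<Rightarrow> real"
    by (simp flip: sum.inter_filter)
  show ?thesis
    using sum_intertwine[OF assms, of "\<lambda>x. if x = c then 1 else 0"]
    unfolding * of_nat_eq_iff .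
qed

section \<open>Singular value decompositions\<close>

text \<open>The predicate \<open>E\<close> lets one induction on the complement of \<open>J\<close>
  serve two purposes: with \<open>E\<close> = "is an eigenvector" it yields an eigenbasis, with a
  trivial \<open>E\<close> it completes a partial orthonormal family.\<close>

lemma orthonormal_family_extend:
  fixes q :: "'k::finite \<Rightarrow> 'a::euclidean_space"
  assumes step: "\<And>(J :: 'k set) q. J \<noteq> UNIV \<Longrightarrow> (\<forall>i\<in>J. \<forall>j\<in>J. q i \<bullet> q j = (if i = j then 1 else 0)) \<Longrightarrow>
        (\<forall>j\<in>J. E (q j)) \<Longrightarrow> \<exists>v. v \<bullet> v = 1 \<and> (\<forall>j\<in>J. q j \<bullet> v = 0) \<and> E v"
    and "\<forall>i\<in>J. \<forall>j\<in>J. q i \<bullet> q j = (if i = j then 1 else 0)" and "\<forall>j\<in>J. E (q j)"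
  shows "\<exists>q'. (\<forall>j\<in>J. q' j = q j) \<and> (\<forall>i j. q' i \<bullet> q' j = (if i = j then 1 else 0)) \<and> (\<forall>j. E (q' j))"
  using assms(2,3)
proof (induction "card (- J)" arbitrary: J q)
  case 0
  then have "- J = {}" by simp
  then have "J = UNIV" by blast
  with 0 show ?case by auto
next
  case (Suc n)
  then have "J \<noteq> UNIV" by auto
  then obtain k where k: "k \<notin> J" by auto
  obtain v where v: "v \<bullet> v = 1" "\<forall>j\<in>J. q j \<bullet> v = 0" "E v"
    using step[of J q, OF \<open>J \<noteq> UNIV\<close> Suc.prems] by auto
  have "- insert k J = - J - {k}" by auto
  then have "card (- insert k J) = n"
    using Suc.hyps(2) k by simp
  moreover have "\<forall>i\<in>insert k J. \<forall>j\<in>insert k J. (q(k := v)) i \<bullet> (q(k := v)) j = (if i = j then 1 else 0)"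
    using v Suc.prems(1) k by (auto simp: inner_commute)
  moreover have "\<forall>j\<in>insert k J. E ((q(k := v)) j)"
    using v Suc.prems(2) k by auto
  ultimately obtain q' where "\<forall>j\<in>insert k J. q' j = (q(k := v)) j"
    "\<forall>i j. q' i \<bullet> q' j = (if i = j then 1 else 0)" "\<forall>j. E (q' j)"
    using Suc.hyps(1)[of "insert k J" "q(k := v)"] by metis
  then show ?case
    using k by (intro exI[of _ q']) auto
qed

lemma exists_unit_orthogonal:
  fixes q :: "'k::finite \<Rightarrow> 'a::euclidean_space"
  assumes "CARD('k) \<le> DIM('a)" "J \<noteq> UNIV"
  shows "\<exists>v. v \<bullet> v = 1 \<and> (\<forall>j\<in>J. q j \<bullet> v = 0)"
proof -
  have "dim (q ` J) \<le> card (q ` J)" by (rule dim_le_card') simp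
  also have "\<dots> \<le> card J" by (rule card_image_le) simp
  also have "\<dots> < CARD('k)" using assms(2) by (intro psubset_card_mono) auto
  finally have "dim (q ` J) < DIM('a)" using assms(1) by simp
  then obtain x where x: "x \<noteq> 0" "\<And>y. y \<in> span (q ` J) \<Longrightarrow> orthogonal x y"
    using orthogonal_to_subspace_exists by blast
  have "q j \<bullet> x = 0" if "j \<in> J" for j
    using x(2)[of "q j"] that by (simp add: span_base orthogonal_def inner_commute)
  with x(1) show ?thesis
    by (intro exI[of _ "x /\<^sub>R norm x"]) (auto simp: dot_square_norm power2_eq_square)
qed

text \<open>By symmetry \<open>A\<close> preserves the orthogonal complement \<open>W\<close> of the
  eigenvectors found so far. A maximizer \<open>v\<close> of the Rayleigh quotient on the unit
  sphere of \<open>W\<close> is an eigenvector: its residual \<open>w\<close> lies in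
  \<open>W\<close>, and moving from \<open>v\<close> by \<open>t *\<^sub>R w\<close> changes the
  quadratic form to first order by 2t|w|^2, which maximality forbids unless w = 0.\<close>

lemma exists_eigenvector_orthogonal:
  fixes A :: "real^'n^'n" and q :: "'n \<Rightarrow> real^'n"
  assumes sym: "transpose A = A" and "J \<noteq> UNIV"
    and eig: "\<forall>j\<in>J. \<exists>e. A *v q j = e *\<^sub>R q j"
  shows "\<exists>v. v \<bullet> v = 1 \<and> (\<forall>j\<in>J. q j \<bullet> v = 0) \<and> (\<exists>e. A *v v = e *\<^sub>R v)"
proof -
  define W where "W = {v. \<forall>j\<in>J. q j \<bullet> v = 0}"
  have symA: "(A *v x) \<bullet> y = x \<bullet> (A *v y)" for x y
    by (metis dot_lmul_matrix sym transpose_matrix_vector)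
  have AW: "A *v x \<in> W" if "x \<in> W" for x
    using that eig by (auto simp: W_def simp flip: symA)
  have comp: "compact (W \<inter> sphere 0 1)"
    unfolding W_def Collect_ball_eq
    by (intro closed_Int_compact closed_INT ballI closed_Collect_eq continuous_intros compact_sphere)
  have "\<exists>v. v \<bullet> v = 1 \<and> (\<forall>j\<in>J. q j \<bullet> v = 0)"
    by (rule exists_unit_orthogonal) (use assms in auto)
  then have ne: "W \<inter> sphere 0 1 \<noteq> {}"
    by (auto simp: W_def norm_eq_1)
  have "continuous_on (W \<inter> sphere 0 1) (\<lambda>x. x \<bullet> (A *v x))"
    by (intro continuous_intros matrix_vector_mult_linear_continuous_on)
  then obtain v where v: "v \<in> W \<inter> sphere 0 1"
    and max: "\<And>y. y \<in> W \<inter> sphere 0 1 \<Longrightarrow> y \<bullet> (A *v y) \<le> v \<bullet> (A *v v)"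
    using continuous_attains_sup[OF comp ne] by blast
  define mu where "mu = v \<bullet> (A *v v)"
  have vv: "v \<bullet> v = 1" using v by (simp add: norm_eq_1)
  have bound: "x \<bullet> (A *v x) \<le> mu * (x \<bullet> x)" if "x \<in> W" for x
  proof (cases "x = 0")
    case False
    then have "x /\<^sub>R norm x \<in> W \<inter> sphere 0 1"
      using that by (auto simp: W_def)
    from max[OF this] have "(x \<bullet> (A *v x)) / (norm x)\<^sup>2 \<le> mu"
      by (simp add: mu_def matrix_vector_mult_scaleR power2_eq_square divide_simps)
    then show ?thesis
      using False by (simp add: dot_square_norm divide_simps)
  qed simp
  define w where "w = A *v v - mu *\<^sub>R v"
  have "w \<in> W"
    using AW[of v] v by (auto simp: w_def W_def inner_diff_right)
  have wv: "w \<bullet> v = 0"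
    by (simp add: w_def inner_diff_left inner_diff_right vv mu_def inner_commute)
  define c where "c = mu * (w \<bullet> w) - w \<bullet> (A *v w)"
  have wAv: "w \<bullet> (A *v v) = w \<bullet> w"
    using wv by (simp add: w_def inner_diff_right inner_diff_left algebra_simps)
  have quad: "2 * t * (w \<bullet> w) \<le> t\<^sup>2 * c" for t
  proof -
    have "v + t *\<^sub>R w \<in> W"
      using v \<open>w \<in> W\<close> by (auto simp: W_def inner_add_right)
    have vAw: "v \<bullet> (A *v w) = w \<bullet> w"
      using wAv symA[of v w] by (simp add: inner_commute)
    have vw: "v \<bullet> w = 0" using wv by (simp add: inner_commute)
    have "(v + t *\<^sub>R w) \<bullet> (A *v (v + t *\<^sub>R w)) = mu + 2 * t * (w \<bullet> w) + t\<^sup>2 * (w \<bullet> (A *v w))"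
      unfolding matrix_vector_right_distrib matrix_vector_mult_scaleR inner_add_left inner_add_right
        inner_scaleR_left inner_scaleR_right vAw wAv mu_def[symmetric]
      by (simp add: algebra_simps power2_eq_square)
    moreover have "(v + t *\<^sub>R w) \<bullet> (v + t *\<^sub>R w) = 1 + t\<^sup>2 * (w \<bullet> w)"
      unfolding inner_add_left inner_add_right inner_scaleR_left inner_scaleR_right vv wv vw
      by (simp add: power2_eq_square)
    ultimately show ?thesis
      using bound[OF \<open>v + t *\<^sub>R w \<in> W\<close>] by (simp add: c_def algebra_simps)
  qed
  have "w \<bullet> w = 0"
  proof (rule ccontr)
    assume "w \<bullet> w \<noteq> 0"
    then have pos: "w \<bullet> w > 0" by (simp add: less_le)
    \<comment> \<open>A step so small that the second order term \<open>t * c\<close> is at most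
      \<open>w \<bullet> w\<close>, against the bound \<open>2 * (w \<bullet> w) \<le> t * c\<close>
      from \<open>quad\<close>; the absolute value and the 1 cover \<open>c \<le> 0\<close>.\<close>
    define t where "t = (w \<bullet> w) / (\<bar>c\<bar> + 1)"
    have t: "t > 0" using pos by (simp add: t_def add_nonneg_pos)
    have "t * (2 * (w \<bullet> w)) \<le> t * (t * c)"
      using quad[of t] by (simp add: power2_eq_square algebra_simps)
    then have "2 * (w \<bullet> w) \<le> t * c" using t by simp
    also have "\<dots> \<le> t * (\<bar>c\<bar> + 1)" using t by (intro mult_left_mono) auto
    also have "\<dots> = w \<bullet> w" by (simp add: t_def)
    finally show False using pos by simp
  qed
  then have "A *v v = mu *\<^sub>R v" by (simp add: w_def)
  then show ?thesis
    using v vv by (auto simp: W_def)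
qed

lemma symmetric_diagonalization:
  fixes A :: "real^'n^'n"
  assumes "transpose A = A"
  shows "\<exists>Q d. orthogonal_matrix Q \<and> A = Q ** diag d ** transpose Q"
proof -
  have "\<exists>q :: 'n \<Rightarrow> real^'n. (\<forall>j\<in>{}. q j = 0) \<and> (\<forall>i j. q i \<bullet> q j = (if i = j then 1 else 0)) \<and>
      (\<forall>j. \<exists>e. A *v q j = e *\<^sub>R q j)"
  proof (rule orthonormal_family_extend)
    fix J and q :: "'n \<Rightarrow> real^'n"
    assume "J \<noteq> UNIV" "\<forall>j\<in>J. \<exists>e. A *v q j = e *\<^sub>R q j"
    then show "\<exists>v. v \<bullet> v = 1 \<and> (\<forall>j\<in>J. q j \<bullet> v = 0) \<and> (\<exists>e. A *v v = e *\<^sub>R v)"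
      by (rule exists_eigenvector_orthogonal[OF assms])
  qed auto
  then obtain q :: "'n \<Rightarrow> real^'n" where q: "\<And>i j. q i \<bullet> q j = (if i = j then 1 else 0)"
    and "\<forall>j. \<exists>e. A *v q j = e *\<^sub>R q j"
    by auto
  then obtain d where d: "\<And>j. A *v q j = d j *\<^sub>R q j" by metis
  define Q :: "real^'n^'n" where "Q = (\<chi> i j. q j $ i)"
  have col: "column j Q = q j" for j
    by (simp add: Q_def column_def vec_eq_iff)
  have Q: "orthogonal_matrix Q"
    by (simp add: stiefel_square stiefel_columns col q)
  have "A ** Q = Q ** diag d"
  proof -
    have "(A ** Q) $ i $ j = (A *v q j) $ i" for i j
      by (simp add: matrix_mult_nth matrix_vector_mult_def Q_def)
    then show ?thesis
      by (simp add: vec_eq_iff d) (simp add: Q_def)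
  qed
  then have "A = Q ** diag d ** transpose Q"
    by (metis Q orthogonal_matrix_cancel(4))
  with Q show ?thesis by blast
qed

text \<open>Columns of \<open>M\<close> with \<open>s i \<noteq> 0\<close> are normalized. The
  others vanish, so the corresponding columns of \<open>Q\<close> may be any orthonormal completion,
  for which the dimension bound leaves room.\<close>

lemma stiefel_factor:
  fixes M :: "real^'p^'n"
  assumes "CARD('p) \<le> CARD('n)" and M: "transpose M ** M = diag (\<lambda>i. (s i)\<^sup>2)"
  shows "\<exists>Q \<in> stiefel. M = Q ** diag s"
proof -
  have MM: "column i M \<bullet> column j M = (if i = j then (s i)\<^sup>2 else 0)" for i j
    using arg_cong[OF M, of "\<lambda>A. A $ i $ j"] by (simp add: matrix_mult_transpose_dot_column)
  define J where "J = {i. s i \<noteq> 0}"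
  define q0 where "q0 i = column i M /\<^sub>R s i" for i
  have "\<exists>q'. (\<forall>j\<in>J. q' j = q0 j) \<and> (\<forall>i j. q' i \<bullet> q' j = (if i = j then 1 else 0)) \<and> (\<forall>j::'p. True)"
  proof (rule orthonormal_family_extend)
    fix J :: "'p set" and q :: "'p \<Rightarrow> real^'n"
    assume "J \<noteq> UNIV"
    then show "\<exists>v. v \<bullet> v = 1 \<and> (\<forall>j\<in>J. q j \<bullet> v = 0) \<and> True"
      using exists_unit_orthogonal[of J q] assms(1) by simp
  qed (auto simp: q0_def MM J_def power2_eq_square divide_simps)
  then obtain q where qJ: "\<And>j. s j \<noteq> 0 \<Longrightarrow> q j = q0 j"
    and q: "\<And>i j. q i \<bullet> q j = (if i = j then 1 else 0)"
    by (auto simp: J_def)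
  define Q :: "real^'p^'n" where "Q = (\<chi> i j. q j $ i)"
  have col: "column j Q = q j" for j
    by (simp add: Q_def column_def vec_eq_iff)
  have "M $ i $ j = Q $ i $ j * s j" for i j
  proof (cases "s j = 0")
    case True
    then have "column j M = 0" using MM[of j j] by simp
    then show ?thesis using True by (simp add: column_def vec_eq_iff)
  next
    case False
    then show ?thesis by (simp add: Q_def qJ q0_def column_def)
  qed
  then show ?thesis
    by (intro bexI[of _ Q]) (auto simp: stiefel_columns col q vec_eq_iff)
qed

text \<open>Diagonalizing X^T X gives \<open>R\<close>; then \<open>X ** R\<close> has orthogonal
  columns, whose lengths are the singular values.\<close>

lemma compact_svd_exists:
  fixes X :: "real^'p^'n"
  assumes "CARD('p) \<le> CARD('n)"
  shows "\<exists>Q d R. Q \<in> stiefel \<and> (\<forall>i. 0 \<le> d i) \<and> orthogonal_matrix R \<and> X = Q ** diag d ** transpose R"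
proof -
  have "transpose (transpose X ** X) = transpose X ** X" by simp
  then obtain R e where R: "orthogonal_matrix R" and e: "transpose X ** X = R ** diag e ** transpose R"
    using symmetric_diagonalization by blast
  have XR: "transpose (X ** R) ** (X ** R) = diag e"
    using e by (metis (no_types, lifting) R matrix_mul_assoc transpose_mult orthogonal_matrix_cancel(1,3))
  have "0 \<le> e i" for i
  proof -
    have "e i = column i (X ** R) \<bullet> column i (X ** R)"
      using arg_cong[OF XR, of "\<lambda>A. A $ i $ i"]
      by (simp add: matrix_mult_transpose_dot_column del: transpose_mult)
    then show ?thesis by simp
  qed
  then have "diag e = diag (\<lambda>i. (sqrt (e i))\<^sup>2)" by simp
  with XR obtain Q where "Q \<in> stiefel" "X ** R = Q ** diag (\<lambda>i. sqrt (e i))"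
    using stiefel_factor[OF assms, of "X ** R" "\<lambda>i. sqrt (e i)"] by auto
  moreover from this have "X = Q ** diag (\<lambda>i. sqrt (e i)) ** transpose R"
    by (metis R orthogonal_matrix_cancel(4))
  ultimately show ?thesis
    using R \<open>\<And>i. 0 \<le> e i\<close> by (intro exI[of _ Q] exI[of _ "\<lambda>i. sqrt (e i)"] exI[of _ R]) auto
qed

section \<open>The matrix exponential\<close>

abbreviation matrix_power :: "real^'n^'n \<Rightarrow> nat \<Rightarrow> real^'n^'n" where
  "matrix_power A k \<equiv> ((**) A ^^ k) (mat 1)"

lemma matrix_power_commute: "matrix_power A k ** A = A ** matrix_power A k"
proof (induction k)
  case (Suc k)
  then show ?case by simp (metis matrix_mul_assoc)
qed simp

lemma transpose_matrix_power: "transpose (matrix_power A k) = matrix_power (transpose A) k"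
proof (induction k)
  case (Suc k)
  then show ?case by (simp add: matrix_power_commute)
qed simp

lemma matrix_exp_sums:
  fixes A :: "real^'n^'n"
  shows "(\<lambda>k. (1 / fact k) *\<^sub>R matrix_power A k) sums matrix_exp A"
proof -
  obtain K where K: "0 \<le> K" "\<And>(a :: real^'n^'n) (b :: real^'n^'n). norm (a ** b) \<le> norm a * norm b * K"
    using matrix_mult.nonneg_bounded by metis
  have bound: "norm (matrix_power A k) \<le> (norm A * K) ^ k * norm (mat 1 :: real^'n^'n)" for k
  proof (induction k)
    case (Suc k)
    have "norm (matrix_power A (Suc k)) \<le> (norm A * K) * norm (matrix_power A k)"
      using K(2)[of A "matrix_power A k"] by (simp add: mult_ac)
    also have "\<dots> \<le> (norm A * K) * ((norm A * K) ^ k * norm (mat 1 :: real^'n^'n))"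
      using K(1) Suc by (intro mult_left_mono) auto
    finally show ?case by (simp add: mult_ac)
  qed simp
  have "summable (\<lambda>k. (1 / fact k) *\<^sub>R matrix_power A k)"
  proof (rule summable_comparison_test')
    show "summable (\<lambda>k. inverse (fact k) * (norm A * K) ^ k * norm (mat 1 :: real^'n^'n))"
      by (intro summable_mult2 summable_exp)
    show "norm ((1 / fact k) *\<^sub>R matrix_power A k)
        \<le> inverse (fact k) * (norm A * K) ^ k * norm (mat 1 :: real^'n^'n)" for k
      using bound[of k] by (simp add: divide_simps)
  qed
  then show ?thesis
    unfolding matrix_exp_def by (rule summable_sums)
qed

lemma matrix_exp_transpose: "matrix_exp (transpose A) = transpose (matrix_exp A)"
  using matrix_exp_sums[of "transpose A"] bounded_linear.sums[OF bounded_linear_transpose matrix_exp_sums[of A]]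
  unfolding transpose_scaleR transpose_matrix_power by (rule sums_unique2)

text \<open>\<open>A\<close> acts on the column pairs of \<open>V\<close> and \<open>W\<close> as an infinitesimal rotation with
  angular speed \<open>s\<close>.\<close>

lemma matrix_exp_rotation:
  fixes V W :: "real^'p^'n"
  assumes AV: "A ** V = W ** diag s" and AW: "A ** (W ** diag s) = - (V ** diag (\<lambda>i. (s i)\<^sup>2))"
  shows "matrix_exp A ** V = V ** diag (\<lambda>i. cos (s i)) + W ** diag (\<lambda>i. sin (s i))"
proof -
  have pow: "matrix_power A k ** V = V ** diag (\<lambda>i. fact k * cos_coeff k * s i ^ k)
      + W ** diag (\<lambda>i. fact k * sin_coeff k * s i ^ k)" for k
  proof (induction k)
    case 0
    then show ?case by (simp add: vec_eq_iff)
  next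
    case (Suc k)
    \<comment> \<open>A factor \<open>diag s\<close> is split off because only
      \<open>A ** (W ** diag s)\<close> is known, not \<open>A ** W\<close>. For
      \<open>k = 0\<close> the truncated exponent \<open>k - 1\<close> does no harm, since
      \<open>sin_coeff 0 = 0\<close>.\<close>
    define u where "u i = fact k * sin_coeff k * s i ^ (k - 1)" for i
    have "diag (\<lambda>i. fact k * sin_coeff k * s i ^ k) = diag s ** diag u"
      by (cases k) (auto simp: diag_mult_diag u_def vec_eq_iff)
    then have "matrix_power A (Suc k) ** V = A ** V ** diag (\<lambda>i. fact k * cos_coeff k * s i ^ k)
        + A ** (W ** diag s) ** diag u"
      using Suc by (simp add: matrix_mult.add_right flip: matrix_mul_assoc)
    also have "\<dots> = V ** diag (\<lambda>i. - ((s i)\<^sup>2 * u i)) + W ** diag (\<lambda>i. s i * (fact k * cos_coeff k * s i ^ k))"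
      unfolding AV AW by (simp add: vec_eq_iff)
    also have "diag (\<lambda>i. - ((s i)\<^sup>2 * u i)) = diag (\<lambda>i. fact (Suc k) * cos_coeff (Suc k) * s i ^ Suc k)"
      by (cases k) (auto simp: u_def vec_eq_iff cos_coeff_Suc power2_eq_square field_simps)
    also have "diag (\<lambda>i. s i * (fact k * cos_coeff k * s i ^ k))
        = diag (\<lambda>i. fact (Suc k) * sin_coeff (Suc k) * s i ^ Suc k)"
      by (auto simp: vec_eq_iff sin_coeff_Suc)
    finally show ?case .
  qed
  have "(matrix_exp A ** V) $ i $ j = V $ i $ j * cos (s j) + W $ i $ j * sin (s j)" for i j
  proof -
    have "bounded_linear (\<lambda>M. (M ** V) $ i $ j)"
      by (intro bounded_linear_compose[OF bounded_linear_vec_nth] matrix_mult.bounded_linear_left)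
    from bounded_linear.sums[OF this matrix_exp_sums[of A]]
    have "(\<lambda>k. V $ i $ j * (cos_coeff k *\<^sub>R s j ^ k) + W $ i $ j * (sin_coeff k *\<^sub>R s j ^ k))
        sums (matrix_exp A ** V) $ i $ j"
      by (simp add: matrix_mult.scaleR_left pow algebra_simps add_divide_distrib)
    moreover have "(\<lambda>k. V $ i $ j * (cos_coeff k *\<^sub>R s j ^ k) + W $ i $ j * (sin_coeff k *\<^sub>R s j ^ k))
        sums (V $ i $ j * cos (s j) + W $ i $ j * sin (s j))"
      by (intro sums_add sums_mult cos_converges sin_converges)
    ultimately show ?thesis by (rule sums_unique2)
  qed
  then show ?thesis by (simp add: vec_eq_iff)
qed

section \<open>Geodesics of the Grassmannian\<close>

lemma transpose_proj [simp]: "transpose (proj U) = proj U"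
  by (simp add: proj_def)

lemma proj_mult_orthogonal: "orthogonal_matrix M \<Longrightarrow> proj (U ** M) = proj U"
  by (simp add: proj_def matrix_mul_assoc orthogonal_matrix_cancel)

text \<open>The witness is V^T U: the common projection V V^T fixes the columns of
  \<open>U\<close>.\<close>

lemma proj_eqD:
  assumes "U \<in> stiefel" "V \<in> stiefel" "proj U = proj (V :: real^'p^'n)"
  shows "\<exists>M. orthogonal_matrix M \<and> U = V ** M"
proof -
  have "V ** (transpose V ** U) = proj V ** U" by (simp add: proj_def matrix_mul_assoc)
  also have "\<dots> = proj U ** U" using assms(3) by simp
  also have "\<dots> = U"
    using assms(1) by (simp add: proj_def stiefelD flip: matrix_mul_assoc)
  finally have U: "U = V ** (transpose V ** U)" ..
  then have "transpose (V ** (transpose V ** U)) ** (V ** (transpose V ** U)) = mat 1"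
    using assms(1) by (simp add: stiefelD)
  then have "orthogonal_matrix (transpose V ** U)"
    by (simp add: stiefel_square stiefel_def stiefel_cancel[OF assms(2)] flip: matrix_mul_assoc)
  with U show ?thesis by blast
qed

lemma proj_in_grassmann:
  assumes "U \<in> stiefel"
  shows "proj (U :: real^'p^'n) \<in> grassmann CARD('p)"
proof -
  have "transpose U ** U = (mat 1 :: real^'p^'p)" using assms by (rule stiefelD)
  then have "rank (mat 1 :: real^'p^'p) \<le> rank U"
    by (metis rank_mul_le_right)
  moreover have "rank U \<le> rank (proj U)"
    using rank_mul_le_left[of "proj U" U] assms by (simp add: proj_def stiefel_cancel)
  moreover have "rank (proj U) \<le> CARD('p)"
    unfolding proj_def using rank_mul_le_left[of U "transpose U"] rank_bound[of U] by simp
  ultimately have "rank (proj U) = CARD('p)" by (simp add: rank_I)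
  moreover have "proj U ** proj U = proj U"
    by (simp add: proj_def stiefel_cancel[OF assms] flip: matrix_mul_assoc)
  ultimately show ?thesis by (simp add: grassmann_def)
qed

text \<open>The inverse of \<open>hor_lift U\<close>, meaningful for \<open>X\<close> with U^T X =
  0.\<close>

definition tangent_of :: "real^'p^'n \<Rightarrow> real^'p^'n \<Rightarrow> real^'n^'n" where
  "tangent_of U X = X ** transpose U + U ** transpose X"

lemma hor_lift_tangent:
  assumes U: "U \<in> stiefel" and D: "D \<in> tangent (proj U)"
  shows "transpose U ** hor_lift U D = 0" and "D = tangent_of U (hor_lift U D)"
proof -
  have sym: "transpose D = D" and eq: "D ** proj U + proj U ** D = D"
    using D by (auto simp: tangent_def)
  show "D = tangent_of U (hor_lift U D)"
    using eq by (simp add: tangent_of_def hor_lift_def proj_def sym matrix_mul_assoc)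
  have "transpose U ** (D ** proj U + proj U ** D) ** U = transpose U ** D ** U + transpose U ** D ** U"
    using U by (simp add: proj_def matrix_mult.add_right matrix_mult.add_left flip: matrix_mul_assoc)
       (simp add: stiefelD stiefel_cancel flip: matrix_mul_assoc)
  then show "transpose U ** hor_lift U D = 0"
    unfolding eq by (simp add: hor_lift_def matrix_mul_assoc)
qed

lemma tangent_of_tangent:
  assumes U: "U \<in> stiefel" and X: "transpose U ** X = 0"
  shows "tangent_of U X \<in> tangent (proj U)" and "hor_lift U (tangent_of U X) = X"
proof -
  have X': "transpose X ** U = 0"
    using arg_cong[OF X, of transpose] by (simp add: transpose_zero)
  show lift: "hor_lift U (tangent_of U X) = X"
    by (simp add: hor_lift_def tangent_of_def matrix_mult.add_left X' stiefelD[OF U] matrix_mult.zero_right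
        flip: matrix_mul_assoc)
  have sym: "transpose (tangent_of U X) = tangent_of U X"
    by (simp add: tangent_of_def transpose_add)
  have "tangent_of U X ** proj U = X ** transpose U"
    using lift by (simp add: proj_def hor_lift_def matrix_mul_assoc)
  moreover from arg_cong[OF this, of transpose] have "proj U ** tangent_of U X = U ** transpose X"
    by (simp add: sym)
  ultimately show "tangent_of U X \<in> tangent (proj U)"
    unfolding tangent_def by (simp add: sym) (simp add: tangent_of_def)
qed

text \<open>In the square of \<open>tangent_of U X\<close> the mixed products vanish by U^T X = 0,
  and the other two have the same trace |X|^2. The factor 1/2 of the metric makes the horizontal
  lift an isometry.\<close>

lemma gr_norm_tangent_of:
  assumes U: "U \<in> stiefel" and X: "transpose U ** X = 0"
  shows "gr_norm (tangent_of U X) = norm X"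
proof -
  have X': "transpose X ** U = 0"
    using arg_cong[OF X, of transpose] by (simp add: transpose_zero)
  have "tangent_of U X ** tangent_of U X = X ** transpose X + U ** (transpose X ** X ** transpose U)"
    by (simp add: tangent_of_def matrix_mult.add_left matrix_mult.add_right stiefelD[OF U]
        matrix_mult.zero_left matrix_mult.zero_right flip: matrix_mul_assoc)
       (simp add: X X' stiefelD[OF U] stiefel_cancel[OF U] matrix_mul_assoc matrix_mult.zero_left
         matrix_mult.zero_right)
  then have "trace (tangent_of U X ** tangent_of U X)
      = trace (X ** transpose X) + trace (transpose X ** X ** transpose U ** U)"
    using trace_mul_sym[of U "transpose X ** X ** transpose U"] by (simp add: trace_add)
  also have "\<dots> = 2 * (X \<bullet> X)"
    using trace_mul_sym[of X "transpose X"] by (simp add: trace_transpose_mult_inner stiefel_cancel[OF U])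
  finally show ?thesis
    by (simp add: gr_norm_def gr_metric_def norm_eq_sqrt_inner)
qed

text \<open>\<open>Q\<close> need not be orthogonal to \<open>V\<close> in the columns where \<open>a\<close> vanishes.\<close>

lemma horizontal_diag_mono:
  assumes "transpose V ** (Q ** diag a) = 0" and "\<And>i. a i = 0 \<Longrightarrow> b i = 0"
  shows "transpose V ** (Q ** diag b) = 0"
proof -
  have "(transpose V ** Q) $ i $ j * a j = 0" for i j
    using arg_cong[OF assms(1), of "\<lambda>A. A $ i $ j"] by (simp add: matrix_mul_assoc)
  then have "(transpose V ** Q) $ i $ j * b j = 0" for i j
    using assms(2) by (metis mult_eq_0_iff)
  then show ?thesis by (simp add: vec_eq_iff matrix_mul_assoc)
qed

lemma cross_zero:
  assumes "transpose V ** (Q ** diag s) = 0" "f 0 = 0"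
  shows "transpose V ** (Q ** diag (\<lambda>i. f (s i))) = 0"
    and "diag (\<lambda>i. f (s i)) ** (transpose Q ** V) = (0 :: real^'q^'p)"
proof -
  show *: "transpose V ** (Q ** diag (\<lambda>i. f (s i))) = 0"
    by (rule horizontal_diag_mono[OF assms(1)]) (simp add: assms(2))
  show "diag (\<lambda>i. f (s i)) ** (transpose Q ** V) = 0"
    using arg_cong[OF *, of transpose] by (simp add: transpose_zero matrix_mul_assoc)
qed

text \<open>Each pair of columns of \<open>V\<close> and \<open>Q\<close> is rotated in its own
  plane with angular speed \<open>s i\<close>. The frame \<open>V\<close> is left general so that
  \<open>V = U ** R\<close> gives a geodesic in SVD form and a further orthogonal factor gives the
  curves \<open>geodesic_rep\<close>.\<close>

definition rotation_curve :: "real^'p^'n \<Rightarrow> real^'p^'n \<Rightarrow> ('p \<Rightarrow> real) \<Rightarrow> real \<Rightarrow> real^'p^'n" where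
  "rotation_curve V Q s t = V ** diag (\<lambda>i. cos (t * s i)) + Q ** diag (\<lambda>i. sin (t * s i))"

lemma rotation_curve_0: "rotation_curve V Q s 0 = V"
  by (simp add: rotation_curve_def vec_eq_iff)

lemma rotation_curve_stiefel:
  assumes V: "V \<in> stiefel" and Q: "Q \<in> stiefel" and VQ: "transpose V ** (Q ** diag s) = 0"
  shows "rotation_curve V Q s t \<in> stiefel"
proof -
  note z = cross_zero[OF VQ, of "\<lambda>x. sin (t * x)", simplified]
  have "transpose (rotation_curve V Q s t) ** rotation_curve V Q s t
     = diag (\<lambda>i. cos (t * s i)) ** diag (\<lambda>i. cos (t * s i))
       + diag (\<lambda>i. sin (t * s i)) ** diag (\<lambda>i. sin (t * s i))
       + diag (\<lambda>i. cos (t * s i)) ** (transpose V ** (Q ** diag (\<lambda>i. sin (t * s i))))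
       + diag (\<lambda>i. sin (t * s i)) ** (transpose Q ** V) ** diag (\<lambda>i. cos (t * s i))"
    by (simp add: rotation_curve_def transpose_add matrix_mult.add_left matrix_mult.add_right
        stiefel_cancel[OF V] stiefel_cancel[OF Q] flip: matrix_mul_assoc)
  also have "\<dots> = mat 1"
    unfolding z by (simp add: diag_mult_diag vec_eq_iff mat_def matrix_mult.zero_left
        matrix_mult.zero_right flip: power2_eq_square)
  finally show ?thesis by (simp add: stiefel_def)
qed

text \<open>The commutator \<open>A\<close> of the tangent vector and the projection is X U^T - U
  X^T, an infinitesimal rotation of the columns of \<open>U ** R\<close> towards those of
  \<open>Q\<close>. As \<open>A\<close> is antisymmetric, exp(-A) is the transpose of exp(A), so
  conjugating a projection by it just moves the frame.\<close>

lemma gr_exp_tangent_of: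
  assumes U: "U \<in> stiefel" and Q: "Q \<in> stiefel" and R: "orthogonal_matrix R"
    and UQ: "transpose U ** (Q ** diag s) = 0"
  shows "gr_exp (proj U) (tangent_of U (Q ** diag s ** transpose R)) = proj (rotation_curve (U ** R) Q s 1)"
proof -
  define X where "X = Q ** diag s ** transpose R"
  define A where "A = commutator (tangent_of U X) (proj U)"
  have X: "transpose U ** X = 0"
    using UQ by (simp add: X_def matrix_mul_assoc matrix_mult.zero_left)
  have X': "transpose X ** U = 0"
    using arg_cong[OF X, of transpose] by (simp add: transpose_zero)
  have "tangent_of U X ** proj U = X ** transpose U"
    using tangent_of_tangent(2)[OF U X] by (simp add: hor_lift_def proj_def matrix_mul_assoc)
  moreover from arg_cong[OF this, of transpose] have "proj U ** tangent_of U X = U ** transpose X"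
    by (simp add: tangent_of_def transpose_add add.commute)
  ultimately have A: "A = X ** transpose U - U ** transpose X"
    by (simp add: A_def commutator_def)
  have antisym: "transpose A = - A"
    by (simp add: A transpose_diff)
  have XR: "X ** R = Q ** diag s"
    by (simp add: X_def orthogonal_matrix_cancel[OF R])
  have AV: "A ** (U ** R) = Q ** diag s"
    by (simp add: A matrix_mult.diff_left flip: matrix_mul_assoc)
       (simp add: stiefel_cancel[OF U] matrix_mul_assoc XR X' matrix_mult.zero_left
         matrix_mult.zero_right flip: matrix_mul_assoc[of U "transpose X"])
  have "transpose X ** (Q ** diag s) = R ** diag (\<lambda>i. (s i)\<^sup>2)"
    by (simp add: X_def stiefel_cancel[OF Q] diag_mult_diag power2_eq_square flip: matrix_mul_assoc)
  then have AQ: "A ** (Q ** diag s) = - (U ** R ** diag (\<lambda>i. (s i)\<^sup>2))"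
    using UQ by (simp add: A matrix_mult.diff_left matrix_mult.zero_right flip: matrix_mul_assoc)
  have E: "matrix_exp A ** (U ** R) = rotation_curve (U ** R) Q s 1"
    using matrix_exp_rotation[OF AV AQ] by (simp add: rotation_curve_def)
  have "gr_exp (proj U) (tangent_of U X) = matrix_exp A ** proj (U ** R) ** matrix_exp (transpose A)"
    using antisym proj_mult_orthogonal[OF R, of U] by (simp add: gr_exp_def A_def)
  also have "\<dots> = proj (matrix_exp A ** (U ** R))"
    by (simp add: matrix_exp_transpose proj_def matrix_mul_assoc)
  finally show ?thesis unfolding E X_def .
qed

lemma tangent_of_scaleR: "t *\<^sub>R tangent_of U X = tangent_of U (t *\<^sub>R X)"
  by (simp add: tangent_of_def scaleR_add_right transpose_scaleR matrix_mult.scaleR_left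
      matrix_mult.scaleR_right)

lemma gr_exp_geodesic:
  assumes U: "U \<in> stiefel" and Q: "Q \<in> stiefel" and R: "orthogonal_matrix R"
    and UQ: "transpose U ** (Q ** diag s) = 0"
  shows "gr_exp (proj U) (t *\<^sub>R tangent_of U (Q ** diag s ** transpose R))
    = proj (rotation_curve (U ** R) Q s t)"
proof -
  have "t *\<^sub>R tangent_of U (Q ** diag s ** transpose R)
      = tangent_of U (Q ** diag (\<lambda>i. t * s i) ** transpose R)"
    unfolding scaleR_diag[symmetric] tangent_of_scaleR
    by (simp add: matrix_mult.scaleR_left matrix_mult.scaleR_right del: scaleR_diag)
  moreover have "transpose U ** (Q ** diag (\<lambda>i. t * s i)) = 0"
    by (rule cross_zero[OF UQ]) simp
  ultimately show ?thesis
    using gr_exp_tangent_of[OF U Q R, of "\<lambda>i. t * s i"]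
    by (simp add: rotation_curve_def)
qed

section \<open>Velocity, speed and length of rotation curves\<close>

lemma has_vector_derivative_diag:
  assumes "\<And>i. (f i has_real_derivative f' i) (at t)"
  shows "((\<lambda>t. diag (\<lambda>i. f i t)) has_vector_derivative diag f') (at t)"
proof -
  define E :: "'a \<Rightarrow> real^'a^'a" where "E i = diag (\<lambda>j. if j = i then 1 else 0)" for i
  have eq: "diag g = (\<Sum>i\<in>UNIV. g i *\<^sub>R E i)" for g
    by (simp add: E_def del: scaleR_diag) (simp add: vec_eq_iff if_distrib[of "(*) _"] cong: if_cong)
  show ?thesis
    unfolding eq using assms
    by (intro has_vector_derivative_sum)
       (auto intro!: derivative_eq_intros simp: has_real_derivative_iff_has_vector_derivative)
qed

definition rotation_velocity :: "real^'p^'n \<Rightarrow> real^'p^'n \<Rightarrow> ('p \<Rightarrow> real) \<Rightarrow> real \<Rightarrow> real^'p^'n" where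
  "rotation_velocity V Q s t =
     Q ** diag (\<lambda>i. s i * cos (t * s i)) - V ** diag (\<lambda>i. s i * sin (t * s i))"

lemma rotation_curve_derivative:
  "(rotation_curve V Q s has_vector_derivative rotation_velocity V Q s t) (at t)"
proof -
  have c: "((\<lambda>t. diag (\<lambda>i. cos (t * s i))) has_vector_derivative diag (\<lambda>i. - (s i * sin (t * s i)))) (at t)"
    by (rule has_vector_derivative_diag) (auto intro!: derivative_eq_intros)
  have n: "((\<lambda>t. diag (\<lambda>i. sin (t * s i))) has_vector_derivative diag (\<lambda>i. s i * cos (t * s i))) (at t)"
    by (rule has_vector_derivative_diag) (auto intro!: derivative_eq_intros)
  have "((\<lambda>t. V ** diag (\<lambda>i. cos (t * s i)) + Q ** diag (\<lambda>i. sin (t * s i))) has_vector_derivative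
      V ** diag (\<lambda>i. - (s i * sin (t * s i))) + Q ** diag (\<lambda>i. s i * cos (t * s i))) (at t)"
    by (intro has_vector_derivative_add
        bounded_linear.has_vector_derivative[OF matrix_mult.bounded_linear_right] c n)
  moreover have "V ** diag (\<lambda>i. - (s i * sin (t * s i))) + Q ** diag (\<lambda>i. s i * cos (t * s i))
      = rotation_velocity V Q s t"
    by (simp add: rotation_velocity_def vec_eq_iff)
  ultimately show ?thesis
    unfolding rotation_curve_def[abs_def] by simp
qed

text \<open>Needed for \<open>gr_norm_tangent_of\<close> at every time, so that the speed in the
  Grassmannian is the norm of the velocity of the frame.\<close>

lemma rotation_velocity_horizontal:
  assumes V: "V \<in> stiefel" and Q: "Q \<in> stiefel" and VQ: "transpose V ** (Q ** diag s) = 0"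
  shows "transpose (rotation_curve V Q s t) ** rotation_velocity V Q s t = 0"
proof -
  note z = cross_zero[OF VQ, of "\<lambda>x. x * cos (t * x)", simplified]
    cross_zero[OF VQ, of "\<lambda>x. sin (t * x)", simplified]
  have "transpose (rotation_curve V Q s t) ** rotation_velocity V Q s t
     = diag (\<lambda>i. sin (t * s i)) ** diag (\<lambda>i. s i * cos (t * s i))
       - diag (\<lambda>i. cos (t * s i)) ** diag (\<lambda>i. s i * sin (t * s i))
       + diag (\<lambda>i. cos (t * s i)) ** (transpose V ** (Q ** diag (\<lambda>i. s i * cos (t * s i))))
       - diag (\<lambda>i. sin (t * s i)) ** (transpose Q ** V) ** diag (\<lambda>i. s i * sin (t * s i))"
    by (simp add: rotation_curve_def rotation_velocity_def transpose_add matrix_mult.add_left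
        matrix_mult.diff_right stiefel_cancel[OF V] stiefel_cancel[OF Q] flip: matrix_mul_assoc)
  also have "\<dots> = 0"
    unfolding z by (simp add: diag_mult_diag vec_eq_iff matrix_mult.zero_left matrix_mult.zero_right)
  finally show ?thesis .
qed

lemma norm_rotation_velocity:
  assumes V: "V \<in> stiefel" and Q: "Q \<in> stiefel" and VQ: "transpose V ** (Q ** diag s) = 0"
  shows "norm (rotation_velocity V Q s t) = sqrt (\<Sum>i\<in>UNIV. (s i)\<^sup>2)"
proof -
  have "a * cos x * (a * cos x) + a * sin x * (a * sin x) = a\<^sup>2 * ((cos x)\<^sup>2 + (sin x)\<^sup>2)" for a x :: real
    by (simp only: power2_eq_square algebra_simps)
  then have trig: "a * cos x * (a * cos x) + a * sin x * (a * sin x) = a\<^sup>2" for a x :: real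
    by simp
  note z = cross_zero[OF VQ, of "\<lambda>x. x * cos (t * x)", simplified]
  have "transpose (rotation_velocity V Q s t) ** rotation_velocity V Q s t
     = diag (\<lambda>i. s i * cos (t * s i)) ** diag (\<lambda>i. s i * cos (t * s i))
       + diag (\<lambda>i. s i * sin (t * s i)) ** diag (\<lambda>i. s i * sin (t * s i))
       - diag (\<lambda>i. s i * sin (t * s i)) ** (transpose V ** (Q ** diag (\<lambda>i. s i * cos (t * s i))))
       - diag (\<lambda>i. s i * cos (t * s i)) ** (transpose Q ** V) ** diag (\<lambda>i. s i * sin (t * s i))"
    by (simp add: rotation_velocity_def transpose_diff matrix_mult.diff_left
        matrix_mult.diff_right stiefel_cancel[OF V] stiefel_cancel[OF Q] flip: matrix_mul_assoc)
  also have "\<dots> = diag (\<lambda>i. (s i)\<^sup>2)"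
    unfolding z using trig
    by (simp add: diag_mult_diag vec_eq_iff matrix_mult.zero_left matrix_mult.zero_right)
  finally have "transpose (rotation_velocity V Q s t) ** rotation_velocity V Q s t = diag (\<lambda>i. (s i)\<^sup>2)" .
  then have "rotation_velocity V Q s t \<bullet> rotation_velocity V Q s t = (\<Sum>i\<in>UNIV. (s i)\<^sup>2)"
    by (simp add: trace_diag flip: trace_transpose_mult_inner)
  then show ?thesis by (simp add: norm_eq_sqrt_inner)
qed

lemma proj_rotation_curve_derivative:
  "((\<lambda>t. proj (rotation_curve V Q s t)) has_vector_derivative
     tangent_of (rotation_curve V Q s t) (rotation_velocity V Q s t)) (at t)"
  using matrix_mult.has_vector_derivative[OF rotation_curve_derivative[of V Q s t]
      bounded_linear.has_vector_derivative[OF bounded_linear_transpose rotation_curve_derivative[of V Q s t]]]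
  unfolding proj_def tangent_of_def by (simp add: add.commute)

lemma continuous_on_rotation_curve: "continuous_on S (rotation_curve V Q s)"
  by (intro continuous_at_imp_continuous_on ballI has_vector_derivative_continuous[OF rotation_curve_derivative])

lemma continuous_on_rotation_velocity: "continuous_on S (rotation_velocity V Q s)"
proof -
  have d: "continuous_on S (\<lambda>t. diag (\<lambda>i. f i t))" if "\<And>i. continuous_on S (f i)" for f :: "'a \<Rightarrow> real \<Rightarrow> real"
  proof -
    have "continuous_on S (\<lambda>t. if i = j then f i t else 0)" for i j
      using that by (cases "i = j") auto
    then show ?thesis
      unfolding diag_def by (intro continuous_on_vec_lambda)
  qed
  show ?thesis
    unfolding rotation_velocity_def
    by (intro continuous_on_diff matrix_mult.continuous_on continuous_on_const d continuous_intros)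
qed

text \<open>The assumption on \<open>\<gamma>\<close> is confined to the interval because a shortest
  geodesic is prescribed only on [0,1]; the derivative within the interval ignores all other
  values.\<close>

lemma gr_speed_rotation_curve:
  assumes V: "V \<in> stiefel" and Q: "Q \<in> stiefel" and VQ: "transpose V ** (Q ** diag s) = 0"
    and ab: "a < b" "t \<in> {a..b}" and eq: "\<And>t. t \<in> {a..b} \<Longrightarrow> \<gamma> t = proj (rotation_curve V Q s t)"
  shows "gr_speed a b \<gamma> t = sqrt (\<Sum>i\<in>UNIV. (s i)\<^sup>2)"
proof -
  have "((\<lambda>t. proj (rotation_curve V Q s t)) has_vector_derivative
     tangent_of (rotation_curve V Q s t) (rotation_velocity V Q s t)) (at t within {a..b})"
    by (rule has_vector_derivative_at_within[OF proj_rotation_curve_derivative])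
  then have "(\<gamma> has_vector_derivative
     tangent_of (rotation_curve V Q s t) (rotation_velocity V Q s t)) (at t within {a..b})"
    by (rule has_vector_derivative_transform[OF ab(2) eq, rotated]) auto
  then have "vector_derivative \<gamma> (at t within {a..b})
      = tangent_of (rotation_curve V Q s t) (rotation_velocity V Q s t)"
    using ab vector_derivative_within_cbox[of a b t \<gamma>] by simp
  then show ?thesis
    by (simp add: gr_speed_def gr_norm_tangent_of[OF rotation_curve_stiefel[OF V Q VQ]
          rotation_velocity_horizontal[OF V Q VQ]] norm_rotation_velocity[OF V Q VQ])
qed

lemma curve_length_rotation_curve:
  assumes V: "V \<in> stiefel" and Q: "Q \<in> stiefel" and VQ: "transpose V ** (Q ** diag s) = 0"
    and "a < b" and "\<And>t. t \<in> {a..b} \<Longrightarrow> \<gamma> t = proj (rotation_curve V Q s t)"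
  shows "curve_length a b \<gamma> = (b - a) * sqrt (\<Sum>i\<in>UNIV. (s i)\<^sup>2)"
proof -
  have "integral {a..b} (gr_speed a b \<gamma>) = integral {a..b} (\<lambda>t. sqrt (\<Sum>i\<in>UNIV. (s i)\<^sup>2))"
    by (rule Henstock_Kurzweil_Integration.integral_cong) (rule gr_speed_rotation_curve[OF assms(1-4) _ assms(5)])
  then show ?thesis
    using \<open>a < b\<close> by (simp add: curve_length_def)
qed

lemma gr_curve_rotation_curve:
  assumes V: "V \<in> stiefel" and Q: "Q \<in> stiefel" and VQ: "transpose V ** (Q ** diag s) = 0"
  shows "gr_curve CARD('p) (proj V) (proj (rotation_curve V (Q :: real^'p^'n) s 1))
    (\<lambda>t. proj (rotation_curve V Q s t))"
proof -
  let ?g = "\<lambda>t. proj (rotation_curve V Q s t)"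
  have "?g C1_differentiable_on {0..1}"
    unfolding C1_differentiable_on_def tangent_of_def
    by (intro exI[of _ "\<lambda>t. tangent_of (rotation_curve V Q s t) (rotation_velocity V Q s t)"]
        conjI ballI proj_rotation_curve_derivative)
       (auto simp: tangent_of_def intro!: continuous_intros matrix_mult.continuous_on
         bounded_linear.continuous_on[OF bounded_linear_transpose] continuous_on_rotation_curve
         continuous_on_rotation_velocity)
  then have "?g piecewise_C1_differentiable_on {0..1}"
    by (rule C1_differentiable_imp_piecewise)
  moreover have "gr_speed 0 1 ?g integrable_on {0..1}"
    using integrable_const_ivl[where a = 0 and b = "1 :: real" and c = "sqrt (\<Sum>i\<in>UNIV. (s i)\<^sup>2)"]
    by (rule integrable_eq) (simp add: gr_speed_rotation_curve[OF V Q VQ, of 0 1])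
  moreover have "?g ` {0..1} \<subseteq> grassmann CARD('p)"
    using rotation_curve_stiefel[OF V Q VQ] proj_in_grassmann by blast
  ultimately show ?thesis
    by (simp add: gr_curve_def rotation_curve_0)
qed

section \<open>Truncations of the power series of \<open>arcsin\<^sup>2\<close>\<close>

text \<open>\<open>asq_poly m\<close> is the \<open>m\<close>-th partial sum of the power series of \<open>(arcsin \<surd>z)\<^sup>2\<close>. The numbers
  \<open>asq_rem m\<close> are the coefficients of the defect in the differential equation of this
  function, which in the variable \<open>z = sin\<^sup>2 x\<close> reads \<open>h'' = 2\<close>.\<close>

primrec asq_rem :: "nat \<Rightarrow> real" where
  "asq_rem 0 = 2"
| "asq_rem (Suc m) = asq_rem m * (2 * real m + 2) / (2 * real m + 1)"

definition asq_coeff :: "nat \<Rightarrow> real" where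
  "asq_coeff m = asq_rem m / ((2 * real m + 2) * (2 * real m + 1))"

definition asq_poly :: "nat \<Rightarrow> real \<Rightarrow> real" where
  "asq_poly m z = (\<Sum>k<m. asq_coeff k * z ^ Suc k)"

definition asq_poly' :: "nat \<Rightarrow> real \<Rightarrow> real" where
  "asq_poly' m z = (\<Sum>k<m. asq_coeff k * (real (Suc k) * z ^ k))"

lemma asq_rem_pos: "0 < asq_rem m"
  by (induction m) (auto intro!: divide_pos_pos mult_pos_pos)

text \<open>A crude bound (the true growth is of order sqrt m). A polynomial bound suffices, as
  these numbers will be multiplied by a geometric sequence.\<close>

lemma asq_rem_le: "asq_rem m \<le> 2 * (2 * real m + 1)"
proof (induction m)
  case (Suc m)
  have "asq_rem (Suc m) \<le> 2 * (2 * real m + 1) * (2 * real m + 2) / (2 * real m + 1)"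
    using Suc by (simp add: divide_right_mono mult_right_mono)
  also have "\<dots> = 2 * (2 * real m + 2)"
    by (simp add: field_simps)
  finally show ?case by simp
qed simp

lemma asq_coeff_pos: "0 < asq_coeff m"
  by (auto simp: asq_coeff_def intro!: divide_pos_pos mult_pos_pos asq_rem_pos)

text \<open>The second derivative of sin^(2m+2) is (2m+2)(2m+1) sin^(2m) - (2m+2)^2 sin^(2m+2). The
  coefficient is chosen so that its first term cancels the current defect; its second term is the
  next defect.\<close>

lemma asq_coeff_rem:
  "asq_coeff m * ((2 * real m + 2) * (2 * real m + 1)) = asq_rem m"
  "asq_coeff m * (2 * real m + 2)\<^sup>2 = asq_rem (Suc m)"
proof -
  have "2 * real m + 1 > 0" by simp
  then show "asq_coeff m * ((2 * real m + 2) * (2 * real m + 1)) = asq_rem m"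
    by (simp add: asq_coeff_def)
  show "asq_coeff m * (2 * real m + 2)\<^sup>2 = asq_rem (Suc m)"
    by (simp add: asq_coeff_def power2_eq_square divide_simps)
qed

lemma asq_poly_nonneg: "0 \<le> z \<Longrightarrow> 0 \<le> asq_poly m z"
  using asq_coeff_pos by (auto simp: asq_poly_def less_imp_le intro!: sum_nonneg mult_nonneg_nonneg)

lemma asq_poly'_nonneg: "0 \<le> z \<Longrightarrow> 0 \<le> asq_poly' m z"
  using asq_coeff_pos by (auto simp: asq_poly'_def less_imp_le intro!: sum_nonneg mult_nonneg_nonneg)

lemma asq_poly_mono: "0 \<le> y \<Longrightarrow> y \<le> z \<Longrightarrow> asq_poly m y \<le> asq_poly m z"
  unfolding asq_poly_def
  by (intro sum_mono mult_left_mono power_mono) (use asq_coeff_pos in \<open>auto simp: less_imp_le\<close>)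

definition asq_sin' :: "nat \<Rightarrow> real \<Rightarrow> real" where
  "asq_sin' m x = asq_poly' m ((sin x)\<^sup>2) * (2 * sin x * cos x)"

lemma asq_sin_derivative:
  "((\<lambda>x. asq_poly m ((sin x)\<^sup>2)) has_real_derivative asq_sin' m x) (at x)"
proof -
  have "(asq_poly m has_real_derivative asq_poly' m z) (at z)" for z
    unfolding asq_poly_def[abs_def] asq_poly'_def
    by (auto intro!: derivative_eq_intros sum.cong simp del: power_Suc simp: mult_ac)
  then show ?thesis
    unfolding asq_sin'_def by (rule DERIV_chain2[where g = "\<lambda>x. (sin x)\<^sup>2"]) (auto intro!: derivative_eq_intros)
qed

text \<open>The contributions of the summands telescope. What remains of the defect is a single term
  of known sign, so that h'' is at most 2, and close to 2 away from \<pi>/2 for large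
  \<open>m\<close>.\<close>

lemma asq_sin'_derivative:
  "(asq_sin' m has_real_derivative 2 - asq_rem m * (sin x) ^ (2 * m)) (at x)"
proof -
  have eq: "asq_sin' m = (\<lambda>x. \<Sum>k<m. asq_coeff k * (2 * real k + 2) * (sin x ^ (2 * k + 1) * cos x))"
    by (auto simp: asq_sin'_def asq_poly'_def sum_distrib_left sum_distrib_right
        fun_eq_iff algebra_simps intro!: sum.cong simp flip: power_mult)
  have summand: "((\<lambda>x. sin x ^ (2 * k + 1) * cos x) has_real_derivative
      (2 * real k + 1) * sin x ^ (2 * k) - (2 * real k + 2) * sin x ^ (2 * k + 2)) (at x)" for k
  proof -
    have "((\<lambda>x. sin x ^ (2 * k + 1) * cos x) has_real_derivative
      (2 * real k + 1) * sin x ^ (2 * k) * (cos x)\<^sup>2 - sin x ^ (2 * k + 1) * sin x) (at x)"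
      unfolding Suc_eq_plus1[symmetric]
      by (rule DERIV_cong[OF DERIV_mult[OF DERIV_power_Suc[OF DERIV_sin] DERIV_cos]])
         (simp add: power2_eq_square algebra_simps)
    also have "(2 * real k + 1) * sin x ^ (2 * k) * (cos x)\<^sup>2 - sin x ^ (2 * k + 1) * sin x
       = (2 * real k + 1) * sin x ^ (2 * k) - (2 * real k + 2) * sin x ^ (2 * k + 2)"
      unfolding cos_squared_eq by (simp add: algebra_simps power2_eq_square)
    finally show ?thesis .
  qed
  have "(\<Sum>k<m. asq_coeff k * (2 * real k + 2) *
      ((2 * real k + 1) * sin x ^ (2 * k) - (2 * real k + 2) * sin x ^ (2 * k + 2)))
      = 2 - asq_rem m * (sin x) ^ (2 * m)"
  proof (induction m)
    case (Suc m)
    have "asq_coeff m * (2 * real m + 2) *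
        ((2 * real m + 1) * sin x ^ (2 * m) - (2 * real m + 2) * sin x ^ (2 * m + 2))
        = asq_coeff m * ((2 * real m + 2) * (2 * real m + 1)) * sin x ^ (2 * m)
          - asq_coeff m * (2 * real m + 2)\<^sup>2 * sin x ^ (2 * m + 2)"
      by (simp only: power2_eq_square algebra_simps)
    also have "\<dots> = asq_rem m * sin x ^ (2 * m) - asq_rem (Suc m) * sin x ^ (2 * Suc m)"
      unfolding asq_coeff_rem by simp
    finally show ?case
      unfolding sum.lessThan_Suc Suc by simp
  qed simp
  moreover have "(asq_sin' m has_real_derivative (\<Sum>k<m. asq_coeff k * (2 * real k + 2) *
      ((2 * real k + 1) * sin x ^ (2 * k) - (2 * real k + 2) * sin x ^ (2 * k + 2)))) (at x)"
    unfolding eq by (intro DERIV_sum DERIV_cmult summand)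
  ultimately show ?thesis by simp
qed

text \<open>This differential inequality makes the square root of the trace of \<open>asq_poly m\<close>
  1-Lipschitz along curves.\<close>

lemma asq_poly'_bound:
  assumes "0 \<le> z" "z \<le> 1"
  shows "(asq_poly' m z)\<^sup>2 * (z * (1 - z)) \<le> asq_poly m z"
proof -
  define x where "x = arcsin (sqrt z)"
  have sz: "0 \<le> sqrt z" "sqrt z \<le> 1"
    using assms by auto
  then have "-1 \<le> sqrt z" by linarith
  note sz = sz this
  have x: "0 \<le> x" "x \<le> pi / 2"
    using sz arcsin_le_arcsin[of 0 "sqrt z"] arcsin_bounded[of "sqrt z"] by (auto simp: x_def)
  have sinx: "sin x = sqrt z"
    unfolding x_def using sz by (intro sin_arcsin)
  then have z: "(sin x)\<^sup>2 = z" using assms by simp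
  have nonneg: "0 \<le> asq_sin' m y" if "0 \<le> y" "y \<le> pi / 2" for y
    using that unfolding asq_sin'_def
    by (intro mult_nonneg_nonneg asq_poly'_nonneg sin_ge_zero cos_ge_zero) auto
  \<comment> \<open>For h(y) = \<open>asq_poly m ((sin y)\<^sup>2)\<close> the claim reads h'^2
    \<le> 4h. The difference \<open>G\<close> is 0 at 0 and has derivative 2h'(2 - h''), a product
    of nonnegative factors on the interval; for h(y) = y^2 it would vanish identically.\<close>
  define G where "G y = 4 * asq_poly m ((sin y)\<^sup>2) - (asq_sin' m y)\<^sup>2" for y
  have "\<exists>d. (G has_real_derivative d) (at y) \<and> 0 \<le> d" if "0 \<le> y" "y \<le> x" for y
  proof (intro exI conjI)
    show "(G has_real_derivative 2 * asq_sin' m y * (asq_rem m * sin y ^ (2 * m))) (at y)"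
      unfolding G_def
      by (rule derivative_eq_intros asq_sin_derivative asq_sin'_derivative refl)+ (simp add: algebra_simps)
    show "0 \<le> 2 * asq_sin' m y * (asq_rem m * sin y ^ (2 * m))"
      using nonneg[of y] that x asq_rem_pos[of m] by (auto simp: power_mult intro!: mult_nonneg_nonneg)
  qed
  then have "G 0 \<le> G x"
    using x(1) DERIV_nonneg_imp_nondecreasing[of 0 x G] by blast
  moreover have "G 0 = 0"
    by (simp add: G_def asq_sin'_def asq_poly_def)
  ultimately have "(asq_sin' m x)\<^sup>2 \<le> 4 * asq_poly m z"
    by (simp add: G_def z)
  moreover have "(asq_sin' m x)\<^sup>2 = 4 * ((asq_poly' m z)\<^sup>2 * (z * (1 - z)))"
    unfolding asq_sin'_def power_mult_distrib cos_squared_eq z by simp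
  ultimately show ?thesis by simp
qed

text \<open>Integrate h'' \<ge> 2 - e twice from 0, where h(t) =
  \<open>asq_poly m ((sin t)\<^sup>2)\<close> and e = \<open>asq_rem m * sin y ^ (2 * m)\<close> is
  the largest defect on [0,y].\<close>

lemma asq_poly_lower:
  assumes "0 \<le> x" "x \<le> y" "y \<le> pi / 2"
  shows "(1 - asq_rem m * sin y ^ (2 * m) / 2) * x\<^sup>2 \<le> asq_poly m ((sin x)\<^sup>2)"
proof -
  define e where "e = asq_rem m * sin y ^ (2 * m)"
  have v: "(2 - e) * t \<le> asq_sin' m t" if t: "0 \<le> t" "t \<le> y" for t
  proof -
    have "\<exists>d. ((\<lambda>t. asq_sin' m t - (2 - e) * t) has_real_derivative d) (at s) \<and> 0 \<le> d"
      if s: "0 \<le> s" "s \<le> t" for s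
    proof (intro exI conjI)
      show "((\<lambda>t. asq_sin' m t - (2 - e) * t) has_real_derivative
          (2 - asq_rem m * (sin s) ^ (2 * m)) - (2 - e)) (at s)"
        by (rule derivative_eq_intros asq_sin'_derivative refl)+ simp
      have "sin s ^ (2 * m) \<le> sin y ^ (2 * m)"
        using s t assms by (intro power_mono sin_ge_zero sin_monotone_2pi_le) auto
      then show "0 \<le> (2 - asq_rem m * (sin s) ^ (2 * m)) - (2 - e)"
        using asq_rem_pos[of m] by (simp add: e_def)
    qed
    then show ?thesis
      using t(1) DERIV_nonneg_imp_nondecreasing[of 0 t "\<lambda>t. asq_sin' m t - (2 - e) * t"]
      by (auto simp: asq_sin'_def)
  qed
  have "\<exists>d. ((\<lambda>t. asq_poly m ((sin t)\<^sup>2) - (1 - e / 2) * t\<^sup>2) has_real_derivative d) (at t) \<and> 0 \<le> d"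
    if t: "0 \<le> t" "t \<le> x" for t
  proof (intro exI conjI)
    show "((\<lambda>t. asq_poly m ((sin t)\<^sup>2) - (1 - e / 2) * t\<^sup>2) has_real_derivative
        asq_sin' m t - (2 - e) * t) (at t)"
      by (rule derivative_eq_intros asq_sin_derivative refl)+ (simp add: algebra_simps)
    show "0 \<le> asq_sin' m t - (2 - e) * t"
      using v[of t] t assms by simp
  qed
  then show ?thesis
    using assms(1) DERIV_nonneg_imp_nondecreasing[of 0 x "\<lambda>t. asq_poly m ((sin t)\<^sup>2) - (1 - e / 2) * t\<^sup>2"]
    by (auto simp: asq_poly_def e_def)
qed

lemma asq_rem_power_tendsto:
  assumes "0 \<le> q" "q < 1"
  shows "(\<lambda>m. asq_rem m * q ^ m) \<longlonglongrightarrow> 0"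
proof (rule tendsto_sandwich[OF always_eventually always_eventually])
  show "\<forall>m. 0 \<le> asq_rem m * q ^ m"
    using assms asq_rem_pos by (simp add: less_imp_le)
  show "\<forall>m. asq_rem m * q ^ m \<le> 4 * (real m * q ^ m) + 2 * q ^ m"
    using assms mult_right_mono[OF asq_rem_le, of "q ^ _"] by (auto simp: algebra_simps)
  show "(\<lambda>m. 4 * (real m * q ^ m) + 2 * q ^ m) \<longlonglongrightarrow> 0"
    using assms tendsto_add[OF tendsto_mult[OF tendsto_const[of 4] powser_times_n_limit_0[of q]]
        tendsto_mult[OF tendsto_const[of 2] LIMSEQ_power_zero[of q]]] by simp
qed auto

text \<open>The estimate \<open>asq_poly_lower\<close> degenerates at \<pi>/2, where sin = 1. All
  angles are therefore shrunk by a factor \<open>\<tau>\<close> < 1, which by monotonicity only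
  decreases the polynomials. Then \<open>m\<close> tends to infinity with sin^2 bounded away from 1,
  and finally \<open>\<tau>\<close> tends to 1.\<close>

lemma sum_squares_le_of_asq_poly:
  fixes \<theta> :: "'i \<Rightarrow> real"
  assumes "finite I" and \<theta>: "\<And>i. i \<in> I \<Longrightarrow> 0 \<le> \<theta> i \<and> \<theta> i \<le> pi / 2"
    and le: "\<And>m. (\<Sum>i\<in>I. asq_poly m ((sin (\<theta> i))\<^sup>2)) \<le> L"
  shows "(\<Sum>i\<in>I. (\<theta> i)\<^sup>2) \<le> L"
proof -
  have scaled: "\<tau>\<^sup>2 * (\<Sum>i\<in>I. (\<theta> i)\<^sup>2) \<le> L" if \<tau>: "0 < \<tau>" "\<tau> < 1" for \<tau>
  proof -
    define y where "y = \<tau> * (pi / 2)"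
    have y: "0 \<le> y" "y < pi / 2" using \<tau> by (auto simp: y_def)
    have sy: "0 \<le> (sin y)\<^sup>2" "(sin y)\<^sup>2 < 1"
      using y sin_monotone_2pi[of y "pi / 2"] sin_ge_zero[of y] by (auto simp: power2_eq_square intro!: mult_strict_mono[of "sin y" 1 "sin y" 1, simplified])
    have bound: "(1 - asq_rem m * ((sin y)\<^sup>2) ^ m / 2) * (\<Sum>i\<in>I. (\<tau> * \<theta> i)\<^sup>2) \<le> L" for m
    proof -
      have "(1 - asq_rem m * ((sin y)\<^sup>2) ^ m / 2) * (\<tau> * \<theta> i)\<^sup>2 \<le> asq_poly m ((sin (\<theta> i))\<^sup>2)"
        if "i \<in> I" for i
      proof -
        have t: "0 \<le> \<tau> * \<theta> i" "\<tau> * \<theta> i \<le> \<theta> i" "\<tau> * \<theta> i \<le> y"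
          using \<theta>[OF that] \<tau> by (auto simp: y_def mult_left_le_one_le intro!: mult_left_mono)
        have "(1 - asq_rem m * ((sin y)\<^sup>2) ^ m / 2) * (\<tau> * \<theta> i)\<^sup>2 \<le> asq_poly m ((sin (\<tau> * \<theta> i))\<^sup>2)"
          using asq_poly_lower[of "\<tau> * \<theta> i" y m] t y by (simp add: power_mult)
        also have "\<dots> \<le> asq_poly m ((sin (\<theta> i))\<^sup>2)"
          using t \<theta>[OF that]
          by (intro asq_poly_mono power_mono sin_monotone_2pi_le sin_ge_zero) auto
        finally show ?thesis .
      qed
      then have "(\<Sum>i\<in>I. (1 - asq_rem m * ((sin y)\<^sup>2) ^ m / 2) * (\<tau> * \<theta> i)\<^sup>2)
          \<le> (\<Sum>i\<in>I. asq_poly m ((sin (\<theta> i))\<^sup>2))"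
        by (rule sum_mono)
      with le[of m] show ?thesis by (simp add: sum_distrib_left)
    qed
    have "(\<lambda>m. (1 - asq_rem m * ((sin y)\<^sup>2) ^ m / 2) * (\<Sum>i\<in>I. (\<tau> * \<theta> i)\<^sup>2))
        \<longlonglongrightarrow> (1 - 0 / 2) * (\<Sum>i\<in>I. (\<tau> * \<theta> i)\<^sup>2)"
      by (intro tendsto_intros asq_rem_power_tendsto sy) auto
    then have "(1 - 0 / 2) * (\<Sum>i\<in>I. (\<tau> * \<theta> i)\<^sup>2) \<le> L"
      by (rule LIMSEQ_le_const2) (use bound in auto)
    then show ?thesis by (simp add: power_mult_distrib sum_distrib_left)
  qed
  have "((\<lambda>\<tau>. \<tau>\<^sup>2 * (\<Sum>i\<in>I. (\<theta> i)\<^sup>2)) \<longlongrightarrow> 1\<^sup>2 * (\<Sum>i\<in>I. (\<theta> i)\<^sup>2)) (at_left (1::real))"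
    by (intro tendsto_intros)
  moreover have "\<forall>\<^sub>F \<tau> in at_left (1::real). \<tau>\<^sup>2 * (\<Sum>i\<in>I. (\<theta> i)\<^sup>2) \<le> L"
    using eventually_at_left_real[of 0 "1::real"] by (auto elim!: eventually_mono intro: scaled)
  ultimately show ?thesis
    using tendsto_upperbound[of "\<lambda>\<tau>. \<tau>\<^sup>2 * (\<Sum>i\<in>I. (\<theta> i)\<^sup>2)" "1\<^sup>2 * (\<Sum>i\<in>I. (\<theta> i)\<^sup>2)" "at_left (1::real)" L]
    by simp
qed

section \<open>A lower bound for the length of curves\<close>

lemma matrix_power_conj:
  assumes "orthogonal_matrix Q"
  shows "matrix_power (Q ** diag z ** transpose Q) k = Q ** diag (\<lambda>i. z i ^ k) ** transpose Q"
proof (induction k)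
  case 0
  then show ?case using orthogonal_matrixD[OF assms] by (simp add: diag_one)
next
  case (Suc k)
  have "Q ** diag z ** transpose Q ** (Q ** diag (\<lambda>i. z i ^ k) ** transpose Q)
      = Q ** (diag z ** diag (\<lambda>i. z i ^ k)) ** transpose Q"
    by (simp add: orthogonal_matrix_cancel[OF assms] flip: matrix_mul_assoc)
  then show ?case by (simp add: Suc diag_mult_diag)
qed

lemma trace_conj:
  assumes "orthogonal_matrix Q"
  shows "trace (Q ** diag z ** transpose Q) = (\<Sum>i\<in>UNIV. z i)"
  using trace_mul_sym[of "Q ** diag z" "transpose Q"]
  by (simp add: orthogonal_matrix_cancel[OF assms] matrix_mul_assoc trace_diag orthogonal_matrixD[OF assms])

lemma matrix_power_commute_right:
  assumes "B ** A = A ** B"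
  shows "matrix_power A k ** B = B ** matrix_power A k"
proof (induction k)
  case (Suc k)
  have "A ** matrix_power A k ** B = A ** (B ** matrix_power A k)"
    by (simp add: Suc flip: matrix_mul_assoc)
  also have "\<dots> = B ** (A ** matrix_power A k)"
    by (simp add: matrix_mul_assoc assms)
  finally show ?case by simp
qed simp

text \<open>\<open>Z t\<close> and \<open>Z'\<close> need not commute, so the rule k Z^(k-1) Z' is
  available only under a trace. The statement is for all \<open>B\<close> commuting with
  \<open>Z t\<close> because the induction step replaces \<open>B\<close> by
  \<open>B ** Z t\<close>; the application takes \<open>B = mat 1\<close>.\<close>

lemma matrix_power_derivative:
  fixes Z :: "real \<Rightarrow> real^'n^'n"
  assumes Z: "(Z has_vector_derivative Z') (at t)"
  shows "\<exists>D. ((\<lambda>t. matrix_power (Z t) k) has_vector_derivative D) (at t) \<and>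
    (\<forall>B. B ** Z t = Z t ** B \<longrightarrow> trace (B ** D) = real k * trace (B ** matrix_power (Z t) (k - 1) ** Z'))"
proof (induction k)
  case 0
  then show ?case
    by (intro exI[of _ 0]) (auto simp: matrix_mult.zero_right trace_zero intro!: derivative_eq_intros)
next
  case (Suc k)
  then obtain D where D: "((\<lambda>t. matrix_power (Z t) k) has_vector_derivative D) (at t)"
    and tr: "\<And>B. B ** Z t = Z t ** B \<Longrightarrow>
      trace (B ** D) = real k * trace (B ** matrix_power (Z t) (k - 1) ** Z')"
    by blast
  have "trace (B ** (Z t ** D + Z' ** matrix_power (Z t) k))
      = real (Suc k) * trace (B ** matrix_power (Z t) k ** Z')" if B: "B ** Z t = Z t ** B" for B
  proof -
    have "(B ** Z t) ** Z t = Z t ** (B ** Z t)"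
      using B by (metis matrix_mul_assoc)
    from tr[OF this] have "trace (B ** Z t ** D) = real k * trace (B ** matrix_power (Z t) k ** Z')"
      by (cases k) (auto simp: matrix_mul_assoc)
    moreover have "trace (B ** Z' ** matrix_power (Z t) k) = trace (B ** matrix_power (Z t) k ** Z')"
      using trace_mul_sym[of "B ** Z'" "matrix_power (Z t) k"] matrix_power_commute_right[OF B, of k]
      by (simp add: matrix_mul_assoc)
    ultimately show ?thesis
      by (simp add: matrix_mult.add_right trace_add matrix_mul_assoc algebra_simps)
  qed
  moreover have "((\<lambda>t. matrix_power (Z t) (Suc k)) has_vector_derivative
      (Z t ** D + Z' ** matrix_power (Z t) k)) (at t)"
    using matrix_mult.has_vector_derivative[OF Z D] by simp
  ultimately show ?case by (intro exI[of _ "Z t ** D + Z' ** matrix_power (Z t) k"]) auto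
qed

text \<open>A tangent vector at \<open>F\<close> consists of the off-diagonal block F D (1 - F) and
  its transpose, so only the block F G (1 - F) of \<open>G\<close> pairs with it. The two blocks
  give the factor 2, \<open>gr_norm D\<close> is the norm of one of them, and Cauchy-Schwarz
  finishes.\<close>

lemma trace_tangent_bound:
  assumes F: "transpose F = F" "F ** F = F" and D: "D \<in> tangent F" and G: "transpose G = G"
  shows "\<bar>trace (G ** D)\<bar> \<le> 2 * gr_norm D * norm (F ** G ** (mat 1 - F))"
proof -
  have symD: "transpose D = D" and eq: "D ** F + F ** D = D"
    using D by (auto simp: tangent_def)
  have "F ** (D ** F + F ** D) ** F = F ** D ** F + F ** D ** F"
    by (simp add: matrix_mult.add_right matrix_mult.add_left F flip: matrix_mul_assoc)
       (simp add: F matrix_mul_assoc)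
  then have FDF: "F ** (D ** F) = 0"
    unfolding eq by (simp add: matrix_mul_assoc)
  have N: "(F ** D) \<bullet> (F ** D) = trace (D ** F ** D)"
    unfolding trace_transpose_mult_inner[symmetric]
    by (simp add: symD F flip: matrix_mul_assoc) (simp add: F matrix_mul_assoc)
  have "trace (D ** D) = trace (D ** (D ** F + F ** D))" by (simp add: eq)
  also have "\<dots> = trace (D ** (D ** F)) + trace (D ** F ** D)"
    unfolding matrix_mult.add_right trace_add by (simp add: matrix_mul_assoc)
  also have "trace (D ** (D ** F)) = trace (D ** F ** D)"
    by (rule trace_mul_sym)
  finally have nD: "gr_norm D = norm (F ** D)"
    by (simp add: gr_norm_def gr_metric_def norm_eq_sqrt_inner N)
  have GFD: "trace (G ** (F ** D)) = (F ** G) \<bullet> (F ** D)"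
    unfolding trace_transpose_mult_inner[symmetric]
    by (simp add: G F flip: matrix_mul_assoc) (simp add: F matrix_mul_assoc)
  have tr_transpose: "trace (transpose A) = trace A" for A :: "real^'a^'a"
    by (simp add: trace_def transpose_def)
  have "trace (G ** (D ** F)) = trace (transpose (G ** (D ** F)))"
    by (rule tr_transpose[symmetric])
  also have "\<dots> = trace (G ** (F ** D))"
    using trace_mul_sym[of "F ** D" G] by (simp add: G F symD)
  finally have "trace (G ** (D ** F + F ** D)) = 2 * ((F ** G) \<bullet> (F ** D))"
    unfolding matrix_mult.add_right trace_add by (simp add: GFD)
  moreover have "(F ** G ** F) \<bullet> (F ** D) = 0"
  proof -
    have "(F ** G ** F) \<bullet> (F ** D) = trace (F ** (G ** (F ** D)))"
      unfolding trace_transpose_mult_inner[symmetric]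
      by (simp add: G F flip: matrix_mul_assoc) (simp add: F matrix_mul_assoc)
    also have "\<dots> = trace (G ** (F ** D) ** F)" by (rule trace_mul_sym)
    also have "\<dots> = 0" by (simp add: FDF matrix_mult.zero_right trace_zero flip: matrix_mul_assoc)
    finally show ?thesis .
  qed
  ultimately have "trace (G ** D) = 2 * ((F ** G ** (mat 1 - F)) \<bullet> (F ** D))"
    unfolding eq by (simp add: matrix_mult.diff_right inner_diff_left)
  then have "\<bar>trace (G ** D)\<bar> \<le> 2 * (norm (F ** G ** (mat 1 - F)) * norm (F ** D))"
    using Cauchy_Schwarz_ineq2[of "F ** G ** (mat 1 - F)" "F ** D"] by simp
  then show ?thesis by (simp add: nD mult_ac)
qed

text \<open>The squared sines of the principal angles are the eigenvalues of \<open>sine_matrix U F\<close>.\<close>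

definition sine_matrix :: "real^'p^'n \<Rightarrow> real^'n^'n \<Rightarrow> real^'p^'p" where
  "sine_matrix U F = transpose U ** (mat 1 - F) ** U"

text \<open>The trace of \<open>asq_poly m\<close> applied to \<open>Z\<close>, written with powers
  so that differentiating along a curve requires no choice of eigenvectors.\<close>

definition asq_trace :: "nat \<Rightarrow> real^'p^'p \<Rightarrow> real" where
  "asq_trace m Z = (\<Sum>k<m. asq_coeff k * trace (matrix_power Z (Suc k)))"

lemma asq_trace_conj:
  assumes "orthogonal_matrix Q"
  shows "asq_trace m (Q ** diag z ** transpose Q) = (\<Sum>i\<in>UNIV. asq_poly m (z i))"
  unfolding asq_trace_def asq_poly_def matrix_power_conj[OF assms] trace_conj[OF assms] sum_distrib_left
  by (rule sum.swap)

text \<open>\<open>z i\<close> and \<open>1 - z i\<close> are the squared lengths of the columns of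
  \<open>(mat 1 - F) ** (U ** Q)\<close> and \<open>F ** (U ** Q)\<close>, hence
  nonnegative.\<close>

lemma sine_matrix_diagonalization:
  assumes U: "U \<in> stiefel" and F: "transpose F = F" "F ** F = F"
  shows "\<exists>Q z. orthogonal_matrix Q \<and> sine_matrix U F = Q ** diag z ** transpose Q \<and>
    (\<forall>i. 0 \<le> z i \<and> z i \<le> 1)"
proof -
  have sym: "transpose (sine_matrix U F) = sine_matrix U F"
    by (simp add: sine_matrix_def transpose_diff F matrix_mul_assoc)
  obtain Q z where Q: "orthogonal_matrix Q" and Z: "sine_matrix U F = Q ** diag z ** transpose Q"
    using symmetric_diagonalization[OF sym] by blast
  have dz: "diag z = transpose Q ** sine_matrix U F ** Q"
    unfolding Z by (simp add: orthogonal_matrix_cancel[OF Q] orthogonal_matrixD[OF Q] flip: matrix_mul_assoc)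
  have one: "transpose (U ** Q) ** (U ** Q) = mat 1"
    using stiefel_mult_orthogonal[OF U Q] by (rule stiefelD)
  have square: "transpose ((mat 1 - F) ** (U ** Q)) ** ((mat 1 - F) ** (U ** Q)) = diag z"
  proof -
    have "(mat 1 - F) ** (mat 1 - F) = mat 1 - F"
      by (simp add: matrix_mult.diff_left matrix_mult.diff_right F)
    moreover have "transpose ((mat 1 - F) ** (U ** Q)) ** ((mat 1 - F) ** (U ** Q))
      = transpose Q ** (transpose U ** ((mat 1 - F) ** (mat 1 - F)) ** U) ** Q"
      by (simp add: transpose_diff F matrix_mul_assoc)
    ultimately show ?thesis unfolding dz sine_matrix_def by simp
  qed
  have square': "transpose (F ** (U ** Q)) ** (F ** (U ** Q)) = diag (\<lambda>i. 1 - z i)"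
  proof -
    have "transpose (F ** (U ** Q)) ** (F ** (U ** Q)) = transpose (U ** Q) ** (F ** F) ** (U ** Q)"
      by (simp add: F(1) matrix_mul_assoc)
    also have "\<dots> = transpose (U ** Q) ** (U ** Q) - transpose Q ** sine_matrix U F ** Q"
      unfolding F(2) sine_matrix_def
      by (simp add: matrix_mult.diff_left matrix_mult.diff_right flip: matrix_mul_assoc)
    also have "\<dots> = mat 1 - diag z" unfolding one dz ..
    also have "\<dots> = diag (\<lambda>i. 1 - z i)" by (simp add: vec_eq_iff mat_def)
    finally show ?thesis .
  qed
  have "0 \<le> z i" "z i \<le> 1" for i
  proof -
    have "z i = column i ((mat 1 - F) ** (U ** Q)) \<bullet> column i ((mat 1 - F) ** (U ** Q))"
      using arg_cong[OF square, of "\<lambda>A. A $ i $ i"]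
      by (simp add: matrix_mult_transpose_dot_column del: transpose_mult)
    then show "0 \<le> z i" by simp
    have "1 - z i = column i (F ** (U ** Q)) \<bullet> column i (F ** (U ** Q))"
      using arg_cong[OF square', of "\<lambda>A. A $ i $ i"]
      by (simp add: matrix_mult_transpose_dot_column del: transpose_mult)
    then have "0 \<le> 1 - z i" by simp
    then show "z i \<le> 1" by simp
  qed
  with Q Z show ?thesis by blast
qed

lemma sum_conj:
  "(\<Sum>k\<in>K. a k *\<^sub>R (Q ** diag (\<lambda>i. f k i) ** transpose Q)) = Q ** diag (\<lambda>i. \<Sum>k\<in>K. a k * f k i) ** transpose Q"
proof -
  have "diag (\<lambda>i. \<Sum>k\<in>K. a k * f k i) = (\<Sum>k\<in>K. a k *\<^sub>R diag (\<lambda>i. f k i))"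
    by (simp add: vec_eq_iff)
  then show ?thesis
    by (simp add: matrix_mult.sum_left matrix_mult.sum_right matrix_mult.scaleR_left
        matrix_mult.scaleR_right del: scaleR_diag)
qed

text \<open>Write f for \<open>asq_poly m\<close> and F for \<open>\<gamma> t\<close>. The
  derivative is -tr(G D) with G = U f'(Z) U^T, so \<open>trace_tangent_bound\<close> applies. The
  squared norm of F G (1 - F) is tr(f'(Z) (1 - Z) f'(Z) Z), the sum of f'(z)^2 z (1 - z) over the
  eigenvalues, and \<open>asq_poly'_bound\<close> bounds it by the sum of f(z).\<close>

lemma asq_trace_derivative:
  assumes U: "U \<in> stiefel" and F: "transpose (\<gamma> t) = \<gamma> t" "\<gamma> t ** \<gamma> t = \<gamma> t"
    and D: "D \<in> tangent (\<gamma> t)" and \<gamma>: "(\<gamma> has_vector_derivative D) (at t)"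
  shows "\<exists>d. ((\<lambda>t. asq_trace m (sine_matrix U (\<gamma> t))) has_real_derivative d) (at t) \<and>
    \<bar>d\<bar> \<le> 2 * gr_norm D * sqrt (asq_trace m (sine_matrix U (\<gamma> t)))"
proof -
  define Z where "Z t = sine_matrix U (\<gamma> t)" for t
  define Z' where "Z' = - (transpose U ** D ** U)"
  have "bounded_linear (\<lambda>A. transpose U ** A ** U)"
    by (intro bounded_linear_compose[OF matrix_mult.bounded_linear_left] matrix_mult.bounded_linear_right)
  from bounded_linear.has_vector_derivative[OF this has_vector_derivative_diff[OF has_vector_derivative_const \<gamma>]]
  have Z: "(Z has_vector_derivative Z') (at t)"
    by (simp add: Z_def[abs_def] sine_matrix_def Z'_def matrix_mult.minus_left matrix_mult.minus_right)
  have summand: "((\<lambda>t. trace (matrix_power (Z t) (Suc k))) has_real_derivative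
      real (Suc k) * trace (matrix_power (Z t) k ** Z')) (at t)" for k
  proof -
    obtain E where E: "((\<lambda>t. matrix_power (Z t) (Suc k)) has_vector_derivative E) (at t)"
      "\<forall>B. B ** Z t = Z t ** B \<longrightarrow> trace (B ** E) = real (Suc k) * trace (B ** matrix_power (Z t) (Suc k - 1) ** Z')"
      using matrix_power_derivative[OF Z] by blast
    have "trace E = real (Suc k) * trace (matrix_power (Z t) k ** Z')"
      using E(2)[rule_format, of "mat 1"] by simp
    then show ?thesis
      using bounded_linear.has_vector_derivative[OF bounded_linear_trace E(1)]
      by (simp only: has_real_derivative_iff_has_vector_derivative)
  qed
  obtain Q z where Q: "orthogonal_matrix Q" and ZQ: "Z t = Q ** diag z ** transpose Q"
    and z: "\<And>i. 0 \<le> z i" "\<And>i. z i \<le> 1"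
    using sine_matrix_diagonalization[OF U F] unfolding Z_def by blast
  define M where "M = Q ** diag (\<lambda>i. asq_poly' m (z i)) ** transpose Q"
  define G where "G = U ** M ** transpose U"
  define d where "d = (\<Sum>k<m. asq_coeff k * (real (Suc k) * trace (matrix_power (Z t) k ** Z')))"
  have symM: "transpose M = M" by (simp add: M_def matrix_mul_assoc)
  then have symG: "transpose G = G" by (simp add: G_def matrix_mul_assoc)
  have deriv: "((\<lambda>t. asq_trace m (Z t)) has_real_derivative d) (at t)"
    unfolding asq_trace_def d_def by (intro DERIV_sum DERIV_cmult summand)
  have M: "M = (\<Sum>k<m. (asq_coeff k * real (Suc k)) *\<^sub>R matrix_power (Z t) k)"
    unfolding M_def ZQ matrix_power_conj[OF Q] sum_conj asq_poly'_def by (simp add: mult.assoc)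
  have "d = trace (M ** Z')"
    unfolding M d_def by (simp add: matrix_mult.sum_left trace_sum matrix_mult.scaleR_left trace_scaleR mult.assoc)
  also have "\<dots> = - trace (G ** D)"
    using trace_mul_sym[of "M ** transpose U ** D" U]
    by (simp add: Z'_def G_def matrix_mult.minus_right trace_minus matrix_mul_assoc)
  finally have "\<bar>d\<bar> \<le> 2 * gr_norm D * norm (\<gamma> t ** G ** (mat 1 - \<gamma> t))"
    using trace_tangent_bound[OF F D symG] by simp
  moreover have "norm (\<gamma> t ** G ** (mat 1 - \<gamma> t)) \<le> sqrt (asq_trace m (Z t))"
  proof -
    define N where "N = mat 1 - \<gamma> t"
    have N: "transpose N = N" "N ** N = N"
      by (simp_all add: N_def transpose_diff matrix_mult.diff_left matrix_mult.diff_right F)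
    have UFU: "transpose U ** \<gamma> t ** U = mat 1 - Z t"
      by (simp add: Z_def sine_matrix_def matrix_mult.diff_left matrix_mult.diff_right stiefelD[OF U])
    have "(\<gamma> t ** G ** N) \<bullet> (\<gamma> t ** G ** N) = trace (N ** (G ** (\<gamma> t ** \<gamma> t) ** G ** N))"
      by (simp add: F(1) N(1) symG matrix_mul_assoc flip: trace_transpose_mult_inner)
    also have "\<dots> = trace (G ** \<gamma> t ** G ** N ** N)"
      unfolding F(2) by (rule trace_mul_sym)
    also have "\<dots> = trace (G ** \<gamma> t ** G ** N)"
      using N(2) by (simp flip: matrix_mul_assoc)
    also have "\<dots> = trace (U ** (M ** (transpose U ** \<gamma> t ** U) ** M ** transpose U ** N))"
      by (simp add: G_def matrix_mul_assoc)
    also have "\<dots> = trace (M ** (transpose U ** \<gamma> t ** U) ** M ** transpose U ** N ** U)"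
      by (rule trace_mul_sym)
    also have "\<dots> = trace (M ** (mat 1 - Z t) ** M ** Z t)"
      unfolding UFU by (simp add: Z_def sine_matrix_def N_def flip: matrix_mul_assoc)
    also have "mat 1 - Z t = Q ** diag (\<lambda>i. 1 - z i) ** transpose Q"
    proof -
      have "diag (\<lambda>i. 1 - z i) = mat 1 - diag z" by (simp add: vec_eq_iff mat_def)
      then show ?thesis
        by (simp add: ZQ matrix_mult.diff_left matrix_mult.diff_right orthogonal_matrixD[OF Q])
    qed
    also have "M ** (Q ** diag (\<lambda>i. 1 - z i) ** transpose Q) ** M ** Z t
        = Q ** diag (\<lambda>i. (asq_poly' m (z i))\<^sup>2 * (z i * (1 - z i))) ** transpose Q"
    proof -
      have "diag (\<lambda>i. (asq_poly' m (z i))\<^sup>2 * (z i * (1 - z i))) = diag (\<lambda>i. asq_poly' m (z i)) **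
          (diag (\<lambda>i. 1 - z i) ** (diag (\<lambda>i. asq_poly' m (z i)) ** diag z))"
        by (simp add: diag_mult_diag power2_eq_square mult_ac)
      then show ?thesis
        by (simp add: M_def ZQ orthogonal_matrix_cancel[OF Q] flip: matrix_mul_assoc)
    qed
    also have "trace \<dots> = (\<Sum>i\<in>UNIV. (asq_poly' m (z i))\<^sup>2 * (z i * (1 - z i)))"
      by (rule trace_conj[OF Q])
    also have "\<dots> \<le> (\<Sum>i\<in>UNIV. asq_poly m (z i))"
      by (intro sum_mono asq_poly'_bound z)
    also have "\<dots> = asq_trace m (Z t)"
      unfolding ZQ asq_trace_conj[OF Q] ..
    finally show ?thesis
      unfolding N_def norm_eq_sqrt_inner by simp
  qed
  moreover have "0 \<le> 2 * gr_norm D"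
    using trace_transpose_mult_inner[of D D] D
    by (simp add: gr_norm_def gr_metric_def tangent_def)
  ultimately have "\<bar>d\<bar> \<le> 2 * gr_norm D * sqrt (asq_trace m (Z t))"
    by (meson mult_left_mono order_trans)
  with deriv show ?thesis unfolding Z_def by blast
qed

text \<open>Differentiate the equations defining the Grassmannian; interior times are required
  because they hold only on [0,1].\<close>

lemma grassmann_curve_derivative_tangent:
  assumes "t \<in> {0<..<1}" "\<gamma> ` {0..1} \<subseteq> grassmann p" and \<gamma>: "(\<gamma> has_vector_derivative D) (at t)"
  shows "D \<in> tangent (\<gamma> t)"
proof -
  have G: "transpose (\<gamma> s) = \<gamma> s" "\<gamma> s ** \<gamma> s = \<gamma> s" if "s \<in> {0<..<1}" for s
    using that assms(2) by (auto simp: grassmann_def image_subset_iff)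
  have "((\<lambda>s. transpose (\<gamma> s)) has_vector_derivative D) (at t)"
    by (rule has_vector_derivative_transform_within_open[OF \<gamma>, of "{0<..<1}"]) (use assms(1) G in auto)
  then have "transpose D = D"
    using vector_derivative_unique_at bounded_linear.has_vector_derivative[OF bounded_linear_transpose \<gamma>]
    by blast
  moreover have "((\<lambda>s. \<gamma> s ** \<gamma> s) has_vector_derivative D) (at t)"
    by (rule has_vector_derivative_transform_within_open[OF \<gamma>, of "{0<..<1}"]) (use assms(1) G in auto)
  then have "\<gamma> t ** D + D ** \<gamma> t = D"
    using vector_derivative_unique_at matrix_mult.has_vector_derivative[OF \<gamma> \<gamma>] by blast
  ultimately show ?thesis
    by (simp add: tangent_def add.commute)
qed

lemma gr_norm_nonneg: "0 \<le> gr_norm D" if "transpose D = D"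
  using trace_transpose_mult_inner[of D D] that by (simp add: gr_norm_def gr_metric_def)

lemma asq_trace_nonneg:
  assumes "U \<in> stiefel" "F \<in> grassmann p"
  shows "0 \<le> asq_trace m (sine_matrix U F)"
  using sine_matrix_diagonalization[of U F] assms
  by (auto simp: grassmann_def asq_trace_conj intro!: sum_nonneg asq_poly_nonneg)

lemma continuous_on_matrix_power:
  "continuous_on S Z \<Longrightarrow> continuous_on S (\<lambda>t. matrix_power (Z t) k)"
  by (induction k) (auto intro!: matrix_mult.continuous_on)

lemma gr_curve_length_lower_bound:
  assumes U: "U \<in> stiefel" and \<gamma>: "gr_curve p (proj U) F \<gamma>"
  shows "sqrt (asq_trace m (sine_matrix U F)) \<le> curve_length 0 1 \<gamma>"
proof -
  have cont: "continuous_on {0..1} \<gamma>" and int: "gr_speed 0 1 \<gamma> integrable_on {0..1}"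
    and gr: "\<gamma> ` {0..1} \<subseteq> grassmann p" and ends: "\<gamma> 0 = proj U" "\<gamma> 1 = F"
    using \<gamma> by (auto simp: gr_curve_def piecewise_C1_differentiable_on_def)
  obtain S where S: "finite S" and "\<gamma> C1_differentiable_on ({0..1} - S)"
    using \<gamma> by (auto simp: gr_curve_def piecewise_C1_differentiable_on_def)
  then obtain D where D: "\<And>t. t \<in> {0..1} - S \<Longrightarrow> (\<gamma> has_vector_derivative D t) (at t)"
    unfolding C1_differentiable_on_def by blast
  define \<phi> where "\<phi> t = asq_trace m (sine_matrix U (\<gamma> t))" for t
  have \<phi>_nonneg: "0 \<le> \<phi> t" if "t \<in> {0..1}" for t
    unfolding \<phi>_def using that gr by (intro asq_trace_nonneg[OF U, of _ p]) auto
  have \<phi>_cont: "continuous_on {0..1} \<phi>"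
    unfolding \<phi>_def asq_trace_def sine_matrix_def
    by (intro continuous_intros bounded_linear.continuous_on[OF bounded_linear_trace]
        continuous_on_matrix_power matrix_mult.continuous_on cont)
  have speed: "gr_speed 0 1 \<gamma> t = gr_norm (D t)" "D t \<in> tangent (\<gamma> t)" if "t \<in> {0<..<1} - S" for t
  proof -
    have t: "t \<in> {0..1} - S" using that by auto
    have "vector_derivative \<gamma> (at t within {0..1}) = D t"
      using t D[OF t] by (intro vector_derivative_within_closed_interval) (auto intro: has_vector_derivative_at_within)
    then show "gr_speed 0 1 \<gamma> t = gr_norm (D t)" by (simp add: gr_speed_def)
    show "D t \<in> tangent (\<gamma> t)"
      using that by (intro grassmann_curve_derivative_tangent[OF _ gr D]) auto
  qed
  have "\<exists>d. \<forall>t \<in> {0<..<1} - S. (\<phi> has_real_derivative d t) (at t) \<and>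
      \<bar>d t\<bar> \<le> 2 * gr_speed 0 1 \<gamma> t * sqrt (\<phi> t)"
  proof (intro bchoice ballI)
    fix t assume t: "t \<in> {0<..<1} - S"
    then have "\<gamma> t \<in> grassmann p" using gr by (auto simp: image_subset_iff)
    then show "\<exists>d. (\<phi> has_real_derivative d) (at t) \<and> \<bar>d\<bar> \<le> 2 * gr_speed 0 1 \<gamma> t * sqrt (\<phi> t)"
      unfolding speed(1)[OF t] \<phi>_def using t
      by (intro asq_trace_derivative[OF U _ _ speed(2)[OF t] D]) (auto simp: grassmann_def)
  qed
  then obtain d where d: "\<And>t. t \<in> {0<..<1} - S \<Longrightarrow> (\<phi> has_real_derivative d t) (at t)"
    "\<And>t. t \<in> {0<..<1} - S \<Longrightarrow> \<bar>d t\<bar> \<le> 2 * gr_speed 0 1 \<gamma> t * sqrt (\<phi> t)"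
    by blast
  have "\<phi> 0 = 0"
  proof -
    have "sine_matrix U (proj U) = 0"
      by (simp add: sine_matrix_def proj_def matrix_mult.diff_left matrix_mult.diff_right
          stiefel_cancel[OF U] matrix_mul_assoc)
    then show ?thesis
      by (simp add: \<phi>_def ends asq_trace_def matrix_mult.zero_left trace_zero)
  qed
  have "sqrt (\<phi> 1) \<le> curve_length 0 1 \<gamma> + e" if "0 < e" for e
  proof -
    \<comment> \<open>The square root is not differentiable where \<open>\<phi>\<close> vanishes, as
      it does at time 0; adding \<open>e\<^sup>2\<close> avoids this at the cost of
      \<open>\<psi> 0 = e\<close>.\<close>
    define \<psi> where "\<psi> t = sqrt (\<phi> t + e\<^sup>2)" for t
    \<comment> \<open>At the finitely many break points and at the ends the derivative is replaced
      by the speed, so that the bound by the speed holds trivially there; the integral is not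
      affected.\<close>
    define \<psi>' where "\<psi>' t = (if t \<in> {0<..<1} - S then d t / (2 * \<psi> t) else gr_speed 0 1 \<gamma> t)" for t
    have pos: "0 < \<phi> t + e\<^sup>2" if "t \<in> {0..1}" for t
      using \<phi>_nonneg[OF that] \<open>0 < e\<close> by (simp add: add_nonneg_pos)
    have "(\<psi>' has_integral (\<psi> 1 - \<psi> 0)) {0..1}"
    proof (rule fundamental_theorem_of_calculus_interior_strong[OF S])
      show "continuous_on {0..1} \<psi>"
        unfolding \<psi>_def by (intro continuous_intros \<phi>_cont)
      show "(\<psi> has_vector_derivative \<psi>' t) (at t)" if t: "t \<in> {0<..<1} - S" for t
      proof -
        have "(\<psi> has_real_derivative inverse (sqrt (\<phi> t + e\<^sup>2)) / 2 * (d t + 0)) (at t)"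
          unfolding \<psi>_def using pos[of t] t
          by (intro DERIV_chain2[OF DERIV_real_sqrt] DERIV_add d DERIV_const) auto
        moreover have "inverse (sqrt (\<phi> t + e\<^sup>2)) / 2 * (d t + 0) = \<psi>' t"
          using t by (simp add: \<psi>'_def \<psi>_def inverse_eq_divide)
        ultimately show ?thesis
          by (simp only: has_real_derivative_iff_has_vector_derivative)
      qed
    qed simp
    moreover have "(gr_speed 0 1 \<gamma> has_integral curve_length 0 1 \<gamma>) {0..1}"
      unfolding curve_length_def using int by (rule integrable_integral)
    moreover have "\<psi>' t \<le> gr_speed 0 1 \<gamma> t" if "t \<in> {0..1}" for t
    proof (cases "t \<in> {0<..<1} - S")
      case True
      have "0 \<le> gr_speed 0 1 \<gamma> t"
        unfolding speed(1)[OF True] using speed(2)[OF True] by (intro gr_norm_nonneg) (auto simp: tangent_def)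
      then have "\<bar>d t\<bar> \<le> 2 * gr_speed 0 1 \<gamma> t * \<psi> t"
        using d(2)[OF True] by (elim order_trans) (auto simp: \<psi>_def intro!: mult_left_mono)
      moreover have "0 < \<psi> t" using pos[OF that] by (simp add: \<psi>_def)
      ultimately show ?thesis
        using True by (simp add: \<psi>'_def divide_simps mult_ac)
    next
      case False
      then show ?thesis by (auto simp: \<psi>'_def)
    qed
    ultimately have "\<psi> 1 - \<psi> 0 \<le> curve_length 0 1 \<gamma>"
      by (rule has_integral_le)
    moreover have "sqrt (\<phi> 1) \<le> \<psi> 1" "\<psi> 0 = e"
      using \<open>0 < e\<close> by (auto simp: \<psi>_def \<open>\<phi> 0 = 0\<close>)
    ultimately show ?thesis by simp
  qed
  then have "sqrt (\<phi> 1) \<le> curve_length 0 1 \<gamma>"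
    by (rule field_le_epsilon)
  then show ?thesis
    unfolding \<phi>_def ends .
qed

section \<open>Distance and cut locus\<close>

lemma conj_eq_intertwine:
  assumes Q: "orthogonal_matrix Q" and R: "orthogonal_matrix R"
    and eq: "Q ** diag a ** transpose Q = R ** diag b ** transpose R"
  shows "diag b ** (transpose R ** Q) = (transpose R ** Q) ** diag a"
proof -
  have "transpose R ** (Q ** diag a ** transpose Q) ** Q = transpose R ** (R ** diag b ** transpose R) ** Q"
    unfolding eq ..
  then show ?thesis
    by (simp add: orthogonal_matrix_cancel[OF Q] orthogonal_matrix_cancel[OF R] orthogonal_matrixD[OF Q]
        flip: matrix_mul_assoc)
qed

lemma card_conj_eq:
  fixes Q R :: "real^'p^'p"
  assumes Q: "orthogonal_matrix Q" and R: "orthogonal_matrix R"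
    and eq: "Q ** diag a ** transpose Q = R ** diag b ** transpose R"
  shows "card {i. a i = c} = card {i. b i = c}"
proof -
  have "orthogonal_matrix (transpose R ** Q)"
    using Q R by (intro orthogonal_matrix_mul) auto
  from card_intertwine[OF this conj_eq_intertwine[OF assms]] show ?thesis ..
qed

lemma horizontal_mult_orthogonal:
  "transpose U ** (Q ** diag s) = 0 \<Longrightarrow> transpose (U ** R) ** (Q ** diag s) = 0"
  by (simp add: matrix_mult.zero_right flip: matrix_mul_assoc)

lemma horizontal_svd:
  assumes "orthogonal_matrix R" and "transpose U ** (Q ** diag s ** transpose R) = 0"
  shows "transpose U ** (Q ** diag s) = 0"
proof -
  have "transpose U ** (Q ** diag s) = transpose U ** (Q ** diag s ** transpose R) ** R"
    by (simp add: orthogonal_matrixD[OF assms(1)] flip: matrix_mul_assoc)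
  then show ?thesis by (simp add: assms(2) matrix_mult.zero_left)
qed

lemma transpose_rotation_curve:
  assumes V: "V \<in> stiefel" and VQ: "transpose V ** (Q ** diag s) = 0"
  shows "transpose V ** rotation_curve V Q s t = diag (\<lambda>i. cos (t * s i))"
  unfolding rotation_curve_def matrix_mult.add_right
  by (simp add: stiefel_cancel[OF V] horizontal_diag_mono[OF VQ])

lemma projected_rotation_curve:
  assumes U: "U \<in> stiefel" and R: "orthogonal_matrix R" and UQ: "transpose U ** (Q ** diag s) = 0"
  shows "transpose U ** rotation_curve (U ** R) Q s t = R ** diag (\<lambda>i. cos (t * s i))"
proof -
  have "transpose U ** rotation_curve (U ** R) Q s t
      = R ** (transpose (U ** R) ** rotation_curve (U ** R) Q s t)"
    by (simp add: orthogonal_matrix_cancel[OF R] matrix_mul_assoc orthogonal_matrixD[OF R])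
  then show ?thesis
    by (simp only: transpose_rotation_curve[OF stiefel_mult_orthogonal[OF U R] horizontal_mult_orthogonal[OF UQ]])
qed

lemma projected_proj_rotation_curve:
  assumes U: "U \<in> stiefel" and R: "orthogonal_matrix R" and UQ: "transpose U ** (Q ** diag s) = 0"
  shows "transpose U ** proj (rotation_curve (U ** R) Q s t) ** U
    = R ** diag (\<lambda>i. (cos (t * s i))\<^sup>2) ** transpose R"
proof -
  let ?C = "transpose U ** rotation_curve (U ** R) Q s t"
  have "transpose U ** proj (rotation_curve (U ** R) Q s t) ** U = ?C ** transpose ?C"
    by (simp add: proj_def matrix_mul_assoc)
  also have "\<dots> = R ** (diag (\<lambda>i. cos (t * s i)) ** diag (\<lambda>i. cos (t * s i))) ** transpose R"
    unfolding projected_rotation_curve[OF assms] by (simp add: matrix_mul_assoc)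
  finally show ?thesis
    by (simp add: diag_mult_diag power2_eq_square)
qed

text \<open>The frames \<open>U ** Q\<close> and \<open>Y ** R\<close> are aligned in pairs of
  principal vectors. \<open>M\<close> is the part of \<open>Y ** R\<close> orthogonal to
  \<open>U\<close>; its Gram matrix has the entries 1 - s^2 = sin^2 \<theta>, so
  \<open>stiefel_factor\<close> supplies the directions \<open>H\<close> in which to rotate.\<close>

lemma connecting_rotation:
  fixes U Y :: "real^'p^'n"
  assumes card: "CARD('p) \<le> CARD('n)" and U: "U \<in> stiefel" and Y: "Y \<in> stiefel"
    and Q: "orthogonal_matrix Q" and R: "orthogonal_matrix R"
    and svd: "transpose U ** Y = Q ** diag s ** transpose R" and s: "\<And>i. 0 \<le> s i"
  shows "\<And>i. s i \<le> 1"
    and "\<exists>H \<in> stiefel. transpose U ** (H ** diag (\<lambda>i. arccos (s i))) = 0 \<and>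
      rotation_curve (U ** Q) H (\<lambda>i. arccos (s i)) 1 = Y ** R"
proof -
  define M where "M = Y ** R - U ** Q ** diag s"
  have UYR: "transpose U ** (Y ** R) = Q ** diag s"
    by (simp add: matrix_mul_assoc svd orthogonal_matrix_cancel[OF R])
  have "transpose R ** transpose Y ** U = diag s ** transpose Q"
    using arg_cong[OF UYR, of transpose] by (simp add: matrix_mul_assoc)
  then have RYU: "transpose R ** (transpose Y ** (U ** Q)) = diag s"
    by (simp add: matrix_mul_assoc orthogonal_matrix_cancel[OF Q])
  have UM: "transpose U ** M = 0"
    unfolding M_def matrix_mult.diff_right UYR
    by (simp add: stiefel_cancel[OF U] flip: matrix_mul_assoc)
  have YRM: "transpose R ** (transpose Y ** (Y ** R)) = mat 1"
    by (simp add: stiefel_cancel[OF Y] orthogonal_matrixD[OF R])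
  have MM: "transpose M ** M = diag (\<lambda>i. 1 - (s i)\<^sup>2)"
  proof -
    have "transpose M ** M = transpose (Y ** R) ** M - diag s ** transpose Q ** (transpose U ** M)"
      unfolding M_def transpose_diff matrix_mult.diff_left by (simp add: matrix_mul_assoc)
    also have "\<dots> = transpose R ** (transpose Y ** M)"
      unfolding UM by (simp add: matrix_mult.zero_right matrix_mul_assoc)
    also have "\<dots> = mat 1 - transpose R ** (transpose Y ** (U ** Q)) ** diag s"
      unfolding M_def matrix_mult.diff_right YRM by (simp add: matrix_mul_assoc)
    also have "\<dots> = diag (\<lambda>i. 1 - (s i)\<^sup>2)"
      unfolding RYU by (simp add: diag_mult_diag vec_eq_iff mat_def power2_eq_square)
    finally show ?thesis .
  qed
  show le: "s i \<le> 1" for i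
  proof -
    have "1 - (s i)\<^sup>2 = column i M \<bullet> column i M"
      using arg_cong[OF MM, of "\<lambda>A. A $ i $ i"] by (simp add: matrix_mult_transpose_dot_column)
    then have "0 \<le> 1 - (s i)\<^sup>2" by simp
    then show ?thesis using s[of i] by (simp add: power2_le_iff_abs_le[of 1, simplified])
  qed
  define \<theta> where "\<theta> i = arccos (s i)" for i
  have sge: "- 1 \<le> s i" for i using s[of i] by simp
  have cos\<theta>: "cos (\<theta> i) = s i" for i
    using le[of i] sge[of i] by (simp add: \<theta>_def cos_arccos)
  have \<theta>: "0 \<le> \<theta> i" "\<theta> i \<le> pi / 2" for i
    using le[of i] s[of i] sge[of i] arccos_le_pi2[of "s i"] by (auto simp: \<theta>_def arccos_lbound)
  have "transpose M ** M = diag (\<lambda>i. (sin (\<theta> i))\<^sup>2)"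
    unfolding MM sin_squared_eq cos\<theta> ..
  then obtain H where H: "H \<in> stiefel" "M = H ** diag (\<lambda>i. sin (\<theta> i))"
    using stiefel_factor[OF card, of M "\<lambda>i. sin (\<theta> i)"] by auto
  \<comment> \<open>\<open>M\<close> only shows that \<open>H\<close> is horizontal where sin
    \<theta> is nonzero. On [0, \<pi>/2] this is where \<theta> is nonzero.\<close>
  have "\<theta> i = 0" if "sin (\<theta> i) = 0" for i
    using that \<theta>[of i] sin_gt_zero2[of "\<theta> i"] sin_gt_zero[of "\<theta> i"] by (cases "\<theta> i = 0") auto
  then have "transpose U ** (H ** diag \<theta>) = 0"
    using UM unfolding H(2) by (rule horizontal_diag_mono[rotated])
  moreover have "rotation_curve (U ** Q) H \<theta> 1 = Y ** R"
    unfolding rotation_curve_def by (simp add: cos\<theta> flip: H(2)) (simp add: M_def)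
  ultimately show "\<exists>H \<in> stiefel. transpose U ** (H ** diag (\<lambda>i. arccos (s i))) = 0 \<and>
      rotation_curve (U ** Q) H (\<lambda>i. arccos (s i)) 1 = Y ** R"
    using H(1) unfolding \<theta>_def by blast
qed

text \<open>\<open>connecting_rotation\<close> attains the value, so the infimum is a minimum. For
  the converse, the eigenvalues of \<open>sine_matrix U (proj Y)\<close> are 1 - s^2 = sin^2
  \<theta>, which turns the bounds on \<open>asq_trace\<close> into one on the sum of squared
  angles.\<close>

lemma gr_dist_principal_angles:
  fixes U Y :: "real^'p^'n"
  assumes card: "CARD('p) \<le> CARD('n)" and U: "U \<in> stiefel" and Y: "Y \<in> stiefel"
    and Q: "orthogonal_matrix Q" and R: "orthogonal_matrix R"
    and svd: "transpose U ** Y = Q ** diag s ** transpose R" and s: "\<And>i. 0 \<le> s i"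
  shows "gr_dist CARD('p) (proj U) (proj Y) = sqrt (\<Sum>i\<in>UNIV. (arccos (s i))\<^sup>2)"
proof -
  define \<theta> where "\<theta> i = arccos (s i)" for i
  note connect = connecting_rotation[OF assms]
  obtain H where H: "H \<in> stiefel" "transpose U ** (H ** diag \<theta>) = 0"
      "rotation_curve (U ** Q) H \<theta> 1 = Y ** R"
    using connect(2) unfolding \<theta>_def by blast
  have sge: "- 1 \<le> s i" for i using s[of i] by simp
  have cos\<theta>: "cos (\<theta> i) = s i" for i
    using connect(1)[of i] sge[of i] by (simp add: \<theta>_def cos_arccos)
  have \<theta>: "0 \<le> \<theta> i" "\<theta> i \<le> pi / 2" for i
    using connect(1)[of i] s[of i] sge[of i] arccos_le_pi2[of "s i"] by (auto simp: \<theta>_def arccos_lbound)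
  have UQ: "U ** Q \<in> stiefel" by (rule stiefel_mult_orthogonal[OF U Q])
  have hor: "transpose (U ** Q) ** (H ** diag \<theta>) = 0"
    by (rule horizontal_mult_orthogonal[OF H(2)])
  let ?g = "\<lambda>t. proj (rotation_curve (U ** Q) H \<theta> t)"
  have "gr_curve CARD('p) (proj U) (proj Y) ?g"
    using gr_curve_rotation_curve[OF UQ H(1) hor]
    by (simp add: H(3) proj_mult_orthogonal[OF Q] proj_mult_orthogonal[OF R])
  moreover have "curve_length 0 1 ?g = sqrt (\<Sum>i\<in>UNIV. (\<theta> i)\<^sup>2)"
    by (simp add: curve_length_rotation_curve[OF UQ H(1) hor])
  ultimately have attained: "sqrt (\<Sum>i\<in>UNIV. (\<theta> i)\<^sup>2)
      \<in> {curve_length 0 1 \<gamma> | \<gamma>. gr_curve CARD('p) (proj U) (proj Y) \<gamma>}"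
    by (metis (mono_tags, lifting) mem_Collect_eq)
  have "sqrt (\<Sum>i\<in>UNIV. (\<theta> i)\<^sup>2) \<le> curve_length 0 1 \<gamma>"
    if \<gamma>: "gr_curve CARD('p) (proj U) (proj Y) \<gamma>" for \<gamma>
  proof -
    have Z: "sine_matrix U (proj Y) = Q ** diag (\<lambda>i. (sin (\<theta> i))\<^sup>2) ** transpose Q"
    proof -
      have "sine_matrix U (proj Y) = mat 1 - (transpose U ** Y) ** transpose (transpose U ** Y)"
        by (simp add: sine_matrix_def proj_def matrix_mult.diff_left matrix_mult.diff_right
            stiefelD[OF U] matrix_mul_assoc)
      also have "(transpose U ** Y) ** transpose (transpose U ** Y)
          = Q ** (diag s ** diag s) ** transpose Q"
        unfolding svd by (simp add: orthogonal_matrix_cancel[OF R] flip: matrix_mul_assoc)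
      also have "mat 1 - Q ** (diag s ** diag s) ** transpose Q
          = Q ** (mat 1 - diag s ** diag s) ** transpose Q"
        by (simp add: matrix_mult.diff_left matrix_mult.diff_right orthogonal_matrixD[OF Q])
      also have "mat 1 - diag s ** diag s = diag (\<lambda>i. (sin (\<theta> i))\<^sup>2)"
        unfolding sin_squared_eq cos\<theta>
        by (simp add: diag_mult_diag vec_eq_iff mat_def power2_eq_square)
      finally show ?thesis .
    qed
    have le: "sqrt (\<Sum>i\<in>UNIV. asq_poly m ((sin (\<theta> i))\<^sup>2)) \<le> curve_length 0 1 \<gamma>" for m
      using gr_curve_length_lower_bound[OF U \<gamma>, of m] unfolding Z asq_trace_conj[OF Q] .
    \<comment> \<open>The empty partial sum, \<open>m = 0\<close>, already yields the sign needed
      for squaring.\<close>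
    have "0 \<le> curve_length 0 1 \<gamma>"
      using le[of 0] by (simp add: asq_poly_def)
    moreover have "(\<Sum>i\<in>UNIV. (\<theta> i)\<^sup>2) \<le> (curve_length 0 1 \<gamma>)\<^sup>2"
    proof (rule sum_squares_le_of_asq_poly)
      show "(\<Sum>i\<in>UNIV. asq_poly m ((sin (\<theta> i))\<^sup>2)) \<le> (curve_length 0 1 \<gamma>)\<^sup>2" for m
        using le[of m] by (simp add: sqrt_le_D)
    qed (use \<theta> in auto)
    ultimately show ?thesis by (rule real_le_lsqrt)
  qed
  then have "gr_dist CARD('p) (proj U) (proj Y) = sqrt (\<Sum>i\<in>UNIV. (\<theta> i)\<^sup>2)"
    unfolding gr_dist_def by (intro cInf_eq_minimum[OF attained]) auto
  then show ?thesis by (simp add: \<theta>_def)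
qed

text \<open>The product of the two frames is diagonal with entries cos(t s). Their signs move into
  the orthogonal factor \<open>E\<close>, which leaves the singular values |cos(t s)|.\<close>

lemma gr_dist_rotation_curve:
  fixes V Q :: "real^'p^'n"
  assumes card: "CARD('p) \<le> CARD('n)" and V: "V \<in> stiefel" and Q: "Q \<in> stiefel"
    and VQ: "transpose V ** (Q ** diag s) = 0"
  shows "gr_dist CARD('p) (proj V) (proj (rotation_curve V Q s t))
    = sqrt (\<Sum>i\<in>UNIV. (arccos \<bar>cos (t * s i)\<bar>)\<^sup>2)"
proof -
  define E :: "real^'p^'p" where "E = diag (\<lambda>i. if cos (t * s i) < 0 then -1 else 1)"
  have E: "orthogonal_matrix E"
    by (simp add: orthogonal_matrix E_def diag_mult_diag vec_eq_iff mat_def)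
  have "transpose V ** rotation_curve V Q s t = E ** diag (\<lambda>i. \<bar>cos (t * s i)\<bar>) ** transpose (mat 1)"
    by (auto simp: transpose_rotation_curve[OF V VQ] E_def diag_mult_diag diag_eq_iff fun_eq_iff)
  then show ?thesis
    by (intro gr_dist_principal_angles[OF card V rotation_curve_stiefel[OF V Q VQ] E orthogonal_matrix_id]) auto
qed

text \<open>The left-hand side is the distance from \<open>x\<close> to the nearest multiple of
  \<pi>.\<close>

lemma arccos_abs_cos_le:
  assumes "0 \<le> x"
  shows "arccos \<bar>cos x\<bar> \<le> x" and "arccos \<bar>cos x\<bar> = x \<longleftrightarrow> x \<le> pi / 2"
proof -
  have *: "arccos \<bar>cos x\<bar> = x" if "x \<le> pi / 2"
    using that assms cos_ge_zero[of x] by (simp add: arccos_cos)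
  have "arccos \<bar>cos x\<bar> \<le> pi / 2"
    by (intro arccos_le_pi2) auto
  with * show "arccos \<bar>cos x\<bar> \<le> x" "arccos \<bar>cos x\<bar> = x \<longleftrightarrow> x \<le> pi / 2"
    by linarith+
qed

section \<open>Cut time and tangent cut locus in terms of singular values\<close>

lemma norm_svd:
  assumes "Q \<in> stiefel" "orthogonal_matrix R"
  shows "norm (Q ** diag s ** transpose R) = sqrt (\<Sum>i\<in>UNIV. (s i)\<^sup>2)"
  using assms(2)
  by (simp add: norm_eq_sqrt_inner inner_mult_orthogonal inner_mult_stiefel[OF assms(1)] inner_diag
      power2_eq_square)

text \<open>A tangent vector together with one compact SVD of its lift, unsorted. Horizontality is
  required of \<open>Q ** diag s\<close> and not of \<open>Q\<close>, whose columns at zero singular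
  values are arbitrary. The locale is reused with other \<open>R\<close> and the same
  \<open>Q\<close> and \<open>s\<close> for the vectors \<Delta>_W.\<close>

locale svd_tangent =
  fixes U Q :: "real^'p^'n" and s :: "'p \<Rightarrow> real" and R :: "real^'p^'p" and D :: "real^'n^'n"
  assumes card: "CARD('p) \<le> CARD('n)" and U: "U \<in> stiefel" and Q: "Q \<in> stiefel"
    and R: "orthogonal_matrix R" and s: "\<And>i. 0 \<le> s i" and UQ: "transpose U ** (Q ** diag s) = 0"
    and D: "D = tangent_of U (Q ** diag s ** transpose R)"
begin

lemma UR: "U ** R \<in> stiefel"
  by (rule stiefel_mult_orthogonal[OF U R])

lemma URQ: "transpose (U ** R) ** (Q ** diag s) = 0"
  by (rule horizontal_mult_orthogonal[OF UQ])

lemma horizontal: "transpose U ** (Q ** diag s ** transpose R) = 0"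
  using UQ by (simp add: matrix_mul_assoc matrix_mult.zero_left)

lemma tangent: "D \<in> tangent (proj U)"
  unfolding D by (rule tangent_of_tangent[OF U horizontal])

lemma hor_lift: "hor_lift U D = Q ** diag s ** transpose R"
  unfolding D by (rule tangent_of_tangent[OF U horizontal])

lemma norm: "gr_norm D = sqrt (\<Sum>i\<in>UNIV. (s i)\<^sup>2)"
  unfolding D gr_norm_tangent_of[OF U horizontal] by (rule norm_svd[OF Q R])

lemma exp: "gr_exp (proj U) (t *\<^sub>R D) = proj (rotation_curve (U ** R) Q s t)"
  unfolding D by (rule gr_exp_geodesic[OF U Q R UQ])

lemma exp_0: "gr_exp (proj U) 0 = proj U"
  using exp[of 0] by (simp add: rotation_curve_0 proj_mult_orthogonal[OF R])

lemma length:
  assumes "0 < b"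
  shows "curve_length 0 b (\<lambda>t. gr_exp (proj U) (t *\<^sub>R D)) = b * gr_norm D"
  using curve_length_rotation_curve[OF UR Q URQ assms exp] by (simp add: norm)

lemma dist: "gr_dist CARD('p) (proj U) (gr_exp (proj U) (t *\<^sub>R D))
    = sqrt (\<Sum>i\<in>UNIV. (arccos \<bar>cos (t * s i)\<bar>)\<^sup>2)"
  using gr_dist_rotation_curve[OF card UR Q URQ, of t] by (simp add: exp proj_mult_orthogonal[OF R])

text \<open>Length and distance are Euclidean norms whose entries compare one by one by
  \<open>arccos_abs_cos_le\<close>, so they agree only if every pair of entries does.\<close>

lemma length_eq_dist_iff:
  assumes "0 < b"
  shows "b * gr_norm D = gr_dist CARD('p) (proj U) (gr_exp (proj U) (b *\<^sub>R D)) \<longleftrightarrow> (\<forall>i. b * s i \<le> pi / 2)"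
proof -
  have bs: "0 \<le> b * s i" for i using assms s by simp
  have "b * gr_norm D = sqrt (\<Sum>i\<in>UNIV. (b * s i)\<^sup>2)"
    using assms by (simp add: norm power_mult_distrib real_sqrt_mult flip: sum_distrib_left)
  then have "b * gr_norm D = gr_dist CARD('p) (proj U) (gr_exp (proj U) (b *\<^sub>R D)) \<longleftrightarrow>
      (\<Sum>i\<in>UNIV. (arccos \<bar>cos (b * s i)\<bar>)\<^sup>2) = (\<Sum>i\<in>UNIV. (b * s i)\<^sup>2)"
    by (auto simp: dist)
  also have "\<dots> \<longleftrightarrow> (\<forall>i. (arccos \<bar>cos (b * s i)\<bar>)\<^sup>2 = (b * s i)\<^sup>2)"
  proof
    have le: "(arccos \<bar>cos (b * s i)\<bar>)\<^sup>2 \<le> (b * s i)\<^sup>2" for i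
      by (intro power_mono arccos_abs_cos_le bs arccos_lbound) auto
    show "\<forall>i. (arccos \<bar>cos (b * s i)\<bar>)\<^sup>2 = (b * s i)\<^sup>2"
      if "(\<Sum>i\<in>UNIV. (arccos \<bar>cos (b * s i)\<bar>)\<^sup>2) = (\<Sum>i\<in>UNIV. (b * s i)\<^sup>2)"
      using sum_mono_inv[OF that le] by simp
  qed simp
  also have "\<dots> \<longleftrightarrow> (\<forall>i. b * s i \<le> pi / 2)"
    using bs arccos_abs_cos_le(2)[OF bs] by (simp add: power2_eq_iff_nonneg arccos_lbound)
  finally show ?thesis .
qed

lemma length_minimizing_iff:
  assumes "0 < b"
  shows "length_minimizing CARD('p) 0 b (\<lambda>t. gr_exp (proj U) (t *\<^sub>R D)) \<longleftrightarrow> (\<forall>i. b * s i \<le> pi / 2)"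
  using length_eq_dist_iff[OF assms] by (simp add: length_minimizing_def length[OF assms] exp_0)

lemma zero_iff: "D = 0 \<longleftrightarrow> (\<forall>i. s i = 0)"
proof
  assume "D = 0"
  then have "gr_norm D = 0" by (simp add: gr_norm_def gr_metric_def matrix_mult.zero_left trace_zero)
  then show "\<forall>i. s i = 0" by (simp add: norm sum_nonneg_eq_0_iff)
next
  assume "\<forall>i. s i = 0"
  then have "diag s = 0" by (simp add: vec_eq_iff)
  then show "D = 0"
    by (simp add: D tangent_of_def matrix_mult.zero_left matrix_mult.zero_right transpose_zero)
qed

lemma cut_time:
  assumes "D \<noteq> 0"
  shows "0 < Max (range s)" and "cut_time CARD('p) (proj U) D = pi / (2 * Max (range s))"
proof -
  obtain i where "0 < s i" using assms s by (auto simp: zero_iff less_le)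
  also have "s i \<le> Max (range s)" by simp
  finally show pos: "0 < Max (range s)" .
  have "(\<forall>i. b * s i \<le> pi / 2) \<longleftrightarrow> b \<le> pi / (2 * Max (range s))" if "0 < b" for b
  proof -
    have "(\<forall>i. b * s i \<le> pi / 2) \<longleftrightarrow> (\<forall>x\<in>range s. x \<le> pi / (2 * b))"
      using that by (auto simp: field_simps)
    also have "\<dots> \<longleftrightarrow> Max (range s) \<le> pi / (2 * b)"
      by (simp add: Max_le_iff)
    also have "\<dots> \<longleftrightarrow> b \<le> pi / (2 * Max (range s))"
      using that pos by (simp add: field_simps)
    finally show ?thesis .
  qed
  then have "{b. 0 < b \<and> length_minimizing CARD('p) 0 b (\<lambda>t. gr_exp (proj U) (t *\<^sub>R D))}
      = {0<..pi / (2 * Max (range s))}"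
    using length_minimizing_iff by auto
  then show "cut_time CARD('p) (proj U) D = pi / (2 * Max (range s))"
    using pos by (simp add: cut_time_def)
qed

lemma scaled:
  assumes "0 \<le> c"
  shows "svd_tangent U Q (\<lambda>i. c * s i) R (c *\<^sub>R D)"
proof
  show "transpose U ** (Q ** diag (\<lambda>i. c * s i)) = 0"
    by (rule horizontal_diag_mono[OF UQ]) simp
  show "c *\<^sub>R D = tangent_of U (Q ** diag (\<lambda>i. c * s i) ** transpose R)"
    unfolding D tangent_of_scaleR scaleR_diag[symmetric]
    by (simp add: matrix_mult.scaleR_left matrix_mult.scaleR_right del: scaleR_diag)
qed (use assms s card U Q R in auto)

text \<open>By \<open>cut_time\<close> the unit vector along \<open>D\<close> has cut time |D| \<pi>
  / (2 max s), which equals |D| exactly if the largest singular value is \<pi>/2. The zero vector is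
  excluded on both sides.\<close>

lemma tangent_cut_locus_iff:
  "D \<in> tangent_cut_locus CARD('p) (proj U) \<longleftrightarrow> (\<forall>i. s i \<le> pi / 2) \<and> (\<exists>i. s i = pi / 2)"
proof (cases "D = 0")
  case True
  then show ?thesis by (simp add: tangent_cut_locus_def zero_iff)
next
  case False
  define c where "c = 1 / gr_norm D"
  have "gr_norm D \<noteq> 0" using False by (auto simp: zero_iff norm sum_nonneg_eq_0_iff)
  then have pos: "0 < gr_norm D" by (simp add: norm less_le sum_nonneg)
  then have c: "0 < c" by (simp add: c_def)
  interpret S: svd_tangent U Q "\<lambda>i. c * s i" R "c *\<^sub>R D"
    using c by (intro scaled) simp
  have "Max (range (\<lambda>i. c * s i)) = c * Max (range s)"
    using c by (subst image_image[symmetric, of "(*) c" s], subst mono_Max_commute[symmetric])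
      (auto intro!: monoI mult_left_mono)
  then have "cut_time CARD('p) (proj U) (c *\<^sub>R D) = gr_norm D * (pi / (2 * Max (range s)))"
    using S.cut_time(2) False c by (simp add: c_def)
  then have "D \<in> tangent_cut_locus CARD('p) (proj U) \<longleftrightarrow>
      gr_norm D = gr_norm D * (pi / (2 * Max (range s)))"
    using False tangent by (simp add: tangent_cut_locus_def c_def)
  also have "\<dots> \<longleftrightarrow> Max (range s) = pi / 2"
    using pos cut_time(1)[OF False] by (auto simp: field_simps)
  also have "\<dots> \<longleftrightarrow> (\<forall>i. s i \<le> pi / 2) \<and> (\<exists>i. s i = pi / 2)"
    by (subst Max_eq_iff) (auto simp: eq_commute)
  finally show ?thesis .
qed

lemma minimizing_solution_iff:
  "minimizing_solution CARD('p) (proj U) F D \<longleftrightarrow>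
    proj (rotation_curve (U ** R) Q s 1) = F \<and> (\<forall>i. s i \<le> pi / 2)"
  using length_eq_dist_iff[of 1] exp[of 1] tangent by (auto simp: minimizing_solution_def)

end

lemma svd_tangent_exists:
  fixes U :: "real^'p^'n"
  assumes "CARD('p) \<le> CARD('n)" "U \<in> stiefel" "D \<in> tangent (proj U)"
  shows "\<exists>Q s R. svd_tangent U Q s R D"
proof -
  obtain Q s R where svd: "Q \<in> stiefel" "\<forall>i. 0 \<le> s i" "orthogonal_matrix R"
    "hor_lift U D = Q ** diag s ** transpose R"
    using compact_svd_exists[OF assms(1), of "hor_lift U D"] by blast
  then have "svd_tangent U Q s R D"
    using hor_lift_tangent[OF assms(2,3)] assms by (auto simp: svd_tangent_def intro!: horizontal_svd[OF svd(3)])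
  then show ?thesis by blast
qed

text \<open>The place where membership in the cut locus is exploited: at the cut time the largest
  angle is \<pi>/2, so its cosine vanishes and U^T F U is singular.\<close>

lemma cut_locus_rotation:
  fixes U :: "real^'p^'n"
  assumes card: "CARD('p) \<le> CARD('n)" and U: "U \<in> stiefel" and F: "F \<in> cut_locus CARD('p) (proj U)"
  shows "\<exists>R c. orthogonal_matrix R \<and> transpose U ** F ** U = R ** diag c ** transpose R \<and> (\<exists>i. c i = 0)"
proof -
  obtain D where Dt: "D \<in> tangent (proj U)" and D0: "D \<noteq> 0"
    and FD: "F = gr_exp (proj U) (cut_time CARD('p) (proj U) D *\<^sub>R D)"
    using F by (auto simp: cut_locus_def)
  obtain Q s R where "svd_tangent U Q s R D"
    using svd_tangent_exists[OF card U Dt] by blast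
  then interpret svd_tangent U Q s R D .
  obtain i where i: "s i = Max (range s)"
    using Max_in[of "range s"] by (auto simp: image_iff)
  have "cut_time CARD('p) (proj U) D * s i = pi / 2"
    using cut_time[OF D0] by (simp add: i)
  then have "(cos (cut_time CARD('p) (proj U) D * s i))\<^sup>2 = 0"
    by (simp only: cos_pi_half) simp
  then show ?thesis
    unfolding FD exp projected_proj_rotation_curve[OF U R UQ]
    using R by (intro exI[of _ R] exI[of _ "\<lambda>i. (cos (cut_time CARD('p) (proj U) D * s i))\<^sup>2"] conjI) blast+
qed

section \<open>The Extended Grassmann Logarithm\<close>

text \<open>With Y = c M for the end frame c, the SVD of Y^T U with factors M^T, cos s, R makes the
  aligned frame of the procedure equal to c R^T. Its part orthogonal to \<open>U\<close> is then Q
  (sin s) R^T, and arcsin undoes sin because s \<le> \<pi>/2.\<close>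

lemma rotation_eq_ext_log:
  fixes U Y :: "real^'p^'n"
  assumes U: "U \<in> stiefel" and Y: "Y \<in> stiefel" and Q: "Q \<in> stiefel" and R: "orthogonal_matrix R"
    and s: "\<And>i. 0 \<le> s i" "\<And>i. s i \<le> pi / 2" and UQ: "transpose U ** (Q ** diag s) = 0"
    and eq: "proj (rotation_curve (U ** R) Q s 1) = proj Y"
  shows "ext_log_output U Y (Q ** diag s ** transpose R)"
proof -
  define c where "c = rotation_curve (U ** R) Q s 1"
  have c: "c \<in> stiefel"
    unfolding c_def using rotation_curve_stiefel[OF stiefel_mult_orthogonal[OF U R] Q horizontal_mult_orthogonal[OF UQ]] .
  obtain M where M: "orthogonal_matrix M" and Yc: "Y = c ** M"
    using proj_eqD[OF Y c] eq unfolding c_def by auto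
  have Uc: "transpose U ** c = R ** diag (\<lambda>i. cos (s i))"
    unfolding c_def using projected_rotation_curve[OF U R UQ, of 1] by simp
  have "transpose Y ** U = transpose M ** transpose (transpose U ** c)"
    by (simp add: Yc matrix_mul_assoc)
  then have "square_svd (transpose Y ** U) (transpose M) (diag (\<lambda>i. cos (s i))) R"
    using M R s by (auto simp: square_svd_def Uc matrix_mul_assoc nonneg_diagonal_def intro!: cos_ge_zero order_trans[OF _ s(1)])
  moreover have "compact_svd ((mat 1 - U ** transpose U) ** (Y ** transpose M ** transpose R)) Q (diag (\<lambda>i. sin (s i))) R"
  proof -
    have "(mat 1 - U ** transpose U) ** c = c - U ** (transpose U ** c)"
      by (simp add: matrix_mult.diff_left matrix_mul_assoc)
    also have "\<dots> = Q ** diag (\<lambda>i. sin (s i))"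
      unfolding Uc by (simp add: c_def rotation_curve_def matrix_mul_assoc)
    finally have "(mat 1 - U ** transpose U) ** c ** transpose R = Q ** diag (\<lambda>i. sin (s i)) ** transpose R"
      by simp
    moreover have "Y ** transpose M ** transpose R = c ** transpose R"
      by (simp add: Yc orthogonal_matrix_cancel[OF M])
    moreover have "0 \<le> sin (s i)" for i
      using s[of i] by (intro sin_ge_zero) auto
    ultimately show ?thesis
      using Q R by (simp add: compact_svd_def nonneg_diagonal_def matrix_mul_assoc)
  qed
  moreover have "diag_apply arcsin (diag (\<lambda>i. sin (s i))) = diag s"
  proof -
    have "arcsin (sin (s i)) = s i" for i
      using s[of i] by (intro arcsin_sin) auto
    then show ?thesis by simp
  qed
  ultimately show ?thesis
    unfolding ext_log_output_def by metis
qed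

text \<open>The two SVDs of the procedure are chosen independently, so \<open>R1\<close> and
  \<open>R2\<close> may differ. Orthonormality of the aligned frame \<open>Y'\<close> relates them:
  T = R2^T R1 intertwines b^2 with 1 - a^2, hence, all values being nonnegative, cos(arcsin b) with
  a. So the cosine part can be rewritten with \<open>R2\<close>.\<close>

lemma ext_log_rotation:
  fixes U Y :: "real^'p^'n"
  assumes U: "U \<in> stiefel" and Y: "Y \<in> stiefel" and X: "ext_log_output U Y X"
  shows "\<exists>Q s R. Q \<in> stiefel \<and> orthogonal_matrix R \<and> (\<forall>i. 0 \<le> s i \<and> s i \<le> pi / 2) \<and>
    X = Q ** diag s ** transpose R \<and> proj (rotation_curve (U ** R) Q s 1) = proj Y"
proof -
  obtain Q1 S1 R1 Y' Q2 S2 R2 where svd1: "square_svd (transpose Y ** U) Q1 S1 R1"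
    and Y': "Y' = Y ** Q1 ** transpose R1"
    and svd2: "compact_svd ((mat 1 - U ** transpose U) ** Y') Q2 S2 R2"
    and Xeq: "X = Q2 ** diag_apply arcsin S2 ** transpose R2"
    using X by (auto simp: ext_log_output_def)
  obtain a where S1: "S1 = diag a" and a: "\<And>i. 0 \<le> a i"
    using svd1 by (auto simp: square_svd_def nonneg_diagonal_iff)
  obtain b where S2: "S2 = diag b" and b: "\<And>i. 0 \<le> b i"
    using svd2 by (auto simp: compact_svd_def nonneg_diagonal_iff)
  have Q1: "orthogonal_matrix Q1" and R1: "orthogonal_matrix R1"
    and YU: "transpose Y ** U = Q1 ** diag a ** transpose R1"
    using svd1 by (auto simp: square_svd_def S1)
  have Q2: "Q2 \<in> stiefel" and R2: "orthogonal_matrix R2"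
    and NY': "(mat 1 - U ** transpose U) ** Y' = Q2 ** diag b ** transpose R2"
    using svd2 by (auto simp: compact_svd_def S2)
  have UY: "transpose U ** Y = R1 ** diag a ** transpose Q1"
    using arg_cong[OF YU, of transpose] by (simp add: matrix_mul_assoc)
  have UY': "transpose U ** Y' = R1 ** diag a ** transpose R1"
    by (simp add: Y' matrix_mul_assoc UY orthogonal_matrix_cancel[OF Q1])
  have Y'S: "Y' \<in> stiefel"
    unfolding Y' using Q1 R1 Y by (intro stiefel_mult_orthogonal) auto
  define N where "N = Q2 ** diag b ** transpose R2"
  have UN: "transpose U ** N = 0"
    unfolding N_def NY'[symmetric]
    by (simp add: matrix_mult.diff_left matrix_mult.diff_right stiefel_cancel[OF U] flip: matrix_mul_assoc)
  have split: "Y' = U ** (R1 ** diag a ** transpose R1) + N"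
    using NY' unfolding N_def UY'[symmetric] by (simp add: matrix_mult.diff_left matrix_mul_assoc algebra_simps)
  have "transpose N ** U = 0"
    using arg_cong[OF UN, of transpose] by (simp add: transpose_zero)
  then have NU: "transpose N ** (U ** A) = 0" for A :: "real^'p^'p"
    by (simp add: matrix_mul_assoc matrix_mult.zero_left)
  have "mat 1 = transpose (U ** (R1 ** diag a ** transpose R1) + N) ** (U ** (R1 ** diag a ** transpose R1) + N)"
    using stiefelD[OF Y'S] by (simp add: split)
  also have "\<dots> = R1 ** diag (\<lambda>i. (a i)\<^sup>2) ** transpose R1 + transpose N ** N"
  proof -
    have "diag (\<lambda>i. (a i)\<^sup>2) = diag a ** diag a" by (simp add: diag_mult_diag power2_eq_square)
    then show ?thesis
      by (simp add: transpose_add matrix_mult.add_left matrix_mult.add_right NU UN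
          stiefel_cancel[OF U] orthogonal_matrix_cancel[OF R1] matrix_mult.zero_right flip: matrix_mul_assoc)
  qed
  also have "transpose N ** N = R2 ** diag (\<lambda>i. (b i)\<^sup>2) ** transpose R2"
  proof -
    have "diag (\<lambda>i. (b i)\<^sup>2) = diag b ** diag b" by (simp add: diag_mult_diag power2_eq_square)
    then show ?thesis
      by (simp add: N_def stiefel_cancel[OF Q2] flip: matrix_mul_assoc)
  qed
  finally have one: "R2 ** diag (\<lambda>i. (b i)\<^sup>2) ** transpose R2 = mat 1 - R1 ** diag (\<lambda>i. (a i)\<^sup>2) ** transpose R1"
    by (simp add: algebra_simps)
  also have "\<dots> = R1 ** diag (\<lambda>i. 1 - (a i)\<^sup>2) ** transpose R1"
  proof -
    have "diag (\<lambda>i. 1 - (a i)\<^sup>2) = mat 1 - diag (\<lambda>i. (a i)\<^sup>2)" by (simp add: vec_eq_iff mat_def)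
    then show ?thesis
      by (simp add: matrix_mult.diff_left matrix_mult.diff_right orthogonal_matrixD[OF R1])
  qed
  finally have conj: "R1 ** diag (\<lambda>i. 1 - (a i)\<^sup>2) ** transpose R1 = R2 ** diag (\<lambda>i. (b i)\<^sup>2) ** transpose R2" ..
  define T where "T = transpose R2 ** R1"
  have T: "orthogonal_matrix T"
    unfolding T_def using R1 R2 by (intro orthogonal_matrix_mul) auto
  have ab: "T $ i $ j = 0 \<or> (b i)\<^sup>2 = 1 - (a j)\<^sup>2" for i j
    using conj_eq_intertwine[OF R1 R2 conj] unfolding T_def[symmetric] intertwine_iff by blast
  have b1: "b i \<le> 1" for i
  proof -
    \<comment> \<open>A row of \<open>T\<close> has norm 1. A nonzero entry links \<open>b i\<close>
      to some \<open>a j\<close> and so gives \<open>b i \<le> 1\<close>, without which arcsin would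
      be meaningless.\<close>
    have "\<exists>j. T $ i $ j \<noteq> 0"
      using orthogonal_matrix_sum_rows[OF T, of i] by (rule contrapos_pp) simp
    then obtain j where "(b i)\<^sup>2 = 1 - (a j)\<^sup>2" using ab[of i] by blast
    then have "(b i)\<^sup>2 \<le> 1" by simp
    then show ?thesis using b[of i] by (simp add: power2_le_iff_abs_le[of 1, simplified])
  qed
  define s where "s i = arcsin (b i)" for i
  have bge: "- 1 \<le> b i" for i using b[of i] by simp
  have s: "0 \<le> s i" "s i \<le> pi / 2" for i
    using arcsin_le_arcsin[of 0 "b i"] arcsin_bounded[OF bge b1] b[of i] b1[of i] by (auto simp: s_def)
  have sins: "sin (s i) = b i" for i
    unfolding s_def by (rule sin_arcsin[OF bge b1])
  have "cos (s i) = a j" if "T $ i $ j \<noteq> 0" for i j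
  proof -
    have "(cos (s i))\<^sup>2 = (a j)\<^sup>2"
      using ab[of i j] that by (simp add: cos_squared_eq sins)
    then show ?thesis
      using a[of j] cos_ge_zero[of "s i"] s[of i] by (simp add: power2_eq_iff_nonneg)
  qed
  then have cosT: "diag (\<lambda>i. cos (s i)) ** T = T ** diag a"
    unfolding intertwine_iff by blast
  have "Y' ** R2 = U ** R2 ** (T ** diag a) ** transpose T + Q2 ** diag b"
    unfolding split
    by (simp add: matrix_mult.add_left N_def T_def orthogonal_matrix_cancel[OF R2] orthogonal_matrixD[OF R2]
        flip: matrix_mul_assoc)
  also have "\<dots> = rotation_curve (U ** R2) Q2 s 1"
    unfolding cosT[symmetric] rotation_curve_def
    by (simp add: orthogonal_matrixD[OF T] sins flip: matrix_mul_assoc)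
  finally have "rotation_curve (U ** R2) Q2 s 1 = Y ** (Q1 ** transpose R1 ** R2)"
    by (simp add: Y' matrix_mul_assoc)
  moreover have "orthogonal_matrix (Q1 ** transpose R1 ** R2)"
    using Q1 R1 R2 by (intro orthogonal_matrix_mul) auto
  ultimately have "proj (rotation_curve (U ** R2) Q2 s 1) = proj Y"
    by (simp add: proj_mult_orthogonal)
  moreover have "X = Q2 ** diag s ** transpose R2"
    by (simp add: Xeq S2 s_def[abs_def])
  ultimately show ?thesis
    by (intro exI[of _ Q2] exI[of _ s] exI[of _ R2] conjI allI Q2 R2 s)
qed

section \<open>The matrices \<open>diag(W, I)\<close>\<close>

lemma index_pos_less: "i < j \<Longrightarrow> index_pos i < index_pos j"
  unfolding index_pos_def by (intro psubset_card_mono) auto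

lemma inj_index_pos: "inj index_pos"
  by (rule injI) (metis index_pos_less less_irrefl linorder_neqE)

lemma index_pos_range: "range (index_pos :: 'p::{finite,linorder} \<Rightarrow> nat) = {..<CARD('p)}"
proof (rule card_subset_eq)
  have "index_pos i < CARD('p)" for i :: 'p
    unfolding index_pos_def by (intro psubset_card_mono) auto
  then show "range (index_pos :: 'p \<Rightarrow> nat) \<subseteq> {..<CARD('p)}" by auto
  show "card (range (index_pos :: 'p \<Rightarrow> nat)) = card {..<CARD('p)}"
    by (simp add: card_image[OF inj_index_pos])
qed simp

text \<open>Meant for the indices of the singular values \<pi>/2: sorted in descending order they
  form an initial segment, hence are the first \<open>r\<close> indices.\<close>

lemma index_pos_less_card_iff:
  fixes A :: "'p::{finite,linorder} set"
  assumes "\<And>i j. i \<le> j \<Longrightarrow> j \<in> A \<Longrightarrow> i \<in> A"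
  shows "index_pos i < card A \<longleftrightarrow> i \<in> A"
proof
  assume "i \<in> A"
  then have "{k. k < i} \<subset> A" using assms[of _ i] by (auto simp: less_imp_le)
  then show "index_pos i < card A" unfolding index_pos_def by (intro psubset_card_mono) auto
next
  assume "index_pos i < card A"
  show "i \<in> A"
  proof (rule ccontr)
    assume "i \<notin> A"
    then have "A \<subseteq> {k. k < i}" using assms by (auto simp: not_le[symmetric])
    then have "card A \<le> index_pos i" unfolding index_pos_def by (intro card_mono) auto
    with \<open>index_pos i < card A\<close> show False by simp
  qed
qed

lemma transpose_block_diag: "transpose (block_diag r W) = block_diag r (\<lambda>i j. W j i)"
  by (auto simp: block_diag_def transpose_def vec_eq_iff)

lemma sum_index_pos:
  assumes "r \<le> CARD('p::{finite,linorder})"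
  shows "(\<Sum>k\<in>{k :: 'p::{finite,linorder}. index_pos k < r}. f (index_pos k)) = (\<Sum>k<r. f k :: real)"
proof (rule sum.reindex_cong[symmetric, of index_pos])
  show "inj_on index_pos {k :: 'p. index_pos k < r}"
    using inj_index_pos inj_on_subset by blast
  have "{..<r} \<subseteq> range (index_pos :: 'p \<Rightarrow> nat)"
    using assms by (simp add: index_pos_range)
  then show "{..<r} = index_pos ` {k :: 'p. index_pos k < r}" by auto
qed simp

lemma orthogonal_block_diag:
  assumes "r \<le> CARD('p::{finite,linorder})" "orthogonal_upto r W"
  shows "orthogonal_matrix (block_diag r W :: real^('p::{finite,linorder})^('p::{finite,linorder}))"
proof -
  define B where "B = (block_diag r W :: real^('p::{finite,linorder})^('p::{finite,linorder}))"
  have "(\<Sum>k\<in>UNIV. B $ k $ i * B $ k $ j) = (if i = j then 1 else 0)" for i j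
  proof (cases "index_pos i < r \<and> index_pos j < r")
    case True
    have "(\<Sum>k\<in>UNIV. B $ k $ i * B $ k $ j)
        = (\<Sum>k\<in>{k. index_pos k < r}. B $ k $ i * B $ k $ j)"
      using True by (intro sum.mono_neutral_right) (auto simp: B_def block_diag_def)
    also have "\<dots> = (\<Sum>k\<in>{k :: 'p. index_pos k < r}. W (index_pos k) (index_pos i) * W (index_pos k) (index_pos j))"
      using True by (intro sum.cong) (auto simp: B_def block_diag_def)
    also have "\<dots> = (\<Sum>k<r. W k (index_pos i) * W k (index_pos j))"
      by (rule sum_index_pos[OF assms(1)])
    also have "\<dots> = (if i = j then 1 else 0)"
      using assms(2) True inj_eq[OF inj_index_pos, of i j] by (simp add: orthogonal_upto_def)
    finally show ?thesis .
  next
    case False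
    then consider "\<not> index_pos i < r" | "\<not> index_pos j < r" by blast
    then show ?thesis
    proof cases
      case 1
      then have "B $ k $ i = (if k = i then 1 else 0)" for k
        by (simp add: B_def block_diag_def)
      then have "(\<Sum>k\<in>UNIV. B $ k $ i * B $ k $ j) = B $ i $ j"
        by (simp add: if_distrib[of "\<lambda>x. x * _"] sum.delta cong: if_cong)
      with 1 show ?thesis by (simp add: B_def block_diag_def)
    next
      case 2
      then have "B $ k $ j = (if k = j then 1 else 0)" for k
        by (simp add: B_def block_diag_def)
      then have "(\<Sum>k\<in>UNIV. B $ k $ i * B $ k $ j) = B $ j $ i"
        by (simp add: if_distrib[of "(*) _"] sum.delta cong: if_cong)
      with 2 show ?thesis by (auto simp: B_def block_diag_def)
    qed
  qed
  then show ?thesis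
    unfolding B_def[symmetric] by (simp add: orthogonal_matrix vec_eq_iff matrix_mult_nth transpose_def mat_def)
qed

text \<open>Only the rows outside the block are prescribed. The columns follow: such a column has
  norm 1 and already a 1 on the diagonal, so its other entries vanish.\<close>

lemma block_diag_exists:
  fixes N :: "real^('p::{finite,linorder})^('p::{finite,linorder})"
  assumes r: "r \<le> CARD('p::{finite,linorder})" and N: "orthogonal_matrix N"
    and rows: "\<And>i j. \<not> index_pos i < r \<Longrightarrow> N $ i $ j = (if i = j then 1 else 0)"
  shows "\<exists>W. orthogonal_upto r W \<and> N = block_diag r W"
proof -
  define g :: "nat \<Rightarrow> 'p" where "g = inv index_pos"
  have g: "g (index_pos i) = i" for i
    unfolding g_def by (rule inv_f_f[OF inj_index_pos])
  have pos_g: "index_pos (g k) = k" if "k < r" for k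
    unfolding g_def by (rule f_inv_into_f) (use that r in \<open>simp add: index_pos_range\<close>)
  define W where "W a b = N $ g a $ g b" for a b
  have cols: "N $ i $ j = (if i = j then 1 else 0)" if j: "\<not> index_pos j < r" for i j
  proof (cases "i = j")
    case False
    have "(\<Sum>i\<in>UNIV. (N $ i $ j)\<^sup>2) = (N $ j $ j)\<^sup>2 + (\<Sum>i\<in>UNIV - {j}. (N $ i $ j)\<^sup>2)"
      by (rule sum.remove) auto
    then have "(\<Sum>i\<in>UNIV - {j}. (N $ i $ j)\<^sup>2) = 0"
      using orthogonal_matrix_sum_columns[OF N, of j] rows[OF j, of j] by simp
    then have "\<forall>i\<in>UNIV - {j}. (N $ i $ j)\<^sup>2 = 0"
      by (subst (asm) sum_nonneg_eq_0_iff) auto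
    with False show ?thesis by simp
  qed (use rows j in simp)
  have block: "N = block_diag r W"
    using rows cols by (auto simp: block_diag_def vec_eq_iff W_def g)
  have "(\<Sum>k<r. W k a * W k b) = (if a = b then 1 else 0)" if ab: "a < r" "b < r" for a b
  proof -
    have "(\<Sum>k<r. W k a * W k b) = (\<Sum>k\<in>{k :: 'p. index_pos k < r}. W (index_pos k) a * W (index_pos k) b)"
      by (rule sum_index_pos[OF r, symmetric])
    also have "\<dots> = (\<Sum>k\<in>{k :: 'p. index_pos k < r}. N $ k $ g a * N $ k $ g b)"
      by (simp add: W_def g)
    also have "\<dots> = (\<Sum>k\<in>UNIV. N $ k $ g a * N $ k $ g b)"
      using rows pos_g[OF ab(1)] ab(1) by (intro sum.mono_neutral_left) auto
    also have "\<dots> = (transpose N ** N) $ g a $ g b"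
      by (simp add: matrix_mult_nth transpose_def)
    also have "\<dots> = (if a = b then 1 else 0)"
    proof -
      have "g a = g b \<longleftrightarrow> a = b" using pos_g[OF ab(1)] pos_g[OF ab(2)] by metis
      then show ?thesis by (simp add: orthogonal_matrixD[OF N] mat_def)
    qed
    finally show ?thesis .
  qed
  then have "orthogonal_upto r W" by (simp add: orthogonal_upto_def)
  with block show ?thesis by blast
qed

lemma block_diag_absorb:
  assumes "\<And>i :: 'p::{finite,linorder}. index_pos i < r \<Longrightarrow> a i = 0"
  shows "block_diag r W ** diag a = diag a"
  using assms by (auto simp: vec_eq_iff block_diag_def)

section \<open>Minimizing geodesics with the same endpoint\<close>

text \<open>The end frames differ by an orthogonal \<open>M\<close>. Splitting along U U^T and its
  complement gives one equation for the cosine parts and one for the sine parts. As cos is injective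
  on [0, \<pi>/2], \<open>M\<close> intertwines \<open>s\<close> and \<open>s'\<close>, so the sine
  equation can be multiplied by s / sin s to compare the lifts.\<close>

lemma rotation_same_endpoint:
  fixes U :: "real^'p^'n"
  assumes "svd_tangent U Q s R D" and "svd_tangent U Q' s' R' D'"
    and s: "\<And>i. s i \<le> pi / 2" and s': "\<And>i. s' i \<le> pi / 2"
    and eq: "proj (rotation_curve (U ** R) Q s 1) = proj (rotation_curve (U ** R') Q' s' 1)"
  shows "\<exists>N. orthogonal_matrix N \<and> Q' ** diag s' ** transpose R' = Q ** diag s ** N ** transpose R \<and>
    diag (\<lambda>i. cos (s i)) ** N = diag (\<lambda>i. cos (s i))"
proof -
  interpret A: svd_tangent U Q s R D by fact
  interpret B: svd_tangent U Q' s' R' D' by fact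
  have U: "U \<in> stiefel" and R: "orthogonal_matrix R" and R': "orthogonal_matrix R'"
    by (fact A.U A.R B.R)+
  define c where "c = rotation_curve (U ** R) Q s 1"
  define c' where "c' = rotation_curve (U ** R') Q' s' 1"
  have c: "c \<in> stiefel" "c' \<in> stiefel"
    unfolding c_def c'_def by (rule rotation_curve_stiefel[OF A.UR A.Q A.URQ] rotation_curve_stiefel[OF B.UR B.Q B.URQ])+
  obtain M where M: "orthogonal_matrix M" and cM: "c' = c ** M"
    using proj_eqD[OF c(2,1)] eq unfolding c_def c'_def by auto
  have cos_part: "R' ** diag (\<lambda>i. cos (s' i)) = R ** diag (\<lambda>i. cos (s i)) ** M"
    using arg_cong[OF cM, of "\<lambda>A. transpose U ** A"]
      projected_rotation_curve[OF U R A.UQ, of 1] projected_rotation_curve[OF U R' B.UQ, of 1]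
    by (simp add: c_def c'_def matrix_mul_assoc)
  have sin_part: "Q' ** diag (\<lambda>i. sin (s' i)) = Q ** diag (\<lambda>i. sin (s i)) ** M"
  proof -
    have "Q' ** diag (\<lambda>i. sin (s' i)) = c' - U ** (R' ** diag (\<lambda>i. cos (s' i)))"
      by (simp add: c'_def rotation_curve_def matrix_mul_assoc)
    also have "\<dots> = (c - U ** R ** diag (\<lambda>i. cos (s i))) ** M"
      unfolding cos_part cM by (simp add: matrix_mult.diff_left matrix_mul_assoc)
    also have "c - U ** R ** diag (\<lambda>i. cos (s i)) = Q ** diag (\<lambda>i. sin (s i))"
      by (simp add: c_def rotation_curve_def)
    finally show ?thesis .
  qed
  have cos_inj: "x = y" if "(cos x)\<^sup>2 = (cos y)\<^sup>2" "0 \<le> x" "x \<le> pi / 2" "0 \<le> y" "y \<le> pi / 2" for x y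
  proof -
    have "cos x = cos y"
      using that cos_ge_zero[of x] cos_ge_zero[of y] by (simp add: power2_eq_iff_nonneg)
    moreover have "x \<le> pi" "y \<le> pi" using that pi_ge_zero by linarith+
    ultimately show ?thesis using that(2,4) cos_inj_pi by blast
  qed
  have sq: "diag (\<lambda>i. (cos (t i))\<^sup>2) = diag (\<lambda>i. cos (t i)) ** diag (\<lambda>i. cos (t i))" for t :: "'p \<Rightarrow> real"
    by (simp add: diag_mult_diag power2_eq_square)
  have sM: "M $ i $ j = 0 \<or> s i = s' j" for i j
  proof -
    have "diag (\<lambda>i. (cos (s i))\<^sup>2) ** M = M ** diag (\<lambda>i. (cos (s' i))\<^sup>2)"
    proof -
      have "diag (\<lambda>i. (cos (s' i))\<^sup>2) = transpose (R' ** diag (\<lambda>i. cos (s' i))) ** (R' ** diag (\<lambda>i. cos (s' i)))"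
        unfolding sq by (simp add: orthogonal_matrix_cancel[OF R'] flip: matrix_mul_assoc)
      also have "\<dots> = transpose M ** (diag (\<lambda>i. (cos (s i))\<^sup>2) ** M)"
        unfolding sq cos_part by (simp add: orthogonal_matrix_cancel[OF R] flip: matrix_mul_assoc)
      finally show ?thesis by (simp add: orthogonal_matrix_cancel[OF M])
    qed
    then have "M $ i $ j = 0 \<or> (cos (s i))\<^sup>2 = (cos (s' j))\<^sup>2"
      unfolding intertwine_iff by blast
    then show ?thesis using cos_inj A.s B.s s s' by blast
  qed
  \<comment> \<open>A second intertwiner of \<open>s\<close> and \<open>s'\<close>. It lets the
    cosine equation be written as cos(s) M = cos(s) O', and \<open>N\<close> is \<open>M\<close>
    multiplied by the inverse of \<open>O'\<close>.\<close>
  define O' where "O' = transpose R ** R'"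
  have O': "orthogonal_matrix O'"
    unfolding O'_def using R R' by (intro orthogonal_matrix_mul) auto
  have sO: "O' $ i $ j = 0 \<or> s i = s' j" for i j
  proof -
    have "R' ** diag (\<lambda>i. (cos (s' i))\<^sup>2) ** transpose R'
        = (R' ** diag (\<lambda>i. cos (s' i))) ** transpose (R' ** diag (\<lambda>i. cos (s' i)))"
      unfolding sq by (simp add: matrix_mul_assoc)
    also have "\<dots> = R ** diag (\<lambda>i. (cos (s i))\<^sup>2) ** transpose R"
      unfolding sq cos_part by (simp add: matrix_mul_assoc orthogonal_matrix_cancel[OF M])
    finally have "diag (\<lambda>i. (cos (s i))\<^sup>2) ** O' = O' ** diag (\<lambda>i. (cos (s' i))\<^sup>2)"
      unfolding O'_def by (rule conj_eq_intertwine[OF R' R])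
    then have "O' $ i $ j = 0 \<or> (cos (s i))\<^sup>2 = (cos (s' j))\<^sup>2"
      unfolding intertwine_iff by blast
    then show ?thesis using cos_inj A.s B.s s s' by blast
  qed
  define N where "N = M ** transpose R' ** R"
  have "orthogonal_matrix N"
    unfolding N_def using M R R' by (intro orthogonal_matrix_mul) auto
  moreover have "Q' ** diag s' ** transpose R' = Q ** diag s ** N ** transpose R"
  proof -
    \<comment> \<open>At 0 division yields \<open>h 0 = 0\<close>, which is harmless as both sides
      of x = sin x * h x vanish there.\<close>
    define h where "h x = x / sin x" for x :: real
    have h: "diag t = diag (\<lambda>i. sin (t i)) ** diag (\<lambda>i. h (t i))"
      if "\<And>i. 0 \<le> t i" "\<And>i. t i \<le> pi / 2" for t :: "'p \<Rightarrow> real"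
    proof -
      have "t i = sin (t i) * h (t i)" for i
        using that[of i] sin_gt_zero[of "t i"] by (cases "t i = 0") (auto simp: h_def)
      then show ?thesis by (simp add: diag_mult_diag)
    qed
    have "diag (\<lambda>i. h (s i)) ** M = M ** diag (\<lambda>i. h (s' i))"
      unfolding intertwine_iff using sM by metis
    then have "Q' ** diag s' = Q ** diag s ** M"
      unfolding h[of s, OF A.s s] h[of s', OF B.s s']
      by (simp add: matrix_mul_assoc sin_part) (simp flip: matrix_mul_assoc)
    then show ?thesis
      unfolding N_def by (simp add: matrix_mul_assoc orthogonal_matrix_cancel[OF R])
  qed
  moreover have "diag (\<lambda>i. cos (s i)) ** N = diag (\<lambda>i. cos (s i))"
  proof -
    have "diag (\<lambda>i. cos (s i)) ** M = transpose R ** (R' ** diag (\<lambda>i. cos (s' i)))"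
      unfolding cos_part by (simp add: orthogonal_matrix_cancel[OF R] flip: matrix_mul_assoc)
    also have "\<dots> = diag (\<lambda>i. cos (s i)) ** O'"
    proof -
      have "diag (\<lambda>i. cos (s i)) ** O' = O' ** diag (\<lambda>i. cos (s' i))"
        unfolding intertwine_iff using sO by metis
      then show ?thesis by (simp add: O'_def matrix_mul_assoc)
    qed
    finally have "diag (\<lambda>i. cos (s i)) ** N = diag (\<lambda>i. cos (s i)) ** (O' ** (transpose R' ** R))"
      by (simp add: N_def matrix_mul_assoc)
    also have "O' ** (transpose R' ** R) = mat 1"
      by (simp add: O'_def orthogonal_matrix_cancel[OF R'] orthogonal_matrixD[OF R] flip: matrix_mul_assoc)
    finally show ?thesis by simp
  qed
  ultimately show ?thesis by blast
qed

theorem theorem5p5: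
  fixes U Y :: "real^('p::{finite,linorder})^'n"
    and P F :: "real^'n^'n"
    and \<theta> :: "'p \<Rightarrow> real"
    and p r :: nat
  assumes "p = CARD('p)" and "p \<le> CARD('n)"
    and "U \<in> stiefel" and "Y \<in> stiefel"
    and "P = U ** transpose U" and "F = Y ** transpose Y"
    and "F \<in> cut_locus p P"
    and "principal_angles U Y \<theta>"
    and "r = card {k. \<theta> k = pi / 2}"
  shows "(\<forall>\<Delta> \<in> tangent P.
            (\<Delta> \<in> tangent_cut_locus p P \<and> minimizing_solution p P F \<Delta>)
              \<longleftrightarrow> ext_log_output U Y (hor_lift U \<Delta>)) \<and>
         (\<forall>\<Delta> Q S R.
            \<Delta> \<in> tangent_cut_locus p P \<and> minimizing_solution p P F \<Delta> \<and>
            compact_svd (hor_lift U \<Delta>) Q S R \<and> descending_diagonal S \<longrightarrow>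
              hor_lift U ` {\<Delta>'. minimizing_solution p P F \<Delta>'} =
                {Q ** S ** block_diag r W ** transpose R | W. orthogonal_upto r W} \<and>
              (\<forall>W \<Delta>\<^sub>W. orthogonal_upto r W \<and> \<Delta>\<^sub>W \<in> tangent P \<and>
                 hor_lift U \<Delta>\<^sub>W = Q ** S ** block_diag r W ** transpose R \<longrightarrow>
                   (\<forall>t. geodesic_rep U Q S R r W t \<in> stiefel \<and>
                        gr_exp P (t *\<^sub>R \<Delta>\<^sub>W) = proj (geodesic_rep U Q S R r W t))) \<and>
              (\<forall>\<gamma>. shortest_geodesic p P F \<gamma> \<longleftrightarrow>
                 (\<exists>W. orthogonal_upto r W \<and>
                    (\<forall>t\<in>{0..1}. \<gamma> t = proj (geodesic_rep U Q S R r W t)))))"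
proof -
  have card: "CARD('p) \<le> CARD('n)" and U: "U \<in> stiefel" and Y: "Y \<in> stiefel"
    using assms by auto
  have p: "p = CARD('p)" and P: "P = proj U" and F: "F = proj Y"
    using assms by (auto simp: proj_def)
  obtain Q1 a R1 where Q1: "orthogonal_matrix Q1" and R1: "orthogonal_matrix R1"
    and UY: "transpose U ** Y = Q1 ** diag a ** transpose R1"
    and a: "\<And>i. 0 \<le> a i" and \<theta>: "\<And>k. \<theta> k = arccos (a k)"
    using assms(8) by (auto simp: principal_angles_def singular_values_def square_svd_def nonneg_diagonal_def)
  have a1: "a i \<le> 1" for i
    by (rule connecting_rotation(1)[OF card U Y Q1 R1 UY a])
  \<comment> \<open>Stated with squares because they are the eigenvalues of U^T F U:
    \<open>r\<close> becomes the multiplicity of 0, which depends only on \<open>U\<close> and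
    \<open>F\<close>.\<close>
  have "\<theta> k = pi / 2 \<longleftrightarrow> (a k)\<^sup>2 = 0" for k
  proof -
    have "- 1 \<le> a k" using a[of k] by simp
    then have "cos (\<theta> k) = a k" unfolding \<theta> using a1 by (rule cos_arccos)
    moreover have "arccos 0 = pi / 2" by simp
    ultimately show ?thesis using \<theta>[of k] by (metis cos_pi_half power_zero_numeral zero_eq_power2)
  qed
  then have r: "r = card {k. (a k)\<^sup>2 = 0}"
    using assms(9) by simp
  have UFU: "transpose U ** F ** U = Q1 ** diag (\<lambda>i. (a i)\<^sup>2) ** transpose Q1"
  proof -
    have "transpose U ** F ** U = (transpose U ** Y) ** transpose (transpose U ** Y)"
      by (simp add: F proj_def matrix_mul_assoc)
    moreover have "diag (\<lambda>i. (a i)\<^sup>2) = diag a ** diag a"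
      by (simp add: diag_mult_diag power2_eq_square)
    ultimately show ?thesis
      unfolding UY by (simp add: orthogonal_matrix_cancel[OF R1] flip: matrix_mul_assoc)
  qed
  obtain R2 c where R2: "orthogonal_matrix R2" "transpose U ** F ** U = R2 ** diag c ** transpose R2"
    and "\<exists>i. c i = 0"
    using cut_locus_rotation[OF card U] assms(7) unfolding p P by blast
  moreover have "r = card {i. c i = 0}"
    unfolding r by (rule card_conj_eq[OF Q1 R2(1)]) (use UFU R2(2) in simp)
  ultimately have r_pos: "0 < r" by (auto simp: card_gt_0_iff)
  have r_le: "r \<le> CARD('p)"
    unfolding r by (rule card_mono) auto
  \<comment> \<open>Every minimizing solution has exactly \<open>r\<close> singular values \<pi>/2,
    whichever SVD is used, since cos^2 of its singular values are the eigenvalues of U^T F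
    U.\<close>
  have r_eq: "r = card {i. s i = pi / 2}"
    if "svd_tangent U Q s R D" "\<And>i. s i \<le> pi / 2" "proj (rotation_curve (U ** R) Q s 1) = F" for Q s R D
  proof -
    interpret svd_tangent U Q s R D by fact
    have "Q1 ** diag (\<lambda>i. (a i)\<^sup>2) ** transpose Q1 = R ** diag (\<lambda>i. (cos (s i))\<^sup>2) ** transpose R"
      using projected_proj_rotation_curve[OF U R UQ, of 1] UFU that(3) by simp
    then have "r = card {i. (cos (s i))\<^sup>2 = 0}"
      unfolding r by (rule card_conj_eq[OF Q1 R])
    moreover have "(cos (s i))\<^sup>2 = 0 \<longleftrightarrow> s i = pi / 2" for i
    proof (cases "s i = pi / 2")
      case True
      then have "cos (s i) = 0" by (simp only: cos_pi_half)
      with True show ?thesis by simp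
    next
      case False
      then have "0 < cos (s i)" using s[of i] that(2)[of i] by (intro cos_gt_zero_pi) auto
      with False show ?thesis by simp
    qed
    ultimately show ?thesis by simp
  qed
  \<comment> \<open>As \<open>0 < r\<close>, some singular value is \<pi>/2, so minimizing solutions
    lie in the tangent cut locus automatically.\<close>
  have tcl: "D \<in> tangent_cut_locus p P" if "svd_tangent U Q s R D" "minimizing_solution p P F D" for Q s R D
  proof -
    interpret svd_tangent U Q s R D by fact
    have min: "\<And>i. s i \<le> pi / 2" "proj (rotation_curve (U ** R) Q s 1) = F"
      using that(2) unfolding p P minimizing_solution_iff by auto
    have "{i. s i = pi / 2} \<noteq> {}"
      using r_eq[OF that(1) min] r_pos by (metis card.empty less_irrefl)
    with min show ?thesis
      unfolding p P tangent_cut_locus_iff by auto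
  qed
  have part1: "(D \<in> tangent_cut_locus p P \<and> minimizing_solution p P F D) \<longleftrightarrow> ext_log_output U Y (hor_lift U D)"
    if D: "D \<in> tangent P" for D
  proof
    assume min: "D \<in> tangent_cut_locus p P \<and> minimizing_solution p P F D"
    obtain Q s R where "svd_tangent U Q s R D"
      using svd_tangent_exists[OF card U] D unfolding P by blast
    then interpret svd_tangent U Q s R D .
    have s_le: "\<And>i. s i \<le> pi / 2" and end_Y: "proj (rotation_curve (U ** R) Q s 1) = proj Y"
      using min unfolding p P F minimizing_solution_iff by auto
    show "ext_log_output U Y (hor_lift U D)"
      unfolding hor_lift by (rule rotation_eq_ext_log[OF U Y Q R s s_le UQ end_Y])
  next
    assume "ext_log_output U Y (hor_lift U D)"
    then obtain Q s R where Q: "Q \<in> stiefel" and R: "orthogonal_matrix R"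
      and s_le: "\<And>i. 0 \<le> s i \<and> s i \<le> pi / 2" and X: "hor_lift U D = Q ** diag s ** transpose R"
      and eq: "proj (rotation_curve (U ** R) Q s 1) = proj Y"
      using ext_log_rotation[OF U Y] by blast
    note lift = hor_lift_tangent[OF U D[unfolded P]]
    have svd: "svd_tangent U Q s R D"
      using lift s_le by (auto simp: svd_tangent_def card U Q R X intro!: horizontal_svd[OF R])
    interpret svd_tangent U Q s R D by (rule svd)
    have "minimizing_solution p P F D"
      unfolding p P F minimizing_solution_iff using s_le eq by auto
    with tcl[OF svd] show "D \<in> tangent_cut_locus p P \<and> minimizing_solution p P F D" by blast
  qed
  have part2: "hor_lift U ` {D'. minimizing_solution p P F D'} =
        {Q ** S ** block_diag r W ** transpose R | W. orthogonal_upto r W} \<and>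
      (\<forall>W D\<^sub>W. orthogonal_upto r W \<and> D\<^sub>W \<in> tangent P \<and>
         hor_lift U D\<^sub>W = Q ** S ** block_diag r W ** transpose R \<longrightarrow>
           (\<forall>t. geodesic_rep U Q S R r W t \<in> stiefel \<and>
                gr_exp P (t *\<^sub>R D\<^sub>W) = proj (geodesic_rep U Q S R r W t))) \<and>
      (\<forall>\<gamma>. shortest_geodesic p P F \<gamma> \<longleftrightarrow>
         (\<exists>W. orthogonal_upto r W \<and>
            (\<forall>t\<in>{0..1}. \<gamma> t = proj (geodesic_rep U Q S R r W t))))"
    if min: "minimizing_solution p P F D" and svd: "compact_svd (hor_lift U D) Q S R"
      and desc: "descending_diagonal S" for D Q S R
  proof -
    obtain s where S: "S = diag s" and s: "\<And>i. 0 \<le> s i"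
      using svd by (auto simp: compact_svd_def nonneg_diagonal_iff)
    have Q: "Q \<in> stiefel" and R: "orthogonal_matrix R" and X: "hor_lift U D = Q ** diag s ** transpose R"
      using svd by (auto simp: compact_svd_def S)
    note lift = hor_lift_tangent[OF U, of D]
    have DT: "D \<in> tangent (proj U)" using min by (simp add: minimizing_solution_def P)
    have svdD: "svd_tangent U Q s R D"
      using lift[OF DT] s by (auto simp: svd_tangent_def card U Q R X intro!: horizontal_svd[OF R])
    interpret svd_tangent U Q s R D by (rule svdD)
    have s_le: "\<And>i. s i \<le> pi / 2" and end_F: "proj (rotation_curve (U ** R) Q s 1) = F"
      using min unfolding p P minimizing_solution_iff by auto
    have pos_iff: "index_pos i < r \<longleftrightarrow> s i = pi / 2" for i
    proof -
      have "i \<in> {i. s i = pi / 2}" if "i \<le> j" "j \<in> {i. s i = pi / 2}" for i j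
        using desc that s_le[of i] by (force simp: descending_diagonal_def S)
      from index_pos_less_card_iff[OF this] show ?thesis
        unfolding r_eq[OF svdD s_le end_F] by simp
    qed
    define B where "B W = (block_diag r W :: real^('p::{finite,linorder})^('p::{finite,linorder}))" for W
    have B: "orthogonal_matrix (B W)" if "orthogonal_upto r W" for W
      unfolding B_def by (rule orthogonal_block_diag[OF r_le that])
    \<comment> \<open>Twisting by \<open>W\<close> amounts to replacing \<open>R\<close> by R
      diag(W^T, I), so the results of \<open>svd_tangent\<close> apply to all \<gamma>_W at
      once.\<close>
    have rep: "geodesic_rep U Q S R r W t = rotation_curve (U ** (R ** transpose (B W))) Q s t" for W t
      by (simp add: geodesic_rep_def rotation_curve_def B_def transpose_block_diag S matrix_mul_assoc)
    have RB: "orthogonal_matrix (R ** transpose (B W))" if "orthogonal_upto r W" for W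
      using R B[OF that] by (intro orthogonal_matrix_mul) auto
    have lift_W: "Q ** diag s ** transpose (R ** transpose (B W)) = Q ** S ** block_diag r W ** transpose R" for W
      by (simp add: S B_def matrix_mul_assoc)
    have svd_W: "svd_tangent U Q s (R ** transpose (B W)) (tangent_of U (Q ** S ** block_diag r W ** transpose R))"
      if "orthogonal_upto r W" for W
      unfolding lift_W[symmetric] by unfold_locales (simp_all add: card U Q RB[OF that] s UQ)
    \<comment> \<open>At time 1 the block acts only on columns whose cosine is cos(\<pi>/2) = 0, so
      even the end frame is independent of \<open>W\<close>.\<close>
    have end_W: "proj (rotation_curve (U ** (R ** transpose (B W))) Q s 1) = F" for W
    proof -
      have "transpose (B W) ** diag (\<lambda>i. cos (s i)) = diag (\<lambda>i. cos (s i))"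
        unfolding B_def transpose_block_diag
        by (rule block_diag_absorb) (simp only: pos_iff cos_pi_half)
      then have "rotation_curve (U ** (R ** transpose (B W))) Q s 1 = rotation_curve (U ** R) Q s 1"
        by (simp add: rotation_curve_def flip: matrix_mul_assoc)
      then show ?thesis by (simp add: end_F)
    qed
    have min_W: "minimizing_solution p P F (tangent_of U (Q ** S ** block_diag r W ** transpose R))"
      if "orthogonal_upto r W" for W
    proof -
      interpret W: svd_tangent U Q s "R ** transpose (B W)" "tangent_of U (Q ** S ** block_diag r W ** transpose R)"
        by (rule svd_W[OF that])
      show ?thesis
        unfolding p P W.minimizing_solution_iff using end_W s_le by blast
    qed
    have lift_min: "\<exists>W. orthogonal_upto r W \<and> hor_lift U D' = Q ** S ** block_diag r W ** transpose R"
      if min': "minimizing_solution p P F D'" for D'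
    proof -
      have "D' \<in> tangent (proj U)" using min' by (simp add: minimizing_solution_def P)
      then obtain Q' s' R' where svd': "svd_tangent U Q' s' R' D'"
        using svd_tangent_exists[OF card U] by blast
      then interpret D': svd_tangent U Q' s' R' D' .
      have s'_le: "\<And>i. s' i \<le> pi / 2" and end': "proj (rotation_curve (U ** R') Q' s' 1) = F"
        using min' unfolding p P D'.minimizing_solution_iff by auto
      obtain N where N: "orthogonal_matrix N"
        and lift': "Q' ** diag s' ** transpose R' = Q ** diag s ** N ** transpose R"
        and cosN: "diag (\<lambda>i. cos (s i)) ** N = diag (\<lambda>i. cos (s i))"
        using rotation_same_endpoint[OF svdD svd' s_le s'_le] end_F end' by auto
      \<comment> \<open>Outside the first \<open>r\<close> indices the cosine is positive and can be
        cancelled from \<open>cosN\<close>; within them it vanishes and \<open>N\<close> stays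
        free.\<close>
      have "N $ i $ j = (if i = j then 1 else 0)" if "\<not> index_pos i < r" for i j
      proof -
        have "cos (s i) * N $ i $ j = (if i = j then cos (s i) else 0)"
          using arg_cong[OF cosN, of "\<lambda>A. A $ i $ j"] by simp
        moreover have "cos (s i) > 0"
          using that s[of i] s_le[of i] unfolding pos_iff by (intro cos_gt_zero_pi) auto
        ultimately show ?thesis by (auto split: if_splits)
      qed
      then obtain W where "orthogonal_upto r W" "N = block_diag r W"
        using block_diag_exists[OF r_le N] by blast
      then show ?thesis
        using D'.hor_lift lift' by (auto simp: S)
    qed
    have geo: "geodesic_rep U Q S R r W t \<in> stiefel"
        "gr_exp P (t *\<^sub>R D\<^sub>W) = proj (geodesic_rep U Q S R r W t)"
      if W: "orthogonal_upto r W" "D\<^sub>W \<in> tangent P"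
        "hor_lift U D\<^sub>W = Q ** S ** block_diag r W ** transpose R" for W D\<^sub>W t
    proof -
      interpret W: svd_tangent U Q s "R ** transpose (B W)" "tangent_of U (Q ** S ** block_diag r W ** transpose R)"
        by (rule svd_W[OF W(1)])
      have D\<^sub>W: "D\<^sub>W = tangent_of U (Q ** S ** block_diag r W ** transpose R)"
        using hor_lift_tangent(2)[OF U] W(2,3) unfolding P by metis
      show "geodesic_rep U Q S R r W t \<in> stiefel"
        unfolding rep by (rule rotation_curve_stiefel[OF W.UR W.Q W.URQ])
      show "gr_exp P (t *\<^sub>R D\<^sub>W) = proj (geodesic_rep U Q S R r W t)"
        unfolding rep D\<^sub>W P by (rule W.exp)
    qed
    have lifts: "hor_lift U ` {D'. minimizing_solution p P F D'} =
        {Q ** S ** block_diag r W ** transpose R | W. orthogonal_upto r W}"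
    proof
      show "hor_lift U ` {D'. minimizing_solution p P F D'}
          \<subseteq> {Q ** S ** block_diag r W ** transpose R | W. orthogonal_upto r W}"
        using lift_min by blast
      show "{Q ** S ** block_diag r W ** transpose R | W. orthogonal_upto r W}
          \<subseteq> hor_lift U ` {D'. minimizing_solution p P F D'}"
      proof
        fix X assume "X \<in> {Q ** S ** block_diag r W ** transpose R | W. orthogonal_upto r W}"
        then obtain W where W: "orthogonal_upto r W" and X: "X = Q ** S ** block_diag r W ** transpose R"
          by blast
        interpret W: svd_tangent U Q s "R ** transpose (B W)" "tangent_of U (Q ** S ** block_diag r W ** transpose R)"
          by (rule svd_W[OF W])
        have "hor_lift U (tangent_of U X) = X"
          using W.hor_lift unfolding X lift_W .
        with min_W[OF W] show "X \<in> hor_lift U ` {D'. minimizing_solution p P F D'}"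
          unfolding X by (metis imageI mem_Collect_eq)
      qed
    qed
    have geodesics: "shortest_geodesic p P F \<gamma> \<longleftrightarrow>
        (\<exists>W. orthogonal_upto r W \<and> (\<forall>t\<in>{0..1}. \<gamma> t = proj (geodesic_rep U Q S R r W t)))" for \<gamma>
    proof -
      have "shortest_geodesic p P F \<gamma> \<longleftrightarrow>
          (\<exists>D'. minimizing_solution p P F D' \<and> (\<forall>t\<in>{0..1}. \<gamma> t = gr_exp P (t *\<^sub>R D')))"
      proof -
        \<comment> \<open>Both conditions on \<open>\<gamma>\<close> depend only on its values on
          [0,1], where it is the geodesic of \<open>D'\<close> and has length
          \<open>gr_norm D'\<close>.\<close>
        have key: "\<gamma> 0 = P \<and> \<gamma> 1 = F \<and> length_minimizing p 0 1 \<gamma> \<longleftrightarrow> minimizing_solution p P F D'"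
          if D': "D' \<in> tangent P" and \<gamma>: "\<forall>t\<in>{0..1}. \<gamma> t = gr_exp P (t *\<^sub>R D')" for D'
        proof -
          obtain Q' s' R' where "svd_tangent U Q' s' R' D'"
            using svd_tangent_exists[OF card U] D' unfolding P by blast
          then interpret D': svd_tangent U Q' s' R' D' .
          have "curve_length 0 1 \<gamma> = gr_norm D'"
            using curve_length_rotation_curve[OF D'.UR D'.Q D'.URQ, of 0 1 \<gamma>] \<gamma>
            by (simp add: P D'.exp D'.norm)
          moreover have "\<gamma> 0 = P" "\<gamma> 1 = gr_exp P D'"
            using \<gamma> D'.exp_0 by (simp_all add: P)
          ultimately show ?thesis
            using D' by (auto simp: length_minimizing_def minimizing_solution_def)
        qed
        have "D' \<in> tangent P" if "minimizing_solution p P F D'" for D'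
          using that by (simp add: minimizing_solution_def)
        then show ?thesis
          unfolding shortest_geodesic_def Bex_def using key by meson
      qed
      also have "\<dots> \<longleftrightarrow> (\<exists>W. orthogonal_upto r W \<and> (\<forall>t\<in>{0..1}. \<gamma> t = proj (geodesic_rep U Q S R r W t)))"
      proof
        assume "\<exists>D'. minimizing_solution p P F D' \<and> (\<forall>t\<in>{0..1}. \<gamma> t = gr_exp P (t *\<^sub>R D'))"
        then obtain D' where D': "minimizing_solution p P F D'" "\<forall>t\<in>{0..1}. \<gamma> t = gr_exp P (t *\<^sub>R D')"
          by blast
        obtain W where W: "orthogonal_upto r W" "hor_lift U D' = Q ** S ** block_diag r W ** transpose R"
          using lift_min[OF D'(1)] by blast
        have "D' \<in> tangent P" using D'(1) by (simp add: minimizing_solution_def)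
        from geo(2)[OF W(1) this W(2)] show "\<exists>W. orthogonal_upto r W \<and>
            (\<forall>t\<in>{0..1}. \<gamma> t = proj (geodesic_rep U Q S R r W t))"
          using D'(2) W(1) by auto
      next
        assume "\<exists>W. orthogonal_upto r W \<and> (\<forall>t\<in>{0..1}. \<gamma> t = proj (geodesic_rep U Q S R r W t))"
        then obtain W where W: "orthogonal_upto r W"
          "\<forall>t\<in>{0..1}. \<gamma> t = proj (geodesic_rep U Q S R r W t)"
          by blast
        interpret W: svd_tangent U Q s "R ** transpose (B W)" "tangent_of U (Q ** S ** block_diag r W ** transpose R)"
          by (rule svd_W[OF W(1)])
        show "\<exists>D'. minimizing_solution p P F D' \<and> (\<forall>t\<in>{0..1}. \<gamma> t = gr_exp P (t *\<^sub>R D'))"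
          using min_W[OF W(1)] W(2) W.exp unfolding P rep by metis
      qed
      finally show ?thesis .
    qed
    show ?thesis
      using lifts geo geodesics by (intro conjI allI impI) auto
  qed
  show ?thesis
    using part1 part2 by (intro conjI ballI allI impI) blast+
qed

end
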